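(* For any $m\geq 1$ and any pairwise distinct natural numbers $n_1,n_2,\ldots,n_m$, the diagonal action of $G$ on $\mathcal{C}_{n_1}\times\mathcal{C}_{n_2}\times\cdots\times\mathcal{C}_{n_m}$ is transitive.
   Context: $R=\mathbb{C}\langle x,y\rangle$ is the free associative $\mathbb{C}$-algebra on $x,y$, and $G$ is the group of all $\mathbb{C}$-algebra automorphisms $\sigma$ of $R$ with $\sigma([x,y])=[x,y]$, where $[x,y]=xy-yx$. For $n\ge 1$, $\tilde{\mathcal{C}}_n$ is the set of pairs $(X,Y)$ of complex $n\times n$ matrices with $\mathrm{rank}([X,Y]+I_n)=1$, and $\mathcal{C}_n=\tilde{\mathcal{C}}_n/\mathrm{PGL}_n(\mathbb{C})$ is its quotient by simultaneous conjugation; by convention $\mathcal{C}_0$ is a single point. The group $G$ acts on $\mathcal{C}_n$ by $\sigma\cdot(X,Y)=(\sigma^{-1}(X),\sigma^{-1}(Y))$, where for $\tau\in G$ the matrices $\tau(X),\tau(Y)$ are obtained by substituting $x=X$, $y=Y$ into the noncommutative polynomials $\tau(x),\tau(y)$. *)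

theory Defs
  imports
    "HOL-Algebra.Group_Action"
    "HOL-Library.Poly_Mapping"
    "HOL-Library.FuncSet"
    "Jordan_Normal_Form.DL_Rank"
begin

section \<open>The free associative algebra on two generators\<close>

datatype letter = LX | LY

text \<open>
  Words form the free monoid, written additively (0 is the empty word, addition is concatenation):
  the multiplication of \<^typ>\<open>'a \<Rightarrow>\<^sub>0 'b\<close> is convolution along the addition of the
  index type, so finitely supported functions on words are the monoid algebra of the free monoid.
\<close>

datatype word = Word (letters: "letter list")

instantiation word :: monoid_add
begin

definition zero_word :: word where
  "0 = Word []"

definition plus_word :: "word \<Rightarrow> word \<Rightarrow> word" where
  "u + v = Word (letters u @ letters v)"

instance
  by standard (simp_all add: zero_word_def plus_word_def)

end

type_synonym free_alg = "word \<Rightarrow>\<^sub>0 complex"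

definition const :: "complex \<Rightarrow> free_alg" where
  "const c = Poly_Mapping.single 0 c"

definition var_x :: free_alg where
  "var_x = Poly_Mapping.single (Word [LX]) 1"

definition var_y :: free_alg where
  "var_y = Poly_Mapping.single (Word [LY]) 1"

definition commutator :: "'a::ring \<Rightarrow> 'a \<Rightarrow> 'a" where
  "commutator a b = a * b - b * a"

definition algebra_automorphism :: "(free_alg \<Rightarrow> free_alg) \<Rightarrow> bool" where
  "algebra_automorphism \<sigma> \<longleftrightarrow>
     bij \<sigma> \<and> \<sigma> 1 = 1 \<and>
     (\<forall>p q. \<sigma> (p + q) = \<sigma> p + \<sigma> q) \<and>
     (\<forall>p q. \<sigma> (p * q) = \<sigma> p * \<sigma> q) \<and>
     (\<forall>c p. \<sigma> (const c * p) = const c * \<sigma> p)"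

definition symp_aut_group :: "(free_alg \<Rightarrow> free_alg) monoid" where
  "symp_aut_group =
     \<lparr> carrier = {\<sigma>. algebra_automorphism \<sigma> \<and>
                      \<sigma> (commutator var_x var_y) = commutator var_x var_y},
       mult = (\<circ>),
       one = id \<rparr>"


section \<open>Substituting matrices into noncommutative polynomials\<close>

primrec eval_letter :: "complex mat \<Rightarrow> complex mat \<Rightarrow> letter \<Rightarrow> complex mat" where
  "eval_letter X Y LX = X"
| "eval_letter X Y LY = Y"

primrec eval_letters :: "nat \<Rightarrow> complex mat \<Rightarrow> complex mat \<Rightarrow> letter list \<Rightarrow> complex mat" where
  "eval_letters n X Y [] = 1\<^sub>m n"
| "eval_letters n X Y (a # w) = eval_letter X Y a * eval_letters n X Y w"

text \<open>
  The linear combination of the word values is written entrywise, because matrices of unspecified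
  size carry no additive monoid class and hence no \<^const>\<open>sum\<close>.
\<close>

definition eval_poly :: "nat \<Rightarrow> complex mat \<Rightarrow> complex mat \<Rightarrow> free_alg \<Rightarrow> complex mat" where
  "eval_poly n X Y p =
     mat n n (\<lambda>(i, j). \<Sum>w\<in>Poly_Mapping.keys p.
       Poly_Mapping.lookup p w * eval_letters n X Y (letters w) $$ (i, j))"


section \<open>Calogero--Moser spaces\<close>

text \<open>
  For \<open>n = 0\<close> the rank condition is dropped: the only pair of empty matrices remains, so that the
  quotient below is a single point.
\<close>

definition CM_pairs :: "nat \<Rightarrow> (complex mat \<times> complex mat) set" where
  "CM_pairs n =
     {(X, Y). X \<in> carrier_mat n n \<and> Y \<in> carrier_mat n n \<and>
        (n = 0 \<or> vec_space.rank n ((X * Y - Y * X) + 1\<^sub>m n) = 1)}"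

text \<open>
  Scalar matrices act trivially by conjugation, so the orbits of the projective linear group are
  those of the general linear group.
\<close>

definition simul_conj :: "nat \<Rightarrow> ((complex mat \<times> complex mat) \<times> (complex mat \<times> complex mat)) set" where
  "simul_conj n =
     {((X, Y), (X', Y')). (X, Y) \<in> CM_pairs n \<and> (X', Y') \<in> CM_pairs n \<and>
        (\<exists>P Q. similar_mat_wit X' X P Q \<and> similar_mat_wit Y' Y P Q)}"

definition CM_space :: "nat \<Rightarrow> (complex mat \<times> complex mat) set set" where
  "CM_space n = CM_pairs n // simul_conj n"


section \<open>The action on the spaces and on their products\<close>

definition act_pair ::
    "nat \<Rightarrow> (free_alg \<Rightarrow> free_alg) \<Rightarrow> complex mat \<times> complex mat \<Rightarrow> complex mat \<times> complex mat" where
  "act_pair n \<sigma> = (\<lambda>(X, Y).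
     (eval_poly n X Y ((inv\<^bsub>symp_aut_group\<^esub> \<sigma>) var_x),
      eval_poly n X Y ((inv\<^bsub>symp_aut_group\<^esub> \<sigma>) var_y)))"

text \<open>
  Substitution commutes with simultaneous conjugation, hence the image of a conjugacy class is
  the conjugacy class of the image of any of its members.
\<close>

definition act_class ::
    "nat \<Rightarrow> (free_alg \<Rightarrow> free_alg) \<Rightarrow> (complex mat \<times> complex mat) set \<Rightarrow> (complex mat \<times> complex mat) set" where
  "act_class n \<sigma> c = act_pair n \<sigma> ` c"

definition CM_product :: "nat \<Rightarrow> (nat \<Rightarrow> nat) \<Rightarrow> (nat \<Rightarrow> (complex mat \<times> complex mat) set) set" where
  "CM_product m n = (\<Pi>\<^sub>E i\<in>{1..m}. CM_space (n i))"

text \<open>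
  The outer restriction is what membership in \<^const>\<open>BijGroup\<close>, the codomain of a group action,
  requires.
\<close>

definition diagonal_action ::
    "nat \<Rightarrow> (nat \<Rightarrow> nat) \<Rightarrow> (free_alg \<Rightarrow> free_alg) \<Rightarrow>
     (nat \<Rightarrow> (complex mat \<times> complex mat) set) \<Rightarrow> (nat \<Rightarrow> (complex mat \<times> complex mat) set)" where
  "diagonal_action m n \<sigma> = (\<lambda>c\<in>CM_product m n. \<lambda>i\<in>{1..m}. act_class (n i) \<sigma> (c i))"

end

theory Submission
  imports
    "Jordan_Normal_Form.Schur_Decomposition"
    "Jordan_Normal_Form.Spectral_Radius"
    "HOL-Computational_Algebra.Fundamental_Theorem_Algebra"
    Defs
begin

text \<open>
  A tuple of Calogero--Moser pairs \<open>(X\<^sub>i, Y\<^sub>i)\<close> of sizes \<open>n\<^sub>i\<close> is moved by the shears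
  \<open>(x, y) \<mapsto> (x + p(y), y)\<close> and \<open>(x, y) \<mapsto> (x, y + q(x))\<close> of the group, acting on all pairs at once, and by a
  separate conjugation of each pair. The claim is that any two tuples are related in this way
  (lemma \<open>transitive_action_if_equivalent\<close>). Every tuple is brought to a form in which all \<open>X\<^sub>i\<close> are diagonal
  and all their eigenvalues, over all \<open>i\<close>, are distinct; and every tuple of this form is related to one fixed tuple.

  \<^bold>\<open>Separating the eigenvalues.\<close> Among the tuples related to a given one, take one with the largest number of
  different eigenvalues of the \<open>X\<^sub>i\<close> together. Two shears lead from it to the matrices
  \<open>X'\<^sub>i = Y\<^sub>i + h(X\<^sub>i) + q(X\<^sub>i) / \<epsilon>\<close>, and the eigenvalues of \<open>\<epsilon> X'\<^sub>i\<close> are those of a small perturbation of \<open>q(X\<^sub>i)\<close>.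
  Let \<open>q(X\<^sub>i)\<close> be semisimple. Near each of its eigenvalues the perturbed ones separate, to first order, like the
  eigenvalues of the compression of \<open>Y\<^sub>i + h(X\<^sub>i)\<close> to the eigenspace (\<open>eigenvalue_cluster\<close>). So maximality bounds the
  number of eigenvalues of these compressions, for every choice of \<open>q\<close> and \<open>h\<close> (\<open>count_compressed_eigenvalues\<close>).

  First let \<open>q(X\<^sub>i)\<close> be the semisimple part of \<open>X\<^sub>i\<close>. Then each compression of \<open>Y\<^sub>i + h(X\<^sub>i)\<close> to a generalised
  eigenspace of \<open>X\<^sub>i\<close> has a single eigenvalue. Linear and quadratic \<open>h\<close> already give enough nilpotent matrices
  to compute the trace of the square of a commutator in two ways; because \<open>[X\<^sub>i, Y\<^sub>i] + 1\<close> has rank one, it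
  follows that the multiplicity \<open>d\<close> of each eigenvalue satisfies \<open>d\<^sup>2 = d\<close> (\<open>multiplicity_le_one\<close>). Hence each
  \<open>X\<^sub>i\<close> has a simple spectrum.

  Now suppose that \<open>X\<^sub>i\<close> and \<open>X\<^sub>j\<close> share an eigenvalue. The sizes \<open>n\<^sub>i\<close> and \<open>n\<^sub>j\<close> are different, so the spectra are, and
  there is an eigenvalue that only one of the two matrices has. Choose \<open>q\<close> such that these two eigenvalues collide, and no
  others. This produces three eigenvalues where there were two, against maximality (\<open>shared_eigenvalue\<close>). This
  is where the sizes have to be different.

  \<^bold>\<open>Reaching one fixed tuple.\<close> Once all eigenvalues are distinct, interpolation makes the shears act independently
  on the blocks. The rank one condition determines \<open>Y\<^sub>i\<close> up to its diagonal, which a shear changes at will, and up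
  to conjugation by diagonal matrices (\<open>off_diagonal_unique\<close>). So \<open>Y\<^sub>i\<close> may be taken to be the derivative on the
  polynomials of degree less than \<open>n\<^sub>i\<close>, plus a constant, and \<open>X\<^sub>i\<close> the multiplication by \<open>z\<close> modulo
  \<open>P\<^sub>i = \<Prod>(z - x)\<close> over the eigenvalues \<open>x\<close>. Up to conjugation by a polynomial in the derivative, this
  multiplication and the one modulo \<open>z\<^bsup>n\<^esup>\<close> differ by a polynomial in the derivative (\<open>diagonal_from_base\<close>).
  Different constants keep the blocks independent, and one shear takes all \<open>P\<^sub>i\<close> to powers of \<open>z\<close> at once
  (\<open>base_equivalent_to_diagonal\<close>).
\<close>

section \<open>Evaluation and substitution homomorphisms of the free algebra\<close>

lemma const_zero [simp]: "const 0 = 0"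
  by (simp add: const_def)

lemma const_one [simp]: "const 1 = 1"
  by (simp add: const_def)

lemma const_add: "const (a + b) = const a + const b"
  by (simp add: const_def single_add)

lemma const_mult: "const (a * b) = const a * const b"
  by (simp add: const_def mult_single)

lemma const_uminus: "const (- a) = - const a"
  by (simp add: const_def single_uminus)

lemma single_Word_Cons:
  "Poly_Mapping.single (Word (a # w)) c =
     (case a of LX \<Rightarrow> var_x | LY \<Rightarrow> var_y) * Poly_Mapping.single (Word w) c"
  by (cases a) (simp_all add: var_x_def var_y_def mult_single plus_word_def)

lemma free_alg_single_induct [case_names zero add single]:
  fixes p :: free_alg
  assumes zero: "P 0" and add: "\<And>p q. P p \<Longrightarrow> P q \<Longrightarrow> P (p + q)"
    and single: "\<And>w c. P (Poly_Mapping.single w c)"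
  shows "P p"
proof (induction p rule: update_induct)
  case const
  show ?case by (rule zero)
next
  case (update f a b)
  have "Poly_Mapping.update a b f = f + Poly_Mapping.single a b"
    using update(1)
    by (intro poly_mapping_eqI)
      (auto simp: lookup_update lookup_add lookup_single in_keys_iff when_def)
  then show ?case
    using add[OF update(3) single] by simp
qed

lemma free_alg_induct [case_names const x y add mult]:
  fixes p :: free_alg
  assumes const: "\<And>c. P (const c)" and x: "P var_x" and y: "P var_y"
    and add: "\<And>p q. P p \<Longrightarrow> P q \<Longrightarrow> P (p + q)"
    and mult: "\<And>p q. P p \<Longrightarrow> P q \<Longrightarrow> P (p * q)"
  shows "P p"
proof (induction p rule: free_alg_single_induct)
  case zero
  show ?case using const[of 0] by simp
next
  case (add p q)
  then show ?case by (rule assms(4))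
next
  case (single w c)
  have "P (Poly_Mapping.single (Word l) c)" for l
  proof (induction l)
    case Nil
    then show ?case using const[of c] by (simp add: const_def zero_word_def)
  next
    case (Cons a l)
    then show ?case
      unfolding single_Word_Cons by (cases a) (auto intro: mult x y)
  qed
  then show ?case by (cases w) simp
qed

lemma const_commute: "const c * p = p * const c"
proof (induction p rule: free_alg_single_induct)
  case (single w d)
  show ?case by (simp add: const_def mult_single mult.commute)
qed (simp_all add: algebra_simps)

text \<open>Both the evaluation at matrices and the substitution below are sums over the support; the
  summands extend by zero, which makes such a sum additive.\<close>

lemma sum_keys_superset:
  fixes g :: "word \<Rightarrow> complex \<Rightarrow> 'b::comm_monoid_add"
  assumes "finite S" and "Poly_Mapping.keys p \<subseteq> S" and "\<And>w. g w 0 = 0"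
  shows "(\<Sum>w\<in>Poly_Mapping.keys p. g w (Poly_Mapping.lookup p w)) =
         (\<Sum>w\<in>S. g w (Poly_Mapping.lookup p w))"
  using assms by (intro sum.mono_neutral_left) (auto simp: in_keys_iff)

lemma sum_keys_add:
  fixes g :: "word \<Rightarrow> complex \<Rightarrow> 'b::comm_monoid_add"
  assumes "\<And>w. g w 0 = 0" and "\<And>w a b. g w (a + b) = g w a + g w b"
  shows "(\<Sum>w\<in>Poly_Mapping.keys (p + q). g w (Poly_Mapping.lookup (p + q) w)) =
         (\<Sum>w\<in>Poly_Mapping.keys p. g w (Poly_Mapping.lookup p w)) +
         (\<Sum>w\<in>Poly_Mapping.keys q. g w (Poly_Mapping.lookup q w))"
proof -
  define S where "S = Poly_Mapping.keys p \<union> Poly_Mapping.keys q"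
  have S: "finite S" "Poly_Mapping.keys p \<subseteq> S" "Poly_Mapping.keys q \<subseteq> S"
    "Poly_Mapping.keys (p + q) \<subseteq> S"
    using Poly_Mapping.keys_add[of p q] by (auto simp: S_def)
  show ?thesis
    unfolding sum_keys_superset[where g = g, OF S(1) S(2) assms(1)]
      sum_keys_superset[where g = g, OF S(1) S(3) assms(1)]
      sum_keys_superset[where g = g, OF S(1) S(4) assms(1)]
    by (simp add: lookup_add assms(2) sum.distrib)
qed

subsection \<open>Evaluation at a pair of matrices\<close>

lemma eval_poly_carrier [simp]: "eval_poly n X Y p \<in> carrier_mat n n"
  by (simp add: eval_poly_def)

lemma eval_poly_dim [simp]: "dim_row (eval_poly n X Y p) = n" "dim_col (eval_poly n X Y p) = n"
  by (simp_all add: eval_poly_def)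

lemma eval_poly_zero [simp]: "eval_poly n X Y 0 = 0\<^sub>m n n"
  by (intro eq_matI) (auto simp: eval_poly_def)

lemma eval_poly_add: "eval_poly n X Y (p + q) = eval_poly n X Y p + eval_poly n X Y q"
proof (intro eq_matI)
  fix i j assume "i < dim_row (eval_poly n X Y p + eval_poly n X Y q)"
    "j < dim_col (eval_poly n X Y p + eval_poly n X Y q)"
  then show "eval_poly n X Y (p + q) $$ (i, j) = (eval_poly n X Y p + eval_poly n X Y q) $$ (i, j)"
    using sum_keys_add[of "\<lambda>w c. c * eval_letters n X Y (letters w) $$ (i, j)" p q]
    by (simp add: eval_poly_def algebra_simps)
qed (simp_all add: eval_poly_def)

context
  fixes n :: nat and X Y :: "complex mat"
  assumes X: "X \<in> carrier_mat n n" and Y: "Y \<in> carrier_mat n n"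
begin

lemma eval_letters_carrier [simp]: "eval_letters n X Y w \<in> carrier_mat n n"
proof (induction w)
  case (Cons a w)
  have "eval_letter X Y a \<in> carrier_mat n n" using X Y by (cases a) auto
  then show ?case using Cons by simp
qed simp

lemma eval_letters_append:
  "eval_letters n X Y (u @ v) = eval_letters n X Y u * eval_letters n X Y v"
proof (induction u)
  case Nil
  show ?case by (simp add: left_mult_one_mat[OF eval_letters_carrier])
next
  case (Cons a u)
  have "eval_letter X Y a \<in> carrier_mat n n" using X Y by (cases a) auto
  then show ?case
    using Cons assoc_mult_mat[OF _ eval_letters_carrier eval_letters_carrier] by simp
qed

lemma eval_poly_single:
  "eval_poly n X Y (Poly_Mapping.single w c) = c \<cdot>\<^sub>m eval_letters n X Y (letters w)"
proof -
  have "dim_row (eval_letters n X Y (letters w)) = n" "dim_col (eval_letters n X Y (letters w)) = n"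
    by (rule carrier_matD[OF eval_letters_carrier])+
  then show ?thesis
    by (intro eq_matI) (auto simp: eval_poly_def)
qed

lemma eval_poly_mult: "eval_poly n X Y (p * q) = eval_poly n X Y p * eval_poly n X Y q"
proof (induction p rule: free_alg_single_induct)
  case zero
  show ?case
    using left_mult_zero_mat[OF eval_poly_carrier[of n X Y q]] by simp
next
  case (add p p')
  then show ?case
    using add_mult_distrib_mat[OF eval_poly_carrier eval_poly_carrier eval_poly_carrier, of n X Y p X Y p' X Y q]
    by (simp only: distrib_right eval_poly_add)
next
  case (single u a)
  show ?case
  proof (induction q rule: free_alg_single_induct)
    case zero
    show ?case
      using right_mult_zero_mat[OF eval_poly_carrier[of n X Y "Poly_Mapping.single u a"]] by simp
  next
    case (add p p')
    then show ?case
      using mult_add_distrib_mat[OF eval_poly_carrier eval_poly_carrier eval_poly_carrier, of n X Y "Poly_Mapping.single u a" X Y p X Y p']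
      by (simp only: distrib_left eval_poly_add)
  next
    case (single v b)
    have "(a \<cdot>\<^sub>m U) * (b \<cdot>\<^sub>m V) = (a * b) \<cdot>\<^sub>m (U * V)"
      if "U \<in> carrier_mat n n" "V \<in> carrier_mat n n" for U V :: "complex mat"
      using that mult_smult_assoc_mat[of U n n "b \<cdot>\<^sub>m V" n a] mult_smult_distrib[of U n n V n b]
      by (simp, intro eq_matI) auto
    from this[OF eval_letters_carrier eval_letters_carrier] show ?case
      by (simp only: mult_single eval_poly_single plus_word_def eval_letters_append word.sel)
  qed
qed

lemma eval_poly_const: "eval_poly n X Y (const c) = c \<cdot>\<^sub>m 1\<^sub>m n"
  by (simp add: const_def eval_poly_single zero_word_def)

lemma eval_poly_one [simp]: "eval_poly n X Y 1 = 1\<^sub>m n"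
  using eval_poly_const[of 1] by (simp, intro eq_matI) auto

lemma eval_poly_x [simp]: "eval_poly n X Y var_x = X"
  using X by (simp add: var_x_def eval_poly_single) (intro eq_matI, auto)

lemma eval_poly_y [simp]: "eval_poly n X Y var_y = Y"
  using Y by (simp add: var_y_def eval_poly_single) (intro eq_matI, auto)

lemma eval_poly_uminus: "eval_poly n X Y (- p) = - eval_poly n X Y p"
proof -
  have "eval_poly n X Y (- p) = eval_poly n X Y (const (- 1) * p)"
    by (simp add: const_uminus)
  also have "\<dots> = (- 1 \<cdot>\<^sub>m 1\<^sub>m n) * eval_poly n X Y p"
    unfolding eval_poly_mult eval_poly_const ..
  also have "\<dots> = - 1 \<cdot>\<^sub>m eval_poly n X Y p"
    by (simp add: smult_carrier_mat mult_smult_assoc_mat[of _ n n _ n] left_mult_one_mat[of _ n n])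
  also have "\<dots> = - eval_poly n X Y p"
    by (intro eq_matI) auto
  finally show ?thesis .
qed

lemma eval_poly_diff: "eval_poly n X Y (p - q) = eval_poly n X Y p - eval_poly n X Y q"
  using eval_poly_add[of n X Y p "- q"] eval_poly_uminus[of q]
  by (simp add: add_uminus_minus_mat[of _ n n])

end

subsection \<open>Algebra endomorphisms\<close>

definition alg_endo :: "(free_alg \<Rightarrow> free_alg) \<Rightarrow> bool" where
  "alg_endo \<sigma> \<longleftrightarrow> (\<forall>c. \<sigma> (const c) = const c) \<and>
     (\<forall>p q. \<sigma> (p + q) = \<sigma> p + \<sigma> q) \<and> (\<forall>p q. \<sigma> (p * q) = \<sigma> p * \<sigma> q)"

lemma alg_endo_const: "alg_endo \<sigma> \<Longrightarrow> \<sigma> (const c) = const c"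
  by (simp add: alg_endo_def)

lemma alg_endo_uminus: "alg_endo \<sigma> \<Longrightarrow> \<sigma> (- p) = - \<sigma> p"
  unfolding alg_endo_def by (metis const_one const_uminus mult_minus1)

lemma alg_endo_diff: "alg_endo \<sigma> \<Longrightarrow> \<sigma> (p - q) = \<sigma> p - \<sigma> q"
  using alg_endo_uminus[of \<sigma> q] unfolding alg_endo_def by (metis diff_conv_add_uminus)

lemma alg_endo_comp: "alg_endo \<sigma> \<Longrightarrow> alg_endo \<tau> \<Longrightarrow> alg_endo (\<sigma> \<circ> \<tau>)"
  by (simp add: alg_endo_def)

lemma alg_endo_ext:
  assumes "alg_endo \<sigma>" "alg_endo \<tau>" "\<sigma> var_x = \<tau> var_x" "\<sigma> var_y = \<tau> var_y"
  shows "\<sigma> = \<tau>"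
proof
  fix p show "\<sigma> p = \<tau> p"
    using assms by (induction p rule: free_alg_induct) (auto simp: alg_endo_const alg_endo_def)
qed

text \<open>Substitution into a composite: this is why acting by evaluation at the images of the
  generators is contravariant, and why the action is defined through the inverse.\<close>

lemma eval_poly_alg_endo:
  assumes X: "X \<in> carrier_mat n n" and Y: "Y \<in> carrier_mat n n" and \<sigma>: "alg_endo \<sigma>"
  shows "eval_poly n (eval_poly n X Y (\<sigma> var_x)) (eval_poly n X Y (\<sigma> var_y)) p =
         eval_poly n X Y (\<sigma> p)"
proof (induction p rule: free_alg_induct)
  case (const c)
  then show ?case by (simp add: eval_poly_const X Y alg_endo_const[OF \<sigma>])
next
  case (add p q)
  then show ?case using \<sigma> by (simp add: eval_poly_add alg_endo_def)
next
  case (mult p q)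
  then show ?case using \<sigma> by (simp add: eval_poly_mult X Y alg_endo_def)
qed (simp_all add: X Y)

definition subst_word :: "free_alg \<Rightarrow> free_alg \<Rightarrow> letter list \<Rightarrow> free_alg" where
  "subst_word a b w = prod_list (map (\<lambda>l. case l of LX \<Rightarrow> a | LY \<Rightarrow> b) w)"

definition subst :: "free_alg \<Rightarrow> free_alg \<Rightarrow> free_alg \<Rightarrow> free_alg" where
  "subst a b p =
     (\<Sum>w\<in>Poly_Mapping.keys p. const (Poly_Mapping.lookup p w) * subst_word a b (letters w))"

lemma subst_add: "subst a b (p + q) = subst a b p + subst a b q"
  using sum_keys_add[of "\<lambda>w c. const c * subst_word a b (letters w)" p q]
  by (simp add: subst_def const_add algebra_simps)

lemma subst_single: "subst a b (Poly_Mapping.single w c) = const c * subst_word a b (letters w)"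
  by (simp add: subst_def)

lemma subst_mult: "subst a b (p * q) = subst a b p * subst a b q"
proof (induction p rule: free_alg_single_induct)
  case (single u c)
  show ?case
  proof (induction q rule: free_alg_single_induct)
    case (single v d)
    have "const c * const d * (subst_word a b (letters u) * subst_word a b (letters v)) =
          const c * subst_word a b (letters u) * (const d * subst_word a b (letters v))"
      by (metis const_commute mult.assoc)
    then show ?case
      by (simp add: mult_single subst_single plus_word_def const_mult subst_word_def)
  qed (simp_all add: subst_add algebra_simps, simp add: subst_def)
qed (simp_all add: subst_add algebra_simps, simp add: subst_def)

lemma alg_endo_subst: "alg_endo (subst a b)"
proof -
  have c: "subst a b (const c) = const c" for c
    by (simp add: const_def subst_single zero_word_def subst_word_def)
  then show ?thesis
    by (simp add: alg_endo_def subst_add subst_mult)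
qed

lemma subst_x [simp]: "subst a b var_x = a"
  by (simp add: var_x_def subst_single subst_word_def)

lemma subst_y [simp]: "subst a b var_y = b"
  by (simp add: var_y_def subst_single subst_word_def)

section \<open>The group and its shears\<close>

lemma symp_aut_group_simps [simp]:
  "\<sigma> \<otimes>\<^bsub>symp_aut_group\<^esub> \<tau> = \<sigma> \<circ> \<tau>" "\<one>\<^bsub>symp_aut_group\<^esub> = id"
  by (simp_all add: symp_aut_group_def)

lemma symp_aut_iff:
  "\<sigma> \<in> carrier symp_aut_group \<longleftrightarrow>
     bij \<sigma> \<and> alg_endo \<sigma> \<and> \<sigma> (commutator var_x var_y) = commutator var_x var_y"
proof -
  have "algebra_automorphism \<sigma> \<longleftrightarrow> bij \<sigma> \<and> alg_endo \<sigma>"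
    unfolding algebra_automorphism_def alg_endo_def by (metis const_one mult.right_neutral)
  then show ?thesis by (simp add: symp_aut_group_def)
qed

lemma symp_aut_inv_into:
  assumes "\<sigma> \<in> carrier symp_aut_group"
  shows "inv_into UNIV \<sigma> \<in> carrier symp_aut_group"
proof -
  have b: "bij \<sigma>" and e: "alg_endo \<sigma>" and c: "\<sigma> (commutator var_x var_y) = commutator var_x var_y"
    using assms by (auto simp: symp_aut_iff)
  have inv: "inv_into UNIV \<sigma> p = q \<longleftrightarrow> p = \<sigma> q" for p q
    using b by (metis bij_inv_eq_iff)
  have \<sigma>inv: "\<sigma> (inv_into UNIV \<sigma> p) = p" for p
    using inv by metis
  have "alg_endo (inv_into UNIV \<sigma>)"
    using e unfolding alg_endo_def by (simp add: inv \<sigma>inv)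
  then show ?thesis
    using b c by (simp add: symp_aut_iff bij_imp_bij_inv inv)
qed

lemma group_symp_aut: "group symp_aut_group"
proof (rule groupI)
  fix \<sigma> assume \<sigma>: "\<sigma> \<in> carrier symp_aut_group"
  have "inv_into UNIV \<sigma> \<circ> \<sigma> = id"
    using \<sigma> by (auto simp: symp_aut_iff bij_def)
  then show "\<exists>\<tau>\<in>carrier symp_aut_group. \<tau> \<otimes>\<^bsub>symp_aut_group\<^esub> \<sigma> = \<one>\<^bsub>symp_aut_group\<^esub>"
    using symp_aut_inv_into[OF \<sigma>] by auto
qed (auto simp: symp_aut_iff alg_endo_comp bij_comp alg_endo_def comp_assoc)

lemma alg_endo_fixes_commutator:
  assumes "alg_endo \<sigma>"
  shows "\<sigma> (commutator p q) = commutator (\<sigma> p) (\<sigma> q)"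
  using assms alg_endo_diff[OF assms] by (simp add: commutator_def alg_endo_def)

lemma subst_symp_autI:
  assumes "subst a b (subst a' b' var_x) = var_x" "subst a b (subst a' b' var_y) = var_y"
    and "subst a' b' (subst a b var_x) = var_x" "subst a' b' (subst a b var_y) = var_y"
    and "commutator a b = commutator var_x var_y"
  shows "subst a b \<in> carrier symp_aut_group"
proof -
  have "alg_endo id" by (simp add: alg_endo_def)
  then have "subst a b \<circ> subst a' b' = id" "subst a' b' \<circ> subst a b = id"
    using assms by (auto intro!: alg_endo_ext alg_endo_comp alg_endo_subst)
  then have "bij (subst a b)"
    by (intro o_bij)
  then show ?thesis
    using assms(5) by (simp add: symp_aut_iff alg_endo_subst alg_endo_fixes_commutator)
qed

text \<open>The coefficients are central, so the value of a polynomial at an element is multiplicative in the polynomial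
  although the algebra is not commutative.\<close>

definition pfree :: "complex poly \<Rightarrow> free_alg \<Rightarrow> free_alg" where
  "pfree f a = fold_coeffs (\<lambda>c r. const c + a * r) f 0"

lemma pfree_0 [simp]: "pfree 0 a = 0"
  by (simp add: pfree_def)

lemma pfree_pCons [simp]: "pfree (pCons c f) a = const c + a * pfree f a"
  by (cases "c = 0 \<and> f = 0") (auto simp: pfree_def)

lemma pfree_add: "pfree (f + g) a = pfree f a + pfree g a"
  by (induction f g rule: poly_induct2) (simp_all add: const_add algebra_simps)

lemma pfree_smult: "pfree (Polynomial.smult c f) a = const c * pfree f a"
proof (induction f)
  case (pCons d f)
  have "a * (const c * pfree f a) = const c * (a * pfree f a)"
    by (metis const_commute mult.assoc)
  then show ?case
    using pCons by (simp add: const_mult algebra_simps)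
qed simp

lemma pfree_mult: "pfree (f * g) a = pfree f a * pfree g a"
  by (induction f) (simp_all add: pfree_add pfree_smult algebra_simps)

lemma pfree_uminus: "pfree (- f) a = - pfree f a"
  using pfree_smult[of "- 1" f a] by (simp add: const_uminus)

lemma pfree_commute: "a * pfree f a = pfree f a * a"
proof (induction f)
  case (pCons c f)
  then have "a * (a * pfree f a) = a * pfree f a * a"
    by (metis mult.assoc)
  then show ?case
    by (simp add: distrib_left distrib_right const_commute)
qed simp

lemma alg_endo_pfree: "alg_endo \<sigma> \<Longrightarrow> \<sigma> (pfree f a) = pfree f (\<sigma> a)"
proof (induction f)
  case 0
  then show ?case using alg_endo_const[of \<sigma> 0] by simp
next
  case (pCons c f)
  then show ?case by (simp add: alg_endo_def[of \<sigma>] alg_endo_const)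
qed

lemma subst_diff: "subst a b (p - q) = subst a b p - subst a b q"
  by (rule alg_endo_diff[OF alg_endo_subst])

lemma subst_pfree: "subst a b (pfree f p) = pfree f (subst a b p)"
  by (rule alg_endo_pfree[OF alg_endo_subst])

definition x_shear :: "complex poly \<Rightarrow> free_alg \<Rightarrow> free_alg" where
  "x_shear f = subst (var_x + pfree f var_y) var_y"

definition y_shear :: "complex poly \<Rightarrow> free_alg \<Rightarrow> free_alg" where
  "y_shear f = subst var_x (var_y + pfree f var_x)"

lemma x_shear_symp_aut: "x_shear f \<in> carrier symp_aut_group"
  unfolding x_shear_def
proof (rule subst_symp_autI[where a' = "var_x - pfree f var_y" and b' = var_y])
  show "commutator (var_x + pfree f var_y) var_y = commutator var_x var_y"
    by (simp add: commutator_def algebra_simps pfree_commute)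
qed (simp_all add: subst_add subst_diff subst_pfree)

lemma y_shear_symp_aut: "y_shear f \<in> carrier symp_aut_group"
  unfolding y_shear_def
proof (rule subst_symp_autI[where a' = var_x and b' = "var_y - pfree f var_x"])
  show "commutator var_x (var_y + pfree f var_x) = commutator var_x var_y"
    by (simp add: commutator_def algebra_simps pfree_commute)
qed (simp_all add: subst_add subst_diff subst_pfree)

section \<open>Polynomials in one matrix\<close>

text \<open>The ring laws for square matrices of one fixed size; the size is not determined by the left-hand
  sides and has to be instantiated for rewriting.\<close>

lemma sq_mat:
  fixes A B C :: "'a::comm_ring_1 mat"
  assumes "A \<in> carrier_mat n n" "B \<in> carrier_mat n n"
  shows sq_mult: "A * B \<in> carrier_mat n n"
    and sq_assoc: "C \<in> carrier_mat n n \<Longrightarrow> A * B * C = A * (B * C)"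
    and sq_distrib_left: "C \<in> carrier_mat n n \<Longrightarrow> A * (B + C) = A * B + A * C"
    and sq_distrib_right: "C \<in> carrier_mat n n \<Longrightarrow> (A + B) * C = A * C + B * C"
    and sq_smult_left: "(k \<cdot>\<^sub>m A) * B = k \<cdot>\<^sub>m (A * B)"
    and sq_smult_right: "A * (k \<cdot>\<^sub>m B) = k \<cdot>\<^sub>m (A * B)"
    and sq_mult_vec: "v \<in> carrier_vec n \<Longrightarrow> (A * B) *\<^sub>v v = A *\<^sub>v (B *\<^sub>v v)"
    and sq_add_vec: "v \<in> carrier_vec n \<Longrightarrow> (A + B) *\<^sub>v v = A *\<^sub>v v + B *\<^sub>v v"
  using assms
  by (auto simp: assoc_mult_mat[of _ n n _ n _ n] mult_add_distrib_mat[of _ n n _ n]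
      add_mult_distrib_mat[of _ n n] mult_smult_distrib[of _ n n _ n] mult_smult_assoc_mat[of _ n n _ n]
      assoc_mult_mat_vec[of _ n n _ n] add_mult_distrib_mat_vec[of _ n n])

definition mat_poly :: "nat \<Rightarrow> complex poly \<Rightarrow> complex mat \<Rightarrow> complex mat" where
  "mat_poly n f A = eval_poly n A A (pfree f var_x)"

lemma eval_poly_pfree:
  assumes "X \<in> carrier_mat n n" "Y \<in> carrier_mat n n"
  shows "eval_poly n X Y (pfree f p) = mat_poly n f (eval_poly n X Y p)"
  using eval_poly_alg_endo[OF assms alg_endo_subst[of p p], of "pfree f var_x"]
  by (simp add: mat_poly_def subst_pfree)

lemma mat_poly_carrier [simp]: "mat_poly n f A \<in> carrier_mat n n"
  by (simp add: mat_poly_def)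

lemma mat_poly_dim [simp]: "dim_row (mat_poly n f A) = n" "dim_col (mat_poly n f A) = n"
  by (simp_all add: mat_poly_def)

lemma mat_poly_0 [simp]: "mat_poly n 0 A = 0\<^sub>m n n"
  by (simp add: mat_poly_def)

lemma mat_poly_add: "mat_poly n (f + g) A = mat_poly n f A + mat_poly n g A"
  by (simp add: mat_poly_def pfree_add eval_poly_add)

lemma mat_poly_mult:
  "A \<in> carrier_mat n n \<Longrightarrow> mat_poly n (f * g) A = mat_poly n f A * mat_poly n g A"
  by (simp add: mat_poly_def pfree_mult eval_poly_mult)

lemma mat_poly_diff:
  "A \<in> carrier_mat n n \<Longrightarrow> mat_poly n (f - g) A = mat_poly n f A - mat_poly n g A"
  using pfree_add[of f "- g"] by (simp add: mat_poly_def pfree_uminus eval_poly_diff)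

lemma mat_poly_pCons:
  "A \<in> carrier_mat n n \<Longrightarrow> mat_poly n (pCons c f) A = c \<cdot>\<^sub>m 1\<^sub>m n + A * mat_poly n f A"
  by (simp add: mat_poly_def eval_poly_add eval_poly_mult eval_poly_const)

lemma mat_poly_const: "A \<in> carrier_mat n n \<Longrightarrow> mat_poly n [:c:] A = c \<cdot>\<^sub>m 1\<^sub>m n"
  by (simp add: mat_poly_def eval_poly_add eval_poly_const)

lemma mat_poly_1 [simp]: "A \<in> carrier_mat n n \<Longrightarrow> mat_poly n 1 A = 1\<^sub>m n"
  using mat_poly_const[of A n 1] by (simp add: one_pCons, intro eq_matI) auto

lemma mat_poly_id [simp]: "A \<in> carrier_mat n n \<Longrightarrow> mat_poly n [:0, 1:] A = A"
  by (simp add: mat_poly_def)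

lemma mat_poly_smult:
  assumes "A \<in> carrier_mat n n"
  shows "mat_poly n (Polynomial.smult c f) A = c \<cdot>\<^sub>m mat_poly n f A"
proof -
  have "mat_poly n (Polynomial.smult c f) A = (c \<cdot>\<^sub>m 1\<^sub>m n) * mat_poly n f A"
    using assms by (simp add: mat_poly_def pfree_smult eval_poly_mult eval_poly_const)
  then show ?thesis
    by (simp add: mult_smult_assoc_mat[of _ n n _ n] left_mult_one_mat[of _ n n])
qed

lemma mat_poly_pcompose:
  assumes A: "A \<in> carrier_mat n n"
  shows "mat_poly n (pcompose f g) A = mat_poly n f (mat_poly n g A)"
  using A by (induction f) (simp_all add: pcompose_pCons mat_poly_add mat_poly_mult mat_poly_const mat_poly_pCons)

lemma smult_mat_mult_vec:
  fixes A :: "complex mat"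
  assumes "A \<in> carrier_mat n n" "v \<in> carrier_vec n"
  shows "(c \<cdot>\<^sub>m A) *\<^sub>v v = c \<cdot>\<^sub>v (A *\<^sub>v v)"
  using assms by (intro eq_vecI) (auto simp: scalar_prod_def sum_distrib_left mult.assoc)

lemma mat_poly_eigenvector:
  assumes A: "A \<in> carrier_mat n n" and v: "v \<in> carrier_vec n" and ev: "A *\<^sub>v v = k \<cdot>\<^sub>v v"
  shows "mat_poly n f A *\<^sub>v v = poly f k \<cdot>\<^sub>v v"
proof (induction f)
  case 0
  then show ?case using v by (intro eq_vecI) auto
next
  case (pCons c f)
  have "mat_poly n (pCons c f) A *\<^sub>v v = c \<cdot>\<^sub>m 1\<^sub>m n *\<^sub>v v + A *\<^sub>v (mat_poly n f A *\<^sub>v v)"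
    using A v by (simp add: mat_poly_pCons add_mult_distrib_mat_vec[of _ n n] assoc_mult_mat_vec[of _ n n _ n])
  also have "\<dots> = c \<cdot>\<^sub>v v + poly f k \<cdot>\<^sub>v (k \<cdot>\<^sub>v v)"
    using A v pCons by (simp add: mult_mat_vec ev smult_mat_mult_vec[of _ n])
  also have "\<dots> = poly (pCons c f) k \<cdot>\<^sub>v v"
    using v by (intro eq_vecI) (auto simp: algebra_simps)
  finally show ?case .
qed

section \<open>Simultaneous conjugation\<close>

lemma eval_poly_conj:
  assumes X: "X \<in> carrier_mat n n" and Y: "Y \<in> carrier_mat n n"
    and P: "P \<in> carrier_mat n n" and Q: "Q \<in> carrier_mat n n" and QP: "Q * P = 1\<^sub>m n" and PQ: "P * Q = 1\<^sub>m n"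
  shows "eval_poly n (P * X * Q) (P * Y * Q) p = P * eval_poly n X Y p * Q"
proof -
  have X': "P * X * Q \<in> carrier_mat n n" and Y': "P * Y * Q \<in> carrier_mat n n"
    using X Y P Q by auto
  show ?thesis
  proof (induction p rule: free_alg_induct)
    case (const c)
    have "P * (c \<cdot>\<^sub>m 1\<^sub>m n) * Q = c \<cdot>\<^sub>m (P * Q)"
      using P Q by (simp add: sq_mat[where n = n])
    then show ?case
      by (simp add: eval_poly_const X Y X' Y' PQ)
  next
    case (add p q)
    then show ?case
      using P Q by (simp add: eval_poly_add sq_mat[where n = n])
  next
    case (mult p q)
    let ?A = "eval_poly n X Y p" and ?B = "eval_poly n X Y q"
    have "Q * (P * (?B * Q)) = ?B * Q"
      using P Q sq_assoc[of Q n P "?B * Q"] by (simp add: sq_mat[where n = n] QP)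
    then have "P * ?A * Q * (P * ?B * Q) = P * (?A * ?B) * Q"
      using P Q by (simp add: sq_mat[where n = n])
    then show ?case
      by (simp only: mult eval_poly_mult[OF X Y] eval_poly_mult[OF X' Y'])
  qed (simp_all add: X Y X' Y')
qed

lemma similar_carrier:
  assumes "similar_mat_wit A B P Q" and "B \<in> carrier_mat n n"
  shows "A \<in> carrier_mat n n" "P \<in> carrier_mat n n" "Q \<in> carrier_mat n n"
  using similar_mat_witD2[OF assms(2) similar_mat_wit_sym[OF assms(1)]] by blast+

lemma similar_carrier':
  assumes "similar_mat_wit A B P Q" and "P \<in> carrier_mat n n"
  shows "A \<in> carrier_mat n n" "B \<in> carrier_mat n n"
proof -
  have "P \<in> carrier_mat (dim_row A) (dim_row A)" by (rule similar_mat_witD(6)[OF refl assms(1)])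
  then have "n = dim_row A" using assms(2) by (metis carrier_matD(1))
  then show "A \<in> carrier_mat n n" "B \<in> carrier_mat n n"
    by (rule similar_mat_witD(4,5)[OF _ assms(1)])+
qed

lemma eval_poly_similar:
  assumes "similar_mat_wit X' X P Q" and "similar_mat_wit Y' Y P Q" and "X \<in> carrier_mat n n"
  shows "similar_mat_wit (eval_poly n X' Y' p) (eval_poly n X Y p) P Q"
proof -
  note c = similar_carrier[OF assms(1,3)]
  note wX = similar_mat_witD2[OF c(1) assms(1)]
  note cY = similar_carrier'[OF assms(2) c(2)]
  have "eval_poly n X' Y' p = P * eval_poly n X Y p * Q"
    using eval_poly_conj[OF assms(3) cY(2) c(2,3) wX(2,1)] wX(3)
      similar_mat_witD2(3)[OF cY(1) assms(2)] by simp
  then show ?thesis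
    by (rule similar_mat_witI[OF wX(1,2) _ eval_poly_carrier eval_poly_carrier c(2,3)])
qed

lemma mat_poly_similar:
  assumes "similar_mat_wit X' X P Q" and "X \<in> carrier_mat n n"
  shows "similar_mat_wit (mat_poly n f X') (mat_poly n f X) P Q"
  unfolding mat_poly_def by (rule eval_poly_similar[OF assms(1) assms(1) assms(2)])

subsection \<open>Pairs of matrices\<close>

definition square_pair :: "nat \<Rightarrow> complex mat \<times> complex mat \<Rightarrow> bool" where
  "square_pair n p \<longleftrightarrow> fst p \<in> carrier_mat n n \<and> snd p \<in> carrier_mat n n"

definition simul_similar :: "complex mat \<times> complex mat \<Rightarrow> complex mat \<times> complex mat \<Rightarrow> bool" where
  "simul_similar p q \<longleftrightarrow>
     (\<exists>P Q. similar_mat_wit (fst p) (fst q) P Q \<and> similar_mat_wit (snd p) (snd q) P Q)"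

definition substitute ::
  "nat \<Rightarrow> (free_alg \<Rightarrow> free_alg) \<Rightarrow> complex mat \<times> complex mat \<Rightarrow> complex mat \<times> complex mat" where
  "substitute n \<tau> p =
     (eval_poly n (fst p) (snd p) (\<tau> var_x), eval_poly n (fst p) (snd p) (\<tau> var_y))"

lemma simul_similar_refl: "square_pair n p \<Longrightarrow> simul_similar p p"
  unfolding square_pair_def simul_similar_def using similar_mat_wit_refl by blast

lemma simul_similar_sym: "simul_similar p q \<Longrightarrow> simul_similar q p"
  unfolding simul_similar_def using similar_mat_wit_sym by blast

lemma simul_similar_trans: "simul_similar p q \<Longrightarrow> simul_similar q r \<Longrightarrow> simul_similar p r"
  unfolding simul_similar_def using similar_mat_wit_trans by blast

lemma square_pair_substitute [simp]: "square_pair n (substitute n \<tau> p)"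
  by (simp add: square_pair_def substitute_def)

lemma square_pair_similar: "simul_similar p q \<Longrightarrow> square_pair n p \<Longrightarrow> square_pair n q"
  unfolding simul_similar_def square_pair_def using similar_mat_witD2(5) by blast

lemma substitute_id: "square_pair n p \<Longrightarrow> substitute n id p = p"
  by (simp add: square_pair_def substitute_def)

lemma substitute_substitute:
  assumes "square_pair n p" and "alg_endo \<tau>"
  shows "substitute n \<tau>' (substitute n \<tau> p) = substitute n (\<tau> \<circ> \<tau>') p"
  using assms eval_poly_alg_endo by (simp add: square_pair_def substitute_def)

lemma simul_similar_substitute:
  assumes "simul_similar p q" and "square_pair n q"
  shows "simul_similar (substitute n \<tau> p) (substitute n \<tau> q)"
proof -
  obtain P Q where "similar_mat_wit (fst p) (fst q) P Q" "similar_mat_wit (snd p) (snd q) P Q"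
    using assms(1) unfolding simul_similar_def by blast
  moreover have "fst q \<in> carrier_mat n n"
    using assms(2) by (simp add: square_pair_def)
  ultimately show ?thesis
    unfolding simul_similar_def substitute_def fst_conv snd_conv using eval_poly_similar by blast
qed

lemma substitute_x_shear:
  "square_pair n p \<Longrightarrow> substitute n (x_shear f) p = (fst p + mat_poly n f (snd p), snd p)"
  by (simp add: square_pair_def substitute_def x_shear_def eval_poly_add eval_poly_pfree)

lemma substitute_y_shear:
  "square_pair n p \<Longrightarrow> substitute n (y_shear f) p = (fst p, snd p + mat_poly n f (fst p))"
  by (simp add: square_pair_def substitute_def y_shear_def eval_poly_add eval_poly_pfree)

subsection \<open>Tuples up to the group and conjugation\<close>

text \<open>A tuple of pairs is moved by one element of the group acting on all pairs at once, and by a conjugation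
  for each index separately.\<close>

definition equivalent ::
  "nat set \<Rightarrow> (nat \<Rightarrow> nat) \<Rightarrow> (nat \<Rightarrow> complex mat \<times> complex mat) \<Rightarrow>
   (nat \<Rightarrow> complex mat \<times> complex mat) \<Rightarrow> bool" where
  "equivalent I n T T' \<longleftrightarrow>
     (\<exists>\<tau>\<in>carrier symp_aut_group. \<forall>i\<in>I. simul_similar (substitute (n i) \<tau> (T i)) (T' i))"

definition square_pairs :: "nat set \<Rightarrow> (nat \<Rightarrow> nat) \<Rightarrow> (nat \<Rightarrow> complex mat \<times> complex mat) \<Rightarrow> bool" where
  "square_pairs I n T \<longleftrightarrow> (\<forall>i\<in>I. square_pair (n i) (T i))"

lemma square_pairsD:
  assumes "square_pairs I n T" "i \<in> I"
  shows "fst (T i) \<in> carrier_mat (n i) (n i)" "snd (T i) \<in> carrier_mat (n i) (n i)"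
  using assms by (simp_all add: square_pairs_def square_pair_def)

lemma equivalent_square_pairs: "equivalent I n T T' \<Longrightarrow> square_pairs I n T'"
  unfolding equivalent_def square_pairs_def using square_pair_similar square_pair_substitute by blast

lemma equivalent_trans:
  assumes TT': "equivalent I n T T'" and T'T'': "equivalent I n T' T''" and T: "square_pairs I n T"
  shows "equivalent I n T T''"
proof -
  obtain \<tau> where \<tau>: "\<tau> \<in> carrier symp_aut_group" "\<And>i. i \<in> I \<Longrightarrow> simul_similar (substitute (n i) \<tau> (T i)) (T' i)"
    using TT' unfolding equivalent_def by blast
  obtain \<tau>' where \<tau>': "\<tau>' \<in> carrier symp_aut_group" "\<And>i. i \<in> I \<Longrightarrow> simul_similar (substitute (n i) \<tau>' (T' i)) (T'' i)"
    using T'T'' unfolding equivalent_def by blast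
  have e: "alg_endo \<tau>" using \<tau> by (simp add: symp_aut_iff)
  have "simul_similar (substitute (n i) (\<tau> \<circ> \<tau>') (T i)) (T'' i)" if i: "i \<in> I" for i
  proof -
    have T: "square_pair (n i) (T i)" and T': "square_pair (n i) (T' i)"
      using T equivalent_square_pairs[OF TT'] i by (auto simp: square_pairs_def)
    have "simul_similar (substitute (n i) \<tau>' (substitute (n i) \<tau> (T i))) (substitute (n i) \<tau>' (T' i))"
      by (rule simul_similar_substitute[OF \<tau>(2)[OF i] T'])
    then show ?thesis
      unfolding substitute_substitute[OF T e] using \<tau>'(2)[OF i] by (rule simul_similar_trans)
  qed
  moreover have "\<tau> \<circ> \<tau>' \<in> carrier symp_aut_group"
    using monoid.m_closed[OF group.is_monoid[OF group_symp_aut] \<tau>(1) \<tau>'(1)] by simp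
  ultimately show ?thesis
    unfolding equivalent_def by blast
qed

lemma equivalent_sym:
  assumes TT': "equivalent I n T T'" and T: "square_pairs I n T"
  shows "equivalent I n T' T"
proof -
  obtain \<tau> where \<tau>: "\<tau> \<in> carrier symp_aut_group" "\<And>i. i \<in> I \<Longrightarrow> simul_similar (substitute (n i) \<tau> (T i)) (T' i)"
    using TT' unfolding equivalent_def by blast
  have e: "alg_endo \<tau>" using \<tau> by (simp add: symp_aut_iff)
  define \<tau>' where "\<tau>' = inv_into UNIV \<tau>"
  have \<tau>': "\<tau>' \<in> carrier symp_aut_group"
    unfolding \<tau>'_def by (rule symp_aut_inv_into[OF \<tau>(1)])
  have "\<tau> \<circ> \<tau>' = id"
    using \<tau>(1) by (auto simp: \<tau>'_def symp_aut_iff bij_is_surj surj_f_inv_f)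
  have "simul_similar (substitute (n i) \<tau>' (T' i)) (T i)" if i: "i \<in> I" for i
  proof -
    have T: "square_pair (n i) (T i)" using T i by (simp add: square_pairs_def)
    have "simul_similar (substitute (n i) \<tau>' (T' i)) (substitute (n i) \<tau>' (substitute (n i) \<tau> (T i)))"
      by (rule simul_similar_substitute[OF simul_similar_sym[OF \<tau>(2)[OF i]] square_pair_substitute])
    then show ?thesis
      unfolding substitute_substitute[OF T e] \<open>\<tau> \<circ> \<tau>' = id\<close> substitute_id[OF T] .
  qed
  then show ?thesis
    unfolding equivalent_def using \<tau>' by blast
qed

lemma equivalent_conj:
  assumes T: "square_pairs I n T" and "\<And>i. i \<in> I \<Longrightarrow> simul_similar (T i) (T' i)"
  shows "equivalent I n T T'"
  unfolding equivalent_def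
proof (intro bexI[of _ id] ballI)
  fix i assume i: "i \<in> I"
  then have "substitute (n i) id (T i) = T i"
    using T by (intro substitute_id) (simp add: square_pairs_def)
  then show "simul_similar (substitute (n i) id (T i)) (T' i)"
    using assms(2)[OF i] by simp
qed (use monoid.one_closed[OF group.is_monoid[OF group_symp_aut]] in simp)

lemma equivalent_refl: "square_pairs I n T \<Longrightarrow> equivalent I n T T"
  by (rule equivalent_conj) (auto simp: square_pairs_def intro: simul_similar_refl)

lemma equivalent_automorphism:
  assumes "\<tau> \<in> carrier symp_aut_group" and "\<And>i. i \<in> I \<Longrightarrow> substitute (n i) \<tau> (T i) = T' i"
  shows "equivalent I n T T'"
  unfolding equivalent_def using assms simul_similar_refl square_pair_substitute by metis

lemma equivalent_x_shear:
  assumes "square_pairs I n T"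
  shows "equivalent I n T (\<lambda>i. (fst (T i) + mat_poly (n i) f (snd (T i)), snd (T i)))"
  using assms by (intro equivalent_automorphism[OF x_shear_symp_aut[of f]] substitute_x_shear) (simp add: square_pairs_def)

lemma equivalent_y_shear:
  assumes "square_pairs I n T"
  shows "equivalent I n T (\<lambda>i. (fst (T i), snd (T i) + mat_poly (n i) f (fst (T i))))"
  using assms by (intro equivalent_automorphism[OF y_shear_symp_aut[of f]] substitute_y_shear) (simp add: square_pairs_def)

section \<open>The action on products of Calogero--Moser spaces\<close>

text \<open>The commutator of the pair does not change at all under the group, so neither does any condition on it.\<close>

lemma eval_poly_fixes_commutator:
  assumes X: "X \<in> carrier_mat n n" and Y: "Y \<in> carrier_mat n n" and \<tau>: "\<tau> \<in> carrier symp_aut_group"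
  shows "eval_poly n X Y (\<tau> var_x) * eval_poly n X Y (\<tau> var_y) -
      eval_poly n X Y (\<tau> var_y) * eval_poly n X Y (\<tau> var_x) = X * Y - Y * X"
proof -
  have "commutator (\<tau> var_x) (\<tau> var_y) = commutator var_x var_y"
    using \<tau> by (metis alg_endo_fixes_commutator symp_aut_iff)
  then have "eval_poly n X Y (commutator (\<tau> var_x) (\<tau> var_y)) = eval_poly n X Y (commutator var_x var_y)"
    by simp
  then show ?thesis
    by (simp add: commutator_def eval_poly_diff eval_poly_mult X Y)
qed

lemma CM_pairs_square: "p \<in> CM_pairs n \<Longrightarrow> square_pair n p"
  by (auto simp: CM_pairs_def square_pair_def)

lemma simul_conj_iff:
  "(p, q) \<in> simul_conj n \<longleftrightarrow> p \<in> CM_pairs n \<and> q \<in> CM_pairs n \<and> simul_similar q p"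
  by (cases p; cases q) (simp add: simul_conj_def simul_similar_def)

lemma equiv_simul_conj: "equiv (CM_pairs n) (simul_conj n)"
proof (rule equivI)
  show "refl_on (CM_pairs n) (simul_conj n)"
    unfolding refl_on_def by (auto simp: simul_conj_iff intro: simul_similar_refl[OF CM_pairs_square])
  show "sym (simul_conj n)"
    by (rule symI) (auto simp: simul_conj_iff intro: simul_similar_sym)
  show "trans (simul_conj n)"
    by (rule transI) (auto simp: simul_conj_iff intro: simul_similar_trans)
qed (auto simp: simul_conj_iff)

definition inv_aut :: "(free_alg \<Rightarrow> free_alg) \<Rightarrow> free_alg \<Rightarrow> free_alg" where
  "inv_aut \<sigma> = inv\<^bsub>symp_aut_group\<^esub> \<sigma>"

lemma inv_aut_closed: "\<sigma> \<in> carrier symp_aut_group \<Longrightarrow> inv_aut \<sigma> \<in> carrier symp_aut_group"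
  unfolding inv_aut_def by (rule group.inv_closed[OF group_symp_aut])

lemma act_pair_eq: "act_pair n \<sigma> p = substitute n (inv_aut \<sigma>) p"
  by (cases p) (simp add: act_pair_def inv_aut_def substitute_def)

lemma act_pair_comp:
  assumes "p \<in> CM_pairs n" and \<sigma>: "\<sigma> \<in> carrier symp_aut_group" and \<tau>: "\<tau> \<in> carrier symp_aut_group"
  shows "act_pair n (\<sigma> \<circ> \<tau>) p = act_pair n \<sigma> (act_pair n \<tau> p)"
proof -
  have "inv_aut (\<sigma> \<circ> \<tau>) = inv_aut \<tau> \<circ> inv_aut \<sigma>"
    using group.inv_mult_group[OF group_symp_aut \<sigma> \<tau>] by (simp add: inv_aut_def)
  moreover have "alg_endo (inv_aut \<tau>)"
    using inv_aut_closed[OF \<tau>] by (simp add: symp_aut_iff)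
  ultimately show ?thesis
    using substitute_substitute[OF CM_pairs_square[OF assms(1)]] by (simp add: act_pair_eq)
qed

lemma act_pair_id:
  assumes "p \<in> CM_pairs n" shows "act_pair n id p = p"
proof -
  have "inv_aut id = id"
    using monoid.inv_one[OF group.is_monoid[OF group_symp_aut]] by (simp add: inv_aut_def)
  then show ?thesis
    by (simp add: act_pair_eq substitute_id CM_pairs_square[OF assms])
qed

lemma act_pair_CM_pairs:
  assumes "p \<in> CM_pairs n" and \<sigma>: "\<sigma> \<in> carrier symp_aut_group"
  shows "act_pair n \<sigma> p \<in> CM_pairs n"
proof -
  have c: "fst p \<in> carrier_mat n n" "snd p \<in> carrier_mat n n"
    using CM_pairs_square[OF assms(1)] by (auto simp: square_pair_def)
  show ?thesis
    using assms(1) unfolding act_pair_eq CM_pairs_def substitute_def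
    by (auto simp: eval_poly_fixes_commutator[OF c inv_aut_closed[OF \<sigma>], simplified])
qed

lemma act_pair_simul_conj:
  assumes "(p, q) \<in> simul_conj n" and \<sigma>: "\<sigma> \<in> carrier symp_aut_group"
  shows "(act_pair n \<sigma> p, act_pair n \<sigma> q) \<in> simul_conj n"
  using assms act_pair_CM_pairs[OF _ \<sigma>] simul_similar_substitute CM_pairs_square
  unfolding simul_conj_iff by (simp add: act_pair_eq)

text \<open>The image of a class is a whole class because the inverse automorphism also maps classes into classes.\<close>

lemma act_class_Image:
  assumes p: "p \<in> CM_pairs n" and \<sigma>: "\<sigma> \<in> carrier symp_aut_group"
  shows "act_class n \<sigma> (simul_conj n `` {p}) = simul_conj n `` {act_pair n \<sigma> p}"
proof (intro equalityI subsetI)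
  fix q assume "q \<in> act_class n \<sigma> (simul_conj n `` {p})"
  then show "q \<in> simul_conj n `` {act_pair n \<sigma> p}"
    using act_pair_simul_conj[OF _ \<sigma>] by (auto simp: act_class_def)
next
  fix q assume "q \<in> simul_conj n `` {act_pair n \<sigma> p}"
  then have q: "(act_pair n \<sigma> p, q) \<in> simul_conj n" by simp
  then have qC: "q \<in> CM_pairs n" by (simp add: simul_conj_iff)
  let ?i = "inv_aut \<sigma>"
  note i = inv_aut_closed[OF \<sigma>]
  have inv: "?i \<circ> \<sigma> = id" "\<sigma> \<circ> ?i = id"
    using group.l_inv[OF group_symp_aut \<sigma>] group.r_inv[OF group_symp_aut \<sigma>]
    by (simp_all add: inv_aut_def)
  have "(p, act_pair n ?i q) \<in> simul_conj n"
    using act_pair_simul_conj[OF q i] act_pair_comp[OF p i \<sigma>] inv by (simp add: act_pair_id[OF p])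
  moreover have "q = act_pair n \<sigma> (act_pair n ?i q)"
    using act_pair_comp[OF qC \<sigma> i] inv by (simp add: act_pair_id[OF qC])
  ultimately show "q \<in> act_class n \<sigma> (simul_conj n `` {p})"
    by (auto simp: act_class_def)
qed

lemma CM_spaceE:
  assumes "c \<in> CM_space n"
  obtains p where "p \<in> CM_pairs n" "c = simul_conj n `` {p}"
  using assms by (auto simp: CM_space_def elim: quotientE)

lemma act_class_closed:
  assumes "c \<in> CM_space n" and \<sigma>: "\<sigma> \<in> carrier symp_aut_group"
  shows "act_class n \<sigma> c \<in> CM_space n"
  using assms(1)
  by (elim CM_spaceE) (simp add: act_class_Image[OF _ \<sigma>] CM_space_def act_pair_CM_pairs[OF _ \<sigma>] quotientI)

lemma act_class_comp:
  assumes "c \<in> CM_space n" "\<sigma> \<in> carrier symp_aut_group" "\<tau> \<in> carrier symp_aut_group"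
  shows "act_class n (\<sigma> \<circ> \<tau>) c = act_class n \<sigma> (act_class n \<tau> c)"
proof -
  have "p \<in> CM_pairs n" if "p \<in> c" for p
    using that assms(1) by (elim CM_spaceE) (simp add: simul_conj_iff)
  then show ?thesis
    using act_pair_comp[OF _ assms(2,3)] by (simp add: act_class_def image_image)
qed

lemma act_class_id:
  assumes "c \<in> CM_space n" shows "act_class n id c = c"
proof -
  have "p \<in> CM_pairs n" if "p \<in> c" for p
    using that assms(1) by (elim CM_spaceE) (simp add: simul_conj_iff)
  then show ?thesis
    by (simp add: act_class_def act_pair_id)
qed

lemma diagonal_action_closed:
  assumes "c \<in> CM_product m n" "\<sigma> \<in> carrier symp_aut_group"
  shows "diagonal_action m n \<sigma> c \<in> CM_product m n"
  using assms act_class_closed by (auto simp: diagonal_action_def CM_product_def PiE_iff)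

lemma diagonal_action_comp:
  assumes "c \<in> CM_product m n" "\<sigma> \<in> carrier symp_aut_group" "\<tau> \<in> carrier symp_aut_group"
  shows "diagonal_action m n (\<sigma> \<circ> \<tau>) c = diagonal_action m n \<sigma> (diagonal_action m n \<tau> c)"
proof -
  have "c i \<in> CM_space (n i)" if "i \<in> {1..m}" for i
    using assms(1) that by (auto simp: CM_product_def)
  then show ?thesis
    using assms diagonal_action_closed[OF assms(1,3)] act_class_comp[OF _ assms(2,3)]
    by (auto simp: diagonal_action_def fun_eq_iff restrict_def)
qed

lemma diagonal_action_id:
  assumes "c \<in> CM_product m n"
  shows "diagonal_action m n id c = c"
proof
  fix i show "diagonal_action m n id c i = c i"
    using assms act_class_id[of "c i" "n i"]
    by (cases "i \<in> {1..m}") (auto simp: diagonal_action_def CM_product_def PiE_iff extensional_def)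
qed

lemma group_action_diagonal: "group_action symp_aut_group (CM_product m n) (diagonal_action m n)"
proof -
  let ?E = "CM_product m n" and ?f = "diagonal_action m n"
  have bij: "?f \<sigma> \<in> Bij ?E" if \<sigma>: "\<sigma> \<in> carrier symp_aut_group" for \<sigma>
  proof -
    let ?i = "inv_aut \<sigma>"
    note i = inv_aut_closed[OF \<sigma>]
    have inv: "?i \<circ> \<sigma> = id" "\<sigma> \<circ> ?i = id"
      using group.l_inv[OF group_symp_aut \<sigma>] group.r_inv[OF group_symp_aut \<sigma>]
      by (simp_all add: inv_aut_def)
    have "bij_betw (?f \<sigma>) ?E ?E"
    proof (rule bij_betw_byWitness[where f' = "?f ?i"])
      show "\<forall>c\<in>?E. ?f ?i (?f \<sigma> c) = c"
        using diagonal_action_comp[OF _ i \<sigma>] diagonal_action_id by (simp add: inv)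
      show "\<forall>c\<in>?E. ?f \<sigma> (?f ?i c) = c"
        using diagonal_action_comp[OF _ \<sigma> i] diagonal_action_id by (simp add: inv)
    qed (use diagonal_action_closed \<sigma> i in auto)
    then show ?thesis
      by (simp add: Bij_def diagonal_action_def)
  qed
  have "?f \<in> hom symp_aut_group (BijGroup ?E)"
  proof (rule homI)
    fix \<sigma> \<tau> assume \<sigma>\<tau>: "\<sigma> \<in> carrier symp_aut_group" "\<tau> \<in> carrier symp_aut_group"
    have "?f (\<sigma> \<circ> \<tau>) = compose ?E (?f \<sigma>) (?f \<tau>)"
    proof
      fix c show "?f (\<sigma> \<circ> \<tau>) c = compose ?E (?f \<sigma>) (?f \<tau>) c"
        using diagonal_action_comp[OF _ \<sigma>\<tau>]
        by (cases "c \<in> ?E") (auto simp: compose_def diagonal_action_def)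
    qed
    then show "?f (\<sigma> \<otimes>\<^bsub>symp_aut_group\<^esub> \<tau>) = ?f \<sigma> \<otimes>\<^bsub>BijGroup ?E\<^esub> ?f \<tau>"
      using bij \<sigma>\<tau> by (simp add: BijGroup_def)
  qed (use bij in \<open>simp add: BijGroup_def\<close>)
  then show ?thesis
    unfolding group_action_def
    by (intro group_hom.intro group_hom_axioms.intro group_symp_aut group_BijGroup)
qed

text \<open>What remains to be shown for transitivity is a statement about tuples of matrices.\<close>

lemma transitive_action_if_equivalent:
  assumes "\<And>T T'. (\<forall>i\<in>{1..m}. T i \<in> CM_pairs (n i)) \<Longrightarrow> (\<forall>i\<in>{1..m}. T' i \<in> CM_pairs (n i)) \<Longrightarrow>
    equivalent {1..m} n T T'"
  shows "transitive_action symp_aut_group (CM_product m n) (diagonal_action m n)"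
proof -
  have "\<exists>\<sigma>\<in>carrier symp_aut_group. diagonal_action m n \<sigma> c = c'"
    if c: "c \<in> CM_product m n" and c': "c' \<in> CM_product m n" for c c'
  proof -
    have "\<exists>p. p \<in> CM_pairs (n i) \<and> d i = simul_conj (n i) `` {p}"
      if "d \<in> CM_product m n" "i \<in> {1..m}" for d i
    proof -
      have "d i \<in> CM_space (n i)" using that by (auto simp: CM_product_def)
      then show ?thesis by (rule CM_spaceE) blast
    qed
    then obtain rep where rep: "\<And>d i. d \<in> CM_product m n \<Longrightarrow> i \<in> {1..m} \<Longrightarrow>
        rep d i \<in> CM_pairs (n i) \<and> d i = simul_conj (n i) `` {rep d i}"
      by metis
    obtain \<tau> where \<tau>: "\<tau> \<in> carrier symp_aut_group"
      and s: "\<forall>i\<in>{1..m}. simul_similar (substitute (n i) \<tau> (rep c i)) (rep c' i)"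
      using assms[of "rep c" "rep c'"] rep c c' unfolding equivalent_def by blast
    define \<sigma> where "\<sigma> = inv_aut \<tau>"
    have \<sigma>: "\<sigma> \<in> carrier symp_aut_group"
      unfolding \<sigma>_def by (rule inv_aut_closed[OF \<tau>])
    have "inv_aut \<sigma> = \<tau>"
      using group.inv_inv[OF group_symp_aut \<tau>] by (simp add: \<sigma>_def inv_aut_def)
    have "act_class (n i) \<sigma> (c i) = c' i" if i: "i \<in> {1..m}" for i
    proof -
      have "(rep c' i, act_pair (n i) \<sigma> (rep c i)) \<in> simul_conj (n i)"
        using s i rep[OF c i] rep[OF c' i] act_pair_CM_pairs[OF _ \<sigma>]
        by (simp add: simul_conj_iff act_pair_eq \<open>inv_aut \<sigma> = \<tau>\<close>)
      then have "simul_conj (n i) `` {act_pair (n i) \<sigma> (rep c i)} = simul_conj (n i) `` {rep c' i}"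
        using equiv_class_eq[OF equiv_simul_conj] by metis
      then show ?thesis
        using rep[OF c i] rep[OF c' i] act_class_Image[OF _ \<sigma>] by metis
    qed
    then have "diagonal_action m n \<sigma> c = c'"
      using c c' by (auto simp: diagonal_action_def CM_product_def PiE_iff extensional_def fun_eq_iff)
    then show ?thesis using \<sigma> by blast
  qed
  then show ?thesis
    by (intro transitive_action.intro transitive_action_axioms.intro group_action_diagonal) auto
qed

lemma mult_entry:
  assumes "A \<in> carrier_mat n n" "B \<in> carrier_mat n n" "i < n" "j < n"
  shows "(A * B) $$ (i, j) = (\<Sum>k<n. A $$ (i, k) * B $$ (k, j))"
  using assms by (simp add: scalar_prod_def atLeast0LessThan)

lemma zero_mat_vec: "v \<in> carrier_vec n \<Longrightarrow> 0\<^sub>m n n *\<^sub>v v = 0\<^sub>v n"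
  by (intro eq_vecI) auto

lemma mat_poly_vec_carrier [simp]: "mat_poly n f A *\<^sub>v v \<in> carrier_vec n"
  by (intro carrier_vecI) simp

section \<open>Rank one and the Calogero--Moser relation\<close>

definition outer_product :: "nat \<Rightarrow> complex mat \<Rightarrow> bool" where
  "outer_product n M \<longleftrightarrow> (\<exists>u v. \<forall>a<n. \<forall>b<n. M $$ (a, b) = u a * v b)"

definition CM_relation :: "nat \<Rightarrow> complex mat \<Rightarrow> complex mat \<Rightarrow> bool" where
  "CM_relation n X Y \<longleftrightarrow> outer_product n (X * Y - Y * X + 1\<^sub>m n)"

text \<open>In a matrix of rank one any two columns are linearly dependent, so the minors of size two vanish; then a
  nonzero entry gives the factorisation.\<close>

lemma outer_product_if_rank_one:
  fixes M :: "complex mat"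
  assumes M: "M \<in> carrier_mat n n" and rank: "vec_space.rank n M = 1"
  shows "outer_product n M"
proof -
  interpret vec_space "TYPE(complex)" n .
  have minor: "M $$ (a, c) * M $$ (b, d) = M $$ (b, c) * M $$ (a, d)"
    if a: "a < n" and b: "b < n" and c: "c < n" and d: "d < n" for a b c d
  proof (cases "col M c = col M d")
    case True
    have "M $$ (a, c) = M $$ (a, d)" "M $$ (b, c) = M $$ (b, d)"
      using True M a b c d by (metis carrier_matD index_col)+
    then show ?thesis by simp
  next
    case False
    define A where "A = mat_of_cols n [col M c, col M d]"
    have A: "A \<in> carrier_mat n 2" by (simp add: A_def mat_of_cols_def numeral_2_eq_2)
    have cM: "col M c \<in> carrier_vec n" "col M d \<in> carrier_vec n"
      using M by auto
    then have cols: "cols A = [col M c, col M d]"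
      by (simp add: A_def)
    have "set (cols A) \<subseteq> set (cols M)"
      unfolding cols using M c d by (auto simp: cols_def)
    then have "lin_dep (set (cols A))"
      using rank_ge_card_indpt[OF M, of "set (cols A)"] rank False by (auto simp: cols)
    moreover have "distinct (cols A)"
      using False by (simp add: cols)
    ultimately obtain v where v: "v \<in> carrier_vec 2" "v \<noteq> 0\<^sub>v 2" "A *\<^sub>v v = 0\<^sub>v n"
      using lin_depE[OF A] by blast
    have comb: "v $ 0 * M $$ (i, c) + v $ 1 * M $$ (i, d) = 0" if i: "i < n" for i
    proof -
      have "(A *\<^sub>v v) $ i = M $$ (i, c) * v $ 0 + M $$ (i, d) * v $ 1"
        using A i v(1) c d M by (simp add: scalar_prod_def A_def mat_of_cols_def numeral_2_eq_2)
      then show ?thesis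
        using v(3) i by (simp add: mult.commute)
    qed
    have "v $ 0 \<noteq> 0 \<or> v $ 1 \<noteq> 0"
    proof (rule ccontr)
      assume "\<not> ?thesis"
      then have "v = 0\<^sub>v 2"
        using v(1) by (intro eq_vecI) (auto simp: less_2_cases_iff)
      then show False using v(2) by simp
    qed
    then show ?thesis
    proof
      assume 0: "v $ 0 \<noteq> 0"
      have e: "M $$ (i, c) = - v $ 1 / v $ 0 * M $$ (i, d)" if "i < n" for i
        using comb[OF that] 0 by (simp add: field_simps eq_neg_iff_add_eq_0)
      show ?thesis by (simp add: e[OF a] e[OF b])
    next
      assume 1: "v $ 1 \<noteq> 0"
      have e: "M $$ (i, d) = - v $ 0 / v $ 1 * M $$ (i, c)" if "i < n" for i
        using comb[OF that] 1 by (simp add: field_simps eq_neg_iff_add_eq_0)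
      show ?thesis by (simp add: e[OF a] e[OF b])
    qed
  qed
  show ?thesis
  proof (cases "\<forall>a<n. \<forall>b<n. M $$ (a, b) = 0")
    case True
    then show ?thesis
      unfolding outer_product_def by (intro exI[of _ "\<lambda>_. 0"]) auto
  next
    case False
    then obtain a0 b0 where ab: "a0 < n" "b0 < n" "M $$ (a0, b0) \<noteq> 0" by blast
    then show ?thesis
      unfolding outer_product_def
      using minor[OF _ ab(1) ab(2)]
      by (intro exI[of _ "\<lambda>a. M $$ (a, b0)"] exI[of _ "\<lambda>b. M $$ (a0, b) / M $$ (a0, b0)"])
        (auto simp: field_simps)
  qed
qed

lemma outer_product_mult:
  assumes M: "M \<in> carrier_mat n n" "P \<in> carrier_mat n n" "Q \<in> carrier_mat n n"
    and "outer_product n M"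
  shows "outer_product n (P * M * Q)"
proof -
  obtain u v where uv: "\<And>a b. a < n \<Longrightarrow> b < n \<Longrightarrow> M $$ (a, b) = u a * v b"
    using assms(4) unfolding outer_product_def by blast
  have "(P * M * Q) $$ (a, b) = (\<Sum>c<n. P $$ (a, c) * u c) * (\<Sum>d<n. v d * Q $$ (d, b))"
    if ab: "a < n" "b < n" for a b
  proof -
    have 1: "(P * M) $$ (a, d) = (\<Sum>c<n. P $$ (a, c) * u c) * v d" if "d < n" for d
      unfolding mult_entry[OF M(2,1) ab(1) that] sum_distrib_right
      using that by (intro sum.cong refl) (simp add: uv)
    have "(P * M * Q) $$ (a, b) = (\<Sum>d<n. (P * M) $$ (a, d) * Q $$ (d, b))"
      using M ab by (intro mult_entry) auto
    also have "\<dots> = (\<Sum>d<n. (\<Sum>c<n. P $$ (a, c) * u c) * (v d * Q $$ (d, b)))"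
      by (intro sum.cong refl) (simp only: 1 lessThan_iff mult.assoc)
    finally show ?thesis
      by (simp add: sum_distrib_left)
  qed
  then show ?thesis
    unfolding outer_product_def
    by (intro exI[of _ "\<lambda>a. \<Sum>c<n. P $$ (a, c) * u c"] exI[of _ "\<lambda>b. \<Sum>d<n. v d * Q $$ (d, b)"]) simp
qed

lemma CM_relation_if_CM_pairs: "(X, Y) \<in> CM_pairs n \<Longrightarrow> CM_relation n X Y"
proof (cases "n = 0")
  case True
  then show ?thesis by (simp add: CM_relation_def outer_product_def)
next
  case False
  assume "(X, Y) \<in> CM_pairs n"
  then have "vec_space.rank n (X * Y - Y * X + 1\<^sub>m n) = 1"
    using False by (simp add: CM_pairs_def)
  then show ?thesis
    unfolding CM_relation_def by (intro outer_product_if_rank_one) simp_all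
qed

lemma CM_relation_similar:
  assumes "similar_mat_wit X' X P Q" and "similar_mat_wit Y' Y P Q" and X: "X \<in> carrier_mat n n"
    and CM: "CM_relation n X' Y'"
  shows "CM_relation n X Y"
proof -
  note c = similar_carrier[OF assms(1) X]
  note cY = similar_carrier'[OF assms(2) c(2)]
  have "similar_mat_wit (eval_poly n X' Y' (commutator var_x var_y + 1)) (eval_poly n X Y (commutator var_x var_y + 1)) P Q"
    by (rule eval_poly_similar[OF assms(1-3)])
  then have "similar_mat_wit (X * Y - Y * X + 1\<^sub>m n) (X' * Y' - Y' * X' + 1\<^sub>m n) Q P"
    using X c cY
    by (simp add: commutator_def eval_poly_add eval_poly_diff eval_poly_mult similar_mat_wit_sym)
  moreover have "X' * Y' - Y' * X' + 1\<^sub>m n \<in> carrier_mat n n"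
    by simp
  ultimately have "X * Y - Y * X + 1\<^sub>m n = Q * (X' * Y' - Y' * X' + 1\<^sub>m n) * P"
    using similar_mat_witD2(3) by (metis similar_carrier(1))
  then show ?thesis
    using CM c unfolding CM_relation_def by (metis \<open>X' * Y' - Y' * X' + 1\<^sub>m n \<in> carrier_mat n n\<close> outer_product_mult)
qed

lemma equivalent_CM_relation:
  assumes T: "square_pairs I n T" and TT': "equivalent I n T T'" and i: "i \<in> I"
    and CM: "CM_relation (n i) (fst (T i)) (snd (T i))"
  shows "CM_relation (n i) (fst (T' i)) (snd (T' i))"
proof -
  have c': "fst (T' i) \<in> carrier_mat (n i) (n i)"
    by (rule square_pairsD(1)[OF equivalent_square_pairs[OF TT'] i])
  from TT' i obtain \<tau> P Q where \<tau>: "\<tau> \<in> carrier symp_aut_group"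
    and s: "similar_mat_wit (eval_poly (n i) (fst (T i)) (snd (T i)) (\<tau> var_x)) (fst (T' i)) P Q"
      "similar_mat_wit (eval_poly (n i) (fst (T i)) (snd (T i)) (\<tau> var_y)) (snd (T' i)) P Q"
    unfolding equivalent_def simul_similar_def substitute_def by auto
  show ?thesis
    by (rule CM_relation_similar[OF s c'])
      (use CM in \<open>simp add: CM_relation_def eval_poly_fixes_commutator[OF square_pairsD[OF T i] \<tau>]\<close>)
qed

section \<open>Annihilating polynomials, invariant subspaces and nilpotent matrices\<close>

abbreviation lin_factors :: "complex list \<Rightarrow> complex poly" where
  "lin_factors es \<equiv> prod_list (map (\<lambda>e. [:- e, 1:]) es)"

lemma mat_poly_linear:
  "A \<in> carrier_mat n n \<Longrightarrow> mat_poly n [:- e, 1:] A = A - e \<cdot>\<^sub>m 1\<^sub>m n"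
  by (simp add: mat_poly_pCons, intro eq_matI) auto

lemma mat_poly_linear_vec:
  assumes "A \<in> carrier_mat n n" "v \<in> carrier_vec n"
  shows "mat_poly n [:- e, 1:] A *\<^sub>v v = A *\<^sub>v v - e \<cdot>\<^sub>v v"
  using assms by (simp add: mat_poly_linear minus_mult_distrib_mat_vec[of _ n n] smult_mat_mult_vec[of _ n])

lemma mat_eq_zeroI:
  fixes A :: "complex mat"
  assumes A: "A \<in> carrier_mat n n" and "\<And>v. v \<in> carrier_vec n \<Longrightarrow> A *\<^sub>v v = 0\<^sub>v n"
  shows "A = 0\<^sub>m n n"
proof (rule eq_matI)
  fix i j assume ij: "i < dim_row (0\<^sub>m n n)" "j < dim_col (0\<^sub>m n n)"
  have "(A *\<^sub>v unit_vec n j) $ i = A $$ (i, j)"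
    using A ij by simp
  then show "A $$ (i, j) = 0\<^sub>m n n $$ (i, j)"
    using assms(2)[of "unit_vec n j"] ij by simp
qed (use A in auto)

text \<open>Subtracting the last diagonal entry from an upper triangular matrix makes it map each term of the standard
  flag into the previous one.\<close>

lemma upper_triangular_annihilated:
  assumes U: "U \<in> carrier_mat n n" and ut: "upper_triangular U" and "k \<le> n"
    and "u \<in> carrier_vec n" and "\<And>i. k \<le> i \<Longrightarrow> i < n \<Longrightarrow> u $ i = 0"
  shows "mat_poly n (lin_factors (map (\<lambda>i. U $$ (i, i)) [0..<k])) U *\<^sub>v u = 0\<^sub>v n"
  using assms(3-5)
proof (induction k arbitrary: u)
  case 0
  then have "u = 0\<^sub>v n" by (intro eq_vecI) auto
  then show ?case using U by simp
next
  case (Suc k)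
  let ?f = "lin_factors (map (\<lambda>i. U $$ (i, i)) [0..<k])" and ?g = "[:- U $$ (k, k), 1:]"
  define w where "w = mat_poly n ?g U *\<^sub>v u"
  have w: "w = U *\<^sub>v u - U $$ (k, k) \<cdot>\<^sub>v u"
    unfolding w_def by (rule mat_poly_linear_vec[OF U Suc.prems(2)])
  have "w $ i = 0" if i: "k \<le> i" "i < n" for i
  proof -
    have "(U *\<^sub>v u) $ i = (\<Sum>j<n. U $$ (i, j) * u $ j)"
      using U Suc.prems(2) i by (simp add: scalar_prod_def atLeast0LessThan)
    also have "\<dots> = (\<Sum>j<n. if j = k then U $$ (i, j) * u $ j else 0)"
    proof (rule sum.cong[OF refl])
      fix j assume "j \<in> {..<n}"
      then show "U $$ (i, j) * u $ j = (if j = k then U $$ (i, j) * u $ j else 0)"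
        using Suc.prems(3)[of j] upper_triangularD[OF ut, of j i] U i by (cases "j < k") auto
    qed
    also have "\<dots> = U $$ (i, k) * u $ k"
      using Suc.prems(1) by simp
    finally show ?thesis
      using upper_triangularD[OF ut, of k i] Suc.prems(2) Suc.prems(3)[of i] U i
      by (cases "i = k") (auto simp: w)
  qed
  moreover have "w \<in> carrier_vec n" by (simp add: w_def)
  ultimately have "mat_poly n ?f U *\<^sub>v w = 0\<^sub>v n"
    using Suc by simp
  moreover have "mat_poly n (lin_factors (map (\<lambda>i. U $$ (i, i)) [0..<Suc k])) U =
      mat_poly n ?f U * mat_poly n ?g U"
    using U by (simp add: mat_poly_mult[symmetric])
  ultimately show ?case
    using Suc.prems(2) by (simp add: w_def sq_mult_vec[where n = n])
qed

lemma schur_form: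
  fixes A :: "complex mat"
  assumes A: "A \<in> carrier_mat n n"
  obtains U P Q where "similar_mat_wit A U P Q" "U \<in> carrier_mat n n" "upper_triangular U"
    "\<forall>i<n. U $$ (i, i) \<in> spectrum A"
proof -
  obtain es where es: "char_poly A = (\<Prod>e\<leftarrow>es. [:- e, 1:])"
    using char_poly_factorized[OF A] by blast
  obtain U P Q where U: "schur_decomposition A es = (U, P, Q)"
    by (metis prod_cases3)
  then have s: "similar_mat_wit A U P Q" and ut: "upper_triangular U" and d: "diag_mat U = es"
    using schur_decomposition[OF A es U] by auto
  have U: "U \<in> carrier_mat n n" by (rule similar_mat_witD2(5)[OF A s])
  have "U $$ (i, i) \<in> spectrum A" if "i < n" for i
  proof -
    have "U $$ (i, i) \<in> set es"
      using that U by (auto simp: d[symmetric] diag_mat_def)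
    then show ?thesis
      by (auto simp: spectrum_root_char_poly[OF A] es poly_prod_list prod_list_zero_iff)
  qed
  then show ?thesis using that s ut U by blast
qed

text \<open>The Cayley--Hamilton theorem, with the factors of the characteristic polynomial listed as eigenvalues.\<close>

lemma annihilating_poly:
  fixes A :: "complex mat"
  assumes A: "A \<in> carrier_mat n n"
  obtains es where "length es = n" "set es \<subseteq> spectrum A" "mat_poly n (lin_factors es) A = 0\<^sub>m n n"
proof -
  obtain U P Q where s: "similar_mat_wit A U P Q" and U: "U \<in> carrier_mat n n" "upper_triangular U"
    and d: "\<forall>i<n. U $$ (i, i) \<in> spectrum A"
    by (rule schur_form[OF A])
  let ?es = "map (\<lambda>i. U $$ (i, i)) [0..<n]"
  have "mat_poly n (lin_factors ?es) U = 0\<^sub>m n n"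
    by (rule mat_eq_zeroI) (use upper_triangular_annihilated[OF U, of n] in auto)
  then have "similar_mat_wit (mat_poly n (lin_factors ?es) A) (0\<^sub>m n n) P Q"
    using mat_poly_similar[OF s U(1)] by metis
  then have "mat_poly n (lin_factors ?es) A = P * 0\<^sub>m n n * Q"
    by (rule similar_mat_witD2(3)[OF mat_poly_carrier])
  also have "\<dots> = 0\<^sub>m n n"
    using similar_mat_witD2(6,7)[OF A s] by simp
  finally show ?thesis
    using that[of ?es] d by fastforce
qed

text \<open>Apply the linear factors of an annihilating polynomial to \<open>w\<close> one by one: the last nonzero vector is
  an eigenvector and has not left the invariant set, which below is the image of a projection.\<close>

lemma eigenvector_in_invariant_set:
  fixes A :: "complex mat"
  assumes A: "A \<in> carrier_mat n n" and W: "W \<subseteq> carrier_vec n"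
    and inv: "\<And>v c. v \<in> W \<Longrightarrow> A *\<^sub>v v - c \<cdot>\<^sub>v v \<in> W" and w: "w \<in> W" "w \<noteq> 0\<^sub>v n"
  obtains v k where "v \<in> W" "v \<noteq> 0\<^sub>v n" "A *\<^sub>v v = k \<cdot>\<^sub>v v"
proof -
  have "\<exists>v\<in>W. v \<noteq> 0\<^sub>v n \<and> (\<exists>k. A *\<^sub>v v = k \<cdot>\<^sub>v v)"
    if "mat_poly n (lin_factors es) A *\<^sub>v w = 0\<^sub>v n" "w \<in> W" "w \<noteq> 0\<^sub>v n" for es w
    using that
  proof (induction es arbitrary: w)
    case Nil
    then show ?case using A W by auto
  next
    case (Cons e es)
    have wc: "w \<in> carrier_vec n" using Cons.prems W by blast
    define w' where "w' = mat_poly n [:- e, 1:] A *\<^sub>v w"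
    have w': "w' = A *\<^sub>v w - e \<cdot>\<^sub>v w"
      unfolding w'_def by (rule mat_poly_linear_vec[OF A wc])
    show ?case
    proof (cases "w' = 0\<^sub>v n")
      case True
      have "(A *\<^sub>v w) $ i = e * w $ i" if "i < n" for i
      proof -
        have "(A *\<^sub>v w - e \<cdot>\<^sub>v w) $ i = 0" using True that by (simp add: w')
        then show ?thesis using A wc that by simp
      qed
      then have "A *\<^sub>v w = e \<cdot>\<^sub>v w"
        using A wc by (intro eq_vecI) auto
      then show ?thesis using Cons.prems by blast
    next
      case False
      have "mat_poly n (lin_factors (e # es)) A = mat_poly n (lin_factors es) A * mat_poly n [:- e, 1:] A"
        using A by (simp add: mat_poly_mult[symmetric] mult.commute)
      then have "mat_poly n (lin_factors es) A *\<^sub>v w' = 0\<^sub>v n"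
        using Cons.prems(1) wc by (simp add: w'_def sq_mult_vec[where n = n])
      moreover have "w' \<in> W" unfolding w' by (rule inv[OF Cons.prems(2)])
      ultimately show ?thesis using Cons.IH False by blast
    qed
  qed
  moreover obtain es where "mat_poly n (lin_factors es) A = 0\<^sub>m n n"
    using annihilating_poly[OF A] by blast
  ultimately show ?thesis
    using that w W by (metis (no_types, lifting) subsetD zero_mat_vec)
qed

definition trace :: "nat \<Rightarrow> complex mat \<Rightarrow> complex" where
  "trace n A = (\<Sum>i<n. A $$ (i, i))"

lemma trace_add: "A \<in> carrier_mat n n \<Longrightarrow> B \<in> carrier_mat n n \<Longrightarrow> trace n (A + B) = trace n A + trace n B"
  by (simp add: trace_def sum.distrib)

lemma trace_smult: "A \<in> carrier_mat n n \<Longrightarrow> trace n (c \<cdot>\<^sub>m A) = c * trace n A"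
  by (simp add: trace_def sum_distrib_left)

lemma trace_mult_entries:
  assumes "A \<in> carrier_mat n n" "B \<in> carrier_mat n n"
  shows "trace n (A * B) = (\<Sum>i<n. \<Sum>j<n. A $$ (i, j) * B $$ (j, i))"
  using assms by (simp add: trace_def scalar_prod_def atLeast0LessThan)

lemma trace_comm:
  assumes "A \<in> carrier_mat n n" "B \<in> carrier_mat n n"
  shows "trace n (A * B) = trace n (B * A)"
  unfolding trace_mult_entries[OF assms] trace_mult_entries[OF assms(2,1)]
  by (subst sum.swap) (simp add: mult.commute)

lemma trace_nilpotent:
  assumes A: "A \<in> carrier_mat n n" and nil: "spectrum A \<subseteq> {0}"
  shows "trace n A = 0"
proof -
  obtain U P Q where s: "similar_mat_wit A U P Q" and U: "U \<in> carrier_mat n n" and "upper_triangular U"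
    and d: "\<forall>i<n. U $$ (i, i) \<in> spectrum A"
    by (rule schur_form[OF A])
  note w = similar_mat_witD2[OF A s]
  have "trace n A = trace n (Q * (P * U))"
    unfolding w(3) by (intro trace_comm sq_mult w)
  also have "Q * (P * U) = U"
    using sq_assoc[OF w(7,6) U] w(2) U by simp
  also have "trace n U = 0"
    unfolding trace_def using d nil by (intro sum.neutral) blast
  finally show ?thesis .
qed

lemma spectrumI:
  "A \<in> carrier_mat n n \<Longrightarrow> v \<in> carrier_vec n \<Longrightarrow> v \<noteq> 0\<^sub>v n \<Longrightarrow> A *\<^sub>v v = k \<cdot>\<^sub>v v \<Longrightarrow> k \<in> spectrum A"
  by (auto simp: spectrum_def eigenvalue_def eigenvector_def)

lemma spectrumE:
  assumes "k \<in> spectrum A" "A \<in> carrier_mat n n"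
  obtains v where "v \<in> carrier_vec n" "v \<noteq> 0\<^sub>v n" "A *\<^sub>v v = k \<cdot>\<^sub>v v"
  using assms by (auto simp: spectrum_def eigenvalue_def eigenvector_def)

lemma spectrum_annihilated:
  assumes A: "A \<in> carrier_mat n n" and "mat_poly n f A = 0\<^sub>m n n" and k: "k \<in> spectrum A"
  shows "poly f k = 0"
proof -
  obtain v where v: "v \<in> carrier_vec n" "v \<noteq> 0\<^sub>v n" "A *\<^sub>v v = k \<cdot>\<^sub>v v"
    using spectrumE[OF k A] by blast
  have "poly f k \<cdot>\<^sub>v v = 0\<^sub>v n"
    using mat_poly_eigenvector[OF A v(1,3), of f] assms(2) zero_mat_vec[OF v(1)] by simp
  moreover obtain i where "i < n" "v $ i \<noteq> 0"
    using v(1,2) by (metis carrier_vecD eq_vecI index_zero_vec)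
  ultimately show ?thesis
    using v(1) by (metis carrier_vecD index_smult_vec(1) index_zero_vec(1) mult_eq_0_iff)
qed

lemma trace_nilpotent_power:
  assumes A: "A \<in> carrier_mat n n" and nil: "spectrum A \<subseteq> {0}" and k: "0 < k"
  shows "trace n (mat_poly n ([:0, 1:] ^ k) A) = 0"
proof (rule trace_nilpotent[OF mat_poly_carrier])
  obtain es where es: "length es = n" "set es \<subseteq> {0}" "mat_poly n (lin_factors es) A = 0\<^sub>m n n"
    using annihilating_poly[OF A] nil by (metis subset_trans)
  then have "es = replicate n 0"
    by (metis replicate_length_same singletonD subsetD)
  then have z: "mat_poly n ([:0, 1:] ^ n) A = 0\<^sub>m n n"
    using es(3) by simp
  have "([:0, 1:] :: complex poly) ^ n dvd ([:0, 1:] ^ k) ^ n"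
    using k by (metis dvd_power dvd_power_same)
  then obtain h where h: "([:0, 1:] ^ k) ^ n = ([:0, 1:] :: complex poly) ^ n * h"
    by (auto elim: dvdE)
  have "pcompose ([:0, 1:] ^ m) ([:0, 1:] ^ k) = (([:0, 1:] ^ k) ^ m :: complex poly)" for m
    by (induction m) (simp_all add: pcompose_mult pcompose_pCons pcompose_1)
  then have "mat_poly n ([:0, 1:] ^ n) (mat_poly n ([:0, 1:] ^ k) A) = 0\<^sub>m n n"
    using A mat_poly_pcompose[OF A, of "[:0, 1:] ^ n" "[:0, 1:] ^ k"]
    by (simp add: h mat_poly_mult z)
  from spectrum_annihilated[OF mat_poly_carrier this]
  show "spectrum (mat_poly n ([:0, 1:] ^ k) A) \<subseteq> {0}"
    by auto
qed

section \<open>Congruences between polynomials\<close>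

text \<open>Coprimality in the form of a Bezout identity, which is what the constructions below need.\<close>

definition bezout :: "complex poly \<Rightarrow> complex poly \<Rightarrow> bool" where
  "bezout p q \<longleftrightarrow> (\<exists>a b. a * p + b * q = 1)"

lemma bezout_commute: "bezout p q \<Longrightarrow> bezout q p"
  unfolding bezout_def by (metis add.commute)

lemma bezout_mult:
  assumes "bezout p q" "bezout p r" shows "bezout p (q * r)"
proof -
  obtain a b c d where 1: "a * p + b * q = 1" "c * p + d * r = 1"
    using assms unfolding bezout_def by blast
  have "(a * (c * p + d * r) + b * q * c) * p + (b * d) * (q * r) = (a * p + b * q) * (c * p + d * r)"
    by (simp add: algebra_simps)
  then show ?thesis
    unfolding bezout_def using 1 by (metis mult_1)
qed

lemma bezout_1: "bezout p 1"
  unfolding bezout_def by (intro exI[of _ 0] exI[of _ 1]) simp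

lemma bezout_power: "bezout p q \<Longrightarrow> bezout p (q ^ k)"
  by (induction k) (simp_all add: bezout_1 bezout_mult)

lemma bezout_prod: "(\<And>x. x \<in> A \<Longrightarrow> bezout p (q x)) \<Longrightarrow> bezout p (prod q A)"
  by (induction A rule: infinite_finite_induct) (simp_all add: bezout_1 bezout_mult)

lemma bezout_linear:
  assumes "x \<noteq> y" shows "bezout [:- x, 1:] [:- y, 1:]"
proof -
  define t where "t = 1 / (y - x)"
  have "t * (y - x) = 1" using assms by (simp add: t_def)
  then have "[:t:] * [:- x, 1:] + [:- t:] * [:- y, 1:] = 1"
    by (simp add: one_pCons algebra_simps)
  then show ?thesis unfolding bezout_def by blast
qed

lemma bezout_linear_power: "x \<noteq> y \<Longrightarrow> bezout ([:- x, 1:] ^ k) ([:- y, 1:] ^ l)"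
  by (intro bezout_power bezout_commute[OF bezout_power] bezout_commute[OF bezout_linear])

lemma bezout_dvd:
  assumes "bezout p q" "p dvd r" "q dvd r" shows "p * q dvd r"
proof -
  obtain a b where "a * p + b * q = 1" using assms(1) unfolding bezout_def by blast
  then have "r = a * (p * r) + b * (r * q)"
    by (metis (no_types, opaque_lifting) mult.assoc mult.commute mult_1 distrib_right)
  moreover have "p * q dvd a * (p * r) + b * (r * q)"
    using assms(2,3) by (intro dvd_add dvd_mult mult_dvd_mono dvd_refl)
  ultimately show ?thesis by simp
qed

lemma poly_chinese_remainder:
  fixes c :: "complex \<Rightarrow> complex poly"
  assumes "finite L"
  obtains q where "\<And>x. x \<in> L \<Longrightarrow> [:- x, 1:] ^ K dvd q - c x"
proof -
  have "\<exists>q. \<forall>x\<in>L. [:- x, 1:] ^ K dvd q - c x"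
    using assms
  proof (induction L rule: finite_induct)
    case (insert y L)
    then obtain q where q: "\<And>x. x \<in> L \<Longrightarrow> [:- x, 1:] ^ K dvd q - c x" by blast
    define M where "M = (\<Prod>x\<in>L. [:- x, 1:] ^ K)"
    have "bezout ([:- y, 1:] ^ K) M"
      unfolding M_def using insert.hyps by (intro bezout_prod bezout_linear_power) auto
    then obtain a b where ab: "a * [:- y, 1:] ^ K + b * M = 1"
      unfolding bezout_def by blast
    let ?q = "q + b * M * (c y - q)"
    have "[:- x, 1:] ^ K dvd ?q - c x" if "x \<in> L" for x
    proof -
      have "[:- x, 1:] ^ K dvd M"
        unfolding M_def using insert.hyps(1) that by (rule dvd_prodI)
      then have "[:- x, 1:] ^ K dvd (q - c x) + b * M * (c y - q)"
        using q[OF that] by (intro dvd_add) auto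
      then show ?thesis by (simp add: algebra_simps)
    qed
    moreover have "[:- y, 1:] ^ K dvd ?q - c y"
    proof -
      have "?q - c y = (q - c y) * (1 - b * M)" by (simp add: algebra_simps)
      also have "1 - b * M = a * [:- y, 1:] ^ K" using ab by (metis add_diff_cancel_right')
      finally show ?thesis by (simp only: dvd_mult dvd_refl)
    qed
    ultimately show ?case by blast
  qed auto
  then show ?thesis using that by blast
qed

lemma prod_linear_powers_dvd:
  assumes "finite L" and "\<And>x. x \<in> L \<Longrightarrow> [:- x, 1:] ^ K dvd (f :: complex poly)"
  shows "(\<Prod>x\<in>L. [:- x, 1:] ^ K) dvd f"
  using assms
proof (induction L rule: finite_induct)
  case (insert y L)
  then show ?case
    by (simp, intro bezout_dvd bezout_prod bezout_linear_power) auto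
qed simp

text \<open>A polynomial that vanishes to high order on the spectrum annihilates the matrix. So the value of a
  polynomial at a matrix depends only on its residues at the eigenvalues.\<close>

lemma mat_poly_vanish:
  assumes A: "A \<in> carrier_mat n n" and "finite L" and sub: "spectrum A \<subseteq> L" and "n \<le> K"
    and dvd: "\<And>x. x \<in> L \<Longrightarrow> [:- x, 1:] ^ K dvd f"
  shows "mat_poly n f A = 0\<^sub>m n n"
proof -
  obtain es where es: "length es = n" "set es \<subseteq> spectrum A" "mat_poly n (lin_factors es) A = 0\<^sub>m n n"
    by (rule annihilating_poly[OF A])
  have "lin_factors es dvd (\<Prod>x\<in>L. [:- x, 1:]) ^ length es" if "set es \<subseteq> L" for es
    using that
  proof (induction es)
    case (Cons e es)
    then have "[:- e, 1:] dvd (\<Prod>x\<in>L. [:- x, 1:])"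
      using \<open>finite L\<close> by (intro dvd_prodI) auto
    then show ?case
      using Cons unfolding list.map prod_list.Cons list.size(4) power_Suc add_Suc_right add_0_right
      by (intro mult_dvd_mono) auto
  qed simp
  then have "lin_factors es dvd (\<Prod>x\<in>L. [:- x, 1:]) ^ n"
    using es sub by (metis subset_trans)
  also have "\<dots> dvd (\<Prod>x\<in>L. [:- x, 1:]) ^ K"
    using \<open>n \<le> K\<close> by (rule le_imp_power_dvd)
  also have "\<dots> = (\<Prod>x\<in>L. [:- x, 1:] ^ K)"
    by (simp add: prod_power_distrib)
  also have "\<dots> dvd f"
    by (rule prod_linear_powers_dvd[OF \<open>finite L\<close> dvd])
  finally obtain h where "f = lin_factors es * h" by (auto elim: dvdE)
  then show ?thesis
    using A es(3) by (simp add: mat_poly_mult left_mult_zero_mat[of _ n n])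
qed

section \<open>Perturbation of eigenvalues\<close>

lemma det_pencil:
  fixes A B :: "complex mat"
  assumes "A \<in> carrier_mat n n" "B \<in> carrier_mat n n"
  obtains p where "degree p \<le> n" "\<And>z. poly p z = det (A + z \<cdot>\<^sub>m B)"
proof -
  define M where "M = mat n n (\<lambda>(i, j). [:A $$ (i, j), B $$ (i, j):])"
  have "degree (det M) \<le> 1 * n"
    by (rule degree_det_le) (auto simp: M_def)
  moreover have "poly (det M) z = det (A + z \<cdot>\<^sub>m B)" for z
    by (rule poly_det_cong[of _ n]) (use assms in \<open>auto simp: M_def\<close>)
  ultimately show ?thesis using that[of "det M"] by simp
qed

text \<open>If a polynomial has no root near \<open>b\<close>, then its value at \<open>b\<close> controls its value everywhere else,
  because each linear factor grows by a bounded ratio.\<close>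

lemma poly_growth_root_free:
  fixes p :: "complex poly"
  assumes "\<delta> > 0" and "\<And>r. poly p r = 0 \<Longrightarrow> \<delta> \<le> norm (b - r)"
  shows "norm (poly p w) \<le> norm (poly p b) * (1 + norm (w - b) / \<delta>) ^ degree p"
proof -
  obtain rs where rs: "p = Polynomial.smult (lead_coeff p) (lin_factors rs)" and len: "length rs = degree p"
    using fundamental_theorem_algebra_factorized[of p] by metis
  have *: "norm (poly (lin_factors rs) w) \<le> norm (poly (lin_factors rs) b) * (1 + norm (w - b) / \<delta>) ^ length rs"
    if "\<forall>r\<in>set rs. \<delta> \<le> norm (b - r)" for rs
    using that
  proof (induction rs)
    case (Cons r rs)
    have "norm (w - r) \<le> norm (b - r) + norm (w - b)"
      by (metis add.commute diff_add_cancel add_diff_eq norm_triangle_ineq)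
    also have "norm (w - b) \<le> norm (b - r) * (norm (w - b) / \<delta>)"
      using Cons.prems assms(1) by (simp add: field_simps mult_right_mono)
    finally have "norm (w - r) \<le> norm (b - r) * (1 + norm (w - b) / \<delta>)"
      by (simp add: distrib_left)
    then have "norm (w - r) * norm (poly (lin_factors rs) w) \<le> (norm (b - r) * (1 + norm (w - b) / \<delta>)) *
        (norm (poly (lin_factors rs) b) * (1 + norm (w - b) / \<delta>) ^ length rs)"
      using Cons assms(1) by (intro mult_mono) auto
    moreover have "poly (lin_factors (r # rs)) z = (z - r) * poly (lin_factors rs) z" for z
      by (simp add: algebra_simps)
    ultimately show ?case by (simp only: norm_mult list.size(4) power_add power_Suc0_right mult_ac)
  qed simp
  have "\<forall>r\<in>set rs. \<delta> \<le> norm (b - r)"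
  proof
    fix r assume "r \<in> set rs"
    then have "poly (lin_factors rs) r = 0"
      by (auto simp: poly_prod_list prod_list_zero_iff)
    then have "poly p r = 0"
      by (subst rs) simp
    then show "\<delta> \<le> norm (b - r)" by (rule assms(2))
  qed
  from mult_left_mono[OF *[OF this], of "norm (lead_coeff p)"]
  have "norm (lead_coeff p) * norm (poly (lin_factors rs) w) \<le>
      norm (lead_coeff p) * norm (poly (lin_factors rs) b) * (1 + norm (w - b) / \<delta>) ^ degree p"
    by (simp add: len mult.assoc)
  moreover have "poly p z = lead_coeff p * poly (lin_factors rs) z" for z
    using arg_cong[OF rs, of "\<lambda>q. poly q z"] by simp
  ultimately show ?thesis
    by (simp only: norm_mult)
qed

text \<open>Roots of a family of polynomials of bounded degree persist, although the degree may drop at the parameter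
  \<open>0\<close>: otherwise the values at \<open>w\<close>, controlled by those at \<open>b\<close>, would tend to \<open>0\<close>.\<close>

lemma root_persistence:
  fixes p :: "complex \<Rightarrow> complex poly"
  assumes deg: "\<And>e. degree (p e) \<le> n"
    and lim: "\<And>w. ((\<lambda>e. poly (p e) w) \<longlongrightarrow> poly (p 0) w) (at 0)"
    and root: "poly (p 0) b = 0" and nz: "poly (p 0) w \<noteq> 0" and \<delta>: "\<delta> > 0"
  shows "\<forall>\<^sub>F e in at 0. \<exists>r. norm (r - b) < \<delta> \<and> poly (p e) r = 0"
proof -
  define C where "C = (1 + norm (w - b) / \<delta>) ^ n"
  define m where "m = norm (poly (p 0) w)"
  have C: "C \<ge> 1" unfolding C_def using \<delta> by (intro one_le_power) simp
  have m: "m > 0" using nz by (simp add: m_def)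
  have "((\<lambda>e. norm (poly (p e) w)) \<longlongrightarrow> m) (at 0)" "((\<lambda>e. norm (poly (p e) b)) \<longlongrightarrow> 0) (at 0)"
    using tendsto_norm[OF lim[of w]] tendsto_norm[OF lim[of b]] root by (simp_all add: m_def)
  then have "\<forall>\<^sub>F e in at 0. norm (poly (p e) w) > m / 2" "\<forall>\<^sub>F e in at 0. norm (poly (p e) b) < m / (2 * C)"
    using order_tendstoD(1)[of _ m _ "m / 2"] order_tendstoD(2)[of _ 0 _ "m / (2 * C)"] m C by force+
  then show ?thesis
  proof eventually_elim
    case (elim e)
    show ?case
    proof (rule ccontr)
      assume "\<not> ?thesis"
      then have "norm (poly (p e) w) \<le> norm (poly (p e) b) * (1 + norm (w - b) / \<delta>) ^ degree (p e)"
        using \<delta> by (intro poly_growth_root_free) (auto simp: norm_minus_commute not_less)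
      also have "\<dots> \<le> norm (poly (p e) b) * C"
        unfolding C_def using \<delta> deg by (intro mult_left_mono power_increasing) auto
      also have "\<dots> \<le> m / (2 * C) * C"
        using elim C by (intro mult_right_mono) auto
      also have "\<dots> = m / 2" using C by simp
      finally show False using elim by simp
    qed
  qed
qed

text \<open>The matrix \<open>e\<close> below is the projection onto the eigenspace of \<open>D\<close> for \<open>\<gamma>\<close> along the other eigenspaces, and
  \<open>b\<close> is an eigenvalue of the compression of \<open>B\<close> to that eigenspace. The pencil \<open>M\<close> is
  \<open>\<gamma> + \<epsilon> w - D - \<epsilon> B\<close> with the rows in the image of \<open>e\<close> divided by \<open>\<epsilon>\<close>; so it still makes sense
  at \<open>\<epsilon> = 0\<close>, where it is singular exactly if \<open>w\<close> is an eigenvalue of the compression.\<close>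

lemma eigenvalue_cluster:
  fixes D B e :: "complex mat"
  assumes D: "D \<in> carrier_mat n n" and B: "B \<in> carrier_mat n n" and e: "e \<in> carrier_mat n n"
    and ee: "e * e = e" and eD: "e * D = \<gamma> \<cdot>\<^sub>m e"
    and eig: "\<And>v. v \<in> carrier_vec n \<Longrightarrow> D *\<^sub>v v = \<gamma> \<cdot>\<^sub>v v \<Longrightarrow> e *\<^sub>v v = v"
    and v: "v \<in> carrier_vec n" "v \<noteq> 0\<^sub>v n" "D *\<^sub>v v = \<gamma> \<cdot>\<^sub>v v" "e *\<^sub>v (B *\<^sub>v v) = b \<cdot>\<^sub>v v"
    and \<delta>: "\<delta> > 0"
  shows "\<forall>\<^sub>F \<epsilon> in at 0. \<exists>w. norm (w - b) < \<delta> \<and> \<gamma> + \<epsilon> * w \<in> spectrum (D + \<epsilon> \<cdot>\<^sub>m B)"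
proof -
  \<comment> \<open>For fixed \<open>w\<close> the pencil is affine in \<open>\<epsilon>\<close> and for fixed \<open>\<epsilon>\<close> it is affine in \<open>w\<close>; so its determinant is a
    polynomial in each of them.\<close>
  define eB where "eB = e * B"
  have eB: "eB \<in> carrier_mat n n" using e B by (simp add: eB_def)
  define H where "H \<epsilon> = \<gamma> \<cdot>\<^sub>m 1\<^sub>m n - D - (eB + \<epsilon> \<cdot>\<^sub>m (B - eB))" for \<epsilon>
  define G where "G \<epsilon> = e + \<epsilon> \<cdot>\<^sub>m (1\<^sub>m n - e)" for \<epsilon>
  define M where "M \<epsilon> w = H \<epsilon> + w \<cdot>\<^sub>m G \<epsilon>" for \<epsilon> w
  have H: "H \<epsilon> \<in> carrier_mat n n" and G: "G \<epsilon> \<in> carrier_mat n n" for \<epsilon>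
    using D B eB e by (auto simp: H_def G_def)
  then have M: "M \<epsilon> w \<in> carrier_mat n n" for \<epsilon> w by (simp add: M_def)
  have Mvec: "M \<epsilon> w *\<^sub>v u = \<gamma> \<cdot>\<^sub>v u - D *\<^sub>v u - (e *\<^sub>v (B *\<^sub>v u) + \<epsilon> \<cdot>\<^sub>v (B *\<^sub>v u - e *\<^sub>v (B *\<^sub>v u)))
        + w \<cdot>\<^sub>v (e *\<^sub>v u + \<epsilon> \<cdot>\<^sub>v (u - e *\<^sub>v u))"
    if u: "u \<in> carrier_vec n" for \<epsilon> w u
  proof -
    have eBu: "eB *\<^sub>v u = e *\<^sub>v (B *\<^sub>v u)"
      unfolding eB_def by (rule sq_mult_vec[OF e B u])
    have 1: "(1\<^sub>m n - e) *\<^sub>v u = u - e *\<^sub>v u"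
      using minus_mult_distrib_mat_vec[OF one_carrier_mat e u] u by simp
    have 2: "(B - eB) *\<^sub>v u = B *\<^sub>v u - e *\<^sub>v (B *\<^sub>v u)"
      using minus_mult_distrib_mat_vec[OF B eB u] by (simp add: eBu)
    have 3: "(\<gamma> \<cdot>\<^sub>m 1\<^sub>m n - D) *\<^sub>v u = \<gamma> \<cdot>\<^sub>v u - D *\<^sub>v u"
      using minus_mult_distrib_mat_vec[OF _ D u, of "\<gamma> \<cdot>\<^sub>m 1\<^sub>m n"] smult_mat_mult_vec[OF one_carrier_mat u] u by simp
    have c: "1\<^sub>m n - e \<in> carrier_mat n n" "B - eB \<in> carrier_mat n n" "\<gamma> \<cdot>\<^sub>m 1\<^sub>m n - D \<in> carrier_mat n n"
      using e eB D by auto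
    have 4: "G \<epsilon> *\<^sub>v u = e *\<^sub>v u + \<epsilon> \<cdot>\<^sub>v (u - e *\<^sub>v u)"
      unfolding G_def using sq_add_vec[OF e smult_carrier_mat[OF c(1)] u] smult_mat_mult_vec[OF c(1) u]
      by (simp add: 1)
    have 5: "(eB + \<epsilon> \<cdot>\<^sub>m (B - eB)) *\<^sub>v u = e *\<^sub>v (B *\<^sub>v u) + \<epsilon> \<cdot>\<^sub>v (B *\<^sub>v u - e *\<^sub>v (B *\<^sub>v u))"
      using sq_add_vec[OF eB smult_carrier_mat[OF c(2)] u] smult_mat_mult_vec[OF c(2) u] by (simp add: 2 eBu)
    have 6: "H \<epsilon> *\<^sub>v u = \<gamma> \<cdot>\<^sub>v u - D *\<^sub>v u - (e *\<^sub>v (B *\<^sub>v u) + \<epsilon> \<cdot>\<^sub>v (B *\<^sub>v u - e *\<^sub>v (B *\<^sub>v u)))"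
      unfolding H_def using minus_mult_distrib_mat_vec[OF c(3) add_carrier_mat[OF smult_carrier_mat[OF c(2)]] u]
      by (simp only: 3 5)
    show ?thesis
      unfolding M_def using sq_add_vec[OF H smult_carrier_mat[OF G] u] smult_mat_mult_vec[OF G u]
      by (simp only: 4 6)
  qed
  have Mv: "(M \<epsilon> w *\<^sub>v u) $ i = \<gamma> * u $ i - (D *\<^sub>v u) $ i - (e *\<^sub>v (B *\<^sub>v u)) $ i
      - \<epsilon> * ((B *\<^sub>v u) $ i - (e *\<^sub>v (B *\<^sub>v u)) $ i) + w * (e *\<^sub>v u) $ i + w * \<epsilon> * (u $ i - (e *\<^sub>v u) $ i)"
    if u: "u \<in> carrier_vec n" and i: "i < n" for \<epsilon> w u i
    using u i D B e by (simp add: Mvec[OF u] algebra_simps del: index_mult_mat_vec)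
  \<comment> \<open>A kernel vector of the pencil is an eigenvector of the perturbed matrix, and at \<open>\<epsilon> = 0\<close> one of the compression.\<close>
  have kernel: "D *\<^sub>v u + \<epsilon> \<cdot>\<^sub>v (B *\<^sub>v u) = (\<gamma> + \<epsilon> * w) \<cdot>\<^sub>v u \<and> e *\<^sub>v (B *\<^sub>v u) = w \<cdot>\<^sub>v (e *\<^sub>v u)"
    if u: "u \<in> carrier_vec n" and 0: "M \<epsilon> w *\<^sub>v u = 0\<^sub>v n" for \<epsilon> w u
  proof -
    have c: "D *\<^sub>v u \<in> carrier_vec n" "B *\<^sub>v u \<in> carrier_vec n" "e *\<^sub>v u \<in> carrier_vec n"
      "e *\<^sub>v (B *\<^sub>v u) \<in> carrier_vec n" using D B e u by auto
    have ez: "e *\<^sub>v 0\<^sub>v n = 0\<^sub>v n"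
      using e by (intro eq_vecI) auto
    have 1: "e *\<^sub>v (e *\<^sub>v y) = e *\<^sub>v y" if "y \<in> carrier_vec n" for y
      using sq_mult_vec[OF e e that] by (simp add: ee)
    have 2: "e *\<^sub>v (D *\<^sub>v u) = \<gamma> \<cdot>\<^sub>v (e *\<^sub>v u)"
      using sq_mult_vec[OF e D u] e u by (simp add: eD smult_mat_mult_vec[of _ n])
    have "e *\<^sub>v (\<gamma> \<cdot>\<^sub>v u - D *\<^sub>v u - (e *\<^sub>v (B *\<^sub>v u) + \<epsilon> \<cdot>\<^sub>v (B *\<^sub>v u - e *\<^sub>v (B *\<^sub>v u)))
        + w \<cdot>\<^sub>v (e *\<^sub>v u + \<epsilon> \<cdot>\<^sub>v (u - e *\<^sub>v u))) = 0\<^sub>v n"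
      using 0 ez unfolding Mvec[OF u] by simp
    moreover have "e *\<^sub>v (\<gamma> \<cdot>\<^sub>v u - D *\<^sub>v u - (e *\<^sub>v (B *\<^sub>v u) + \<epsilon> \<cdot>\<^sub>v (B *\<^sub>v u - e *\<^sub>v (B *\<^sub>v u)))
        + w \<cdot>\<^sub>v (e *\<^sub>v u + \<epsilon> \<cdot>\<^sub>v (u - e *\<^sub>v u))) =
        \<gamma> \<cdot>\<^sub>v (e *\<^sub>v u) - \<gamma> \<cdot>\<^sub>v (e *\<^sub>v u) - (e *\<^sub>v (B *\<^sub>v u) + \<epsilon> \<cdot>\<^sub>v (e *\<^sub>v (B *\<^sub>v u) - e *\<^sub>v (B *\<^sub>v u)))
        + w \<cdot>\<^sub>v (e *\<^sub>v u + \<epsilon> \<cdot>\<^sub>v (e *\<^sub>v u - e *\<^sub>v u))"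
      using e u c 1 2
      by (simp add: mult_add_distrib_mat_vec[of _ n n] mult_minus_distrib_mat_vec[of _ n n] mult_mat_vec[of _ n n])
    ultimately have z: "\<gamma> \<cdot>\<^sub>v (e *\<^sub>v u) - \<gamma> \<cdot>\<^sub>v (e *\<^sub>v u) - (e *\<^sub>v (B *\<^sub>v u) + \<epsilon> \<cdot>\<^sub>v (e *\<^sub>v (B *\<^sub>v u) - e *\<^sub>v (B *\<^sub>v u)))
        + w \<cdot>\<^sub>v (e *\<^sub>v u + \<epsilon> \<cdot>\<^sub>v (e *\<^sub>v u - e *\<^sub>v u)) = 0\<^sub>v n" by simp
    have y: "(e *\<^sub>v (B *\<^sub>v u)) $ i = w * (e *\<^sub>v u) $ i" if i: "i < n" for i
      using arg_cong[OF z, of "\<lambda>t. t $ i"] i u c by (simp del: index_mult_mat_vec)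
    have "(D *\<^sub>v u) $ i + \<epsilon> * (B *\<^sub>v u) $ i = (\<gamma> + \<epsilon> * w) * u $ i" if i: "i < n" for i
      using Mv[OF u i, of \<epsilon> w] i by (simp add: 0 y algebra_simps del: index_mult_mat_vec)
    then have "D *\<^sub>v u + \<epsilon> \<cdot>\<^sub>v (B *\<^sub>v u) = (\<gamma> + \<epsilon> * w) \<cdot>\<^sub>v u"
      using u D B e by (intro eq_vecI) (auto simp del: index_mult_mat_vec)
    moreover have "e *\<^sub>v (B *\<^sub>v u) = w \<cdot>\<^sub>v (e *\<^sub>v u)"
      using y u D B e by (intro eq_vecI) (auto simp del: index_mult_mat_vec)
    ultimately show ?thesis by blast
  qed
  have "\<forall>\<epsilon>. \<exists>p. degree p \<le> n \<and> (\<forall>w. poly p w = det (M \<epsilon> w))"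
    unfolding M_def using det_pencil[OF H G] by metis
  then obtain p where p: "\<And>\<epsilon>. degree (p \<epsilon>) \<le> n" "\<And>\<epsilon> w. poly (p \<epsilon>) w = det (M \<epsilon> w)"
    by metis
  have "((\<lambda>\<epsilon>. poly (p \<epsilon>) w) \<longlongrightarrow> poly (p 0) w) (at 0)" for w
  proof -
    define H' where "H' = \<gamma> \<cdot>\<^sub>m 1\<^sub>m n - D - eB + w \<cdot>\<^sub>m e"
    define G' where "G' = w \<cdot>\<^sub>m (1\<^sub>m n - e) - (B - eB)"
    have c: "H' \<in> carrier_mat n n" "G' \<in> carrier_mat n n"
      using D B eB e by (auto simp: H'_def G'_def)
    have "M \<epsilon> w = H' + \<epsilon> \<cdot>\<^sub>m G'" for \<epsilon>
      using D B eB e by (intro eq_matI) (auto simp: M_def H_def G_def H'_def G'_def algebra_simps)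
    moreover obtain q where "\<And>\<epsilon>. poly q \<epsilon> = det (H' + \<epsilon> \<cdot>\<^sub>m G')"
      using det_pencil[OF c] by metis
    ultimately have "(\<lambda>\<epsilon>. poly (p \<epsilon>) w) = poly q"
      by (simp add: p(2) fun_eq_iff)
    then show ?thesis
      using poly_isCont[of 0 q] by (simp add: isCont_def fun_eq_iff)
  qed
  moreover have "poly (p 0) b = 0"
  proof -
    have "e *\<^sub>v v = v" by (rule eig[OF v(1,3)])
    then have "M 0 b *\<^sub>v v = 0\<^sub>v n"
      using M[of 0 b] v by (intro eq_vecI) (auto simp: Mv[OF v(1)] simp del: index_mult_mat_vec)
    then show ?thesis
      unfolding p(2) using det_0_iff_vec_prod_zero[OF M] v by blast
  qed
  moreover obtain w where "poly (p 0) w \<noteq> 0"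
  proof -
    have "finite (spectrum eB)" by (rule card_finite_spectrum(1)[OF eB])
    then obtain w where w: "w \<notin> spectrum eB"
      using ex_new_if_finite[OF infinite_UNIV_char_0] by blast
    have "det (M 0 w) \<noteq> 0"
    proof
      assume "det (M 0 w) = 0"
      then obtain u where u: "u \<in> carrier_vec n" "u \<noteq> 0\<^sub>v n" "M 0 w *\<^sub>v u = 0\<^sub>v n"
        using det_0_iff_vec_prod_zero[OF M] by blast
      have "D *\<^sub>v u + 0 \<cdot>\<^sub>v (B *\<^sub>v u) = D *\<^sub>v u"
        using D B by (intro eq_vecI) auto
      then have "D *\<^sub>v u = \<gamma> \<cdot>\<^sub>v u"
        using kernel[OF u(1,3)] by simp
      then have "eB *\<^sub>v u = w \<cdot>\<^sub>v u"
        using kernel[OF u(1,3)] eig[OF u(1)] e B u(1) by (simp add: eB_def sq_mult_vec[where n = n])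
      then show False using w spectrumI[OF eB u(1,2)] by blast
    qed
    then show ?thesis using that p(2) by metis
  qed
  ultimately have "\<forall>\<^sub>F \<epsilon> in at 0. \<exists>r. norm (r - b) < \<delta> \<and> poly (p \<epsilon>) r = 0"
    by (rule root_persistence[where p = p, OF p(1) _ _ _ \<delta>])
  then show ?thesis
  proof eventually_elim
    case (elim \<epsilon>)
    then obtain w where w: "norm (w - b) < \<delta>" "det (M \<epsilon> w) = 0" by (auto simp: p(2))
    then obtain u where u: "u \<in> carrier_vec n" "u \<noteq> 0\<^sub>v n" "M \<epsilon> w *\<^sub>v u = 0\<^sub>v n"
      using det_0_iff_vec_prod_zero[OF M] by blast
    have "(D + \<epsilon> \<cdot>\<^sub>m B) *\<^sub>v u = (\<gamma> + \<epsilon> * w) \<cdot>\<^sub>v u"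
      using kernel[OF u(1,3)] D B u(1) by (simp add: sq_add_vec[where n = n] smult_mat_mult_vec[of _ n])
    then have "\<gamma> + \<epsilon> * w \<in> spectrum (D + \<epsilon> \<cdot>\<^sub>m B)"
      using D B by (intro spectrumI[OF _ u(1,2)]) auto
    then show ?case using w(1) by blast
  qed
qed

lemma finite_separation:
  fixes A :: "complex set"
  assumes "finite A"
  obtains d where "d > 0" "\<And>a b. a \<in> A \<Longrightarrow> b \<in> A \<Longrightarrow> a \<noteq> b \<Longrightarrow> 2 * d \<le> norm (a - b)"
proof -
  define S where "S = insert 1 ((\<lambda>(a, b). norm (a - b)) ` {(a, b) \<in> A \<times> A. a \<noteq> b})"
  have "finite {(a, b) \<in> A \<times> A. a \<noteq> b}"
    using assms by (auto intro: finite_subset[of _ "A \<times> A"])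
  then have S: "finite S" "S \<noteq> {}" by (auto simp: S_def)
  have "Min S > 0"
    using S by (auto simp: S_def)
  moreover have "Min S \<le> norm (a - b)" if "a \<in> A" "b \<in> A" "a \<noteq> b" for a b
    using that by (intro Min_le[OF S(1)]) (auto simp: S_def)
  ultimately show ?thesis using that[of "Min S / 2"] by auto
qed

text \<open>Counting the perturbed eigenvalues: those from different eigenvalues of the unperturbed matrices stay
  apart, and those from one eigenvalue separate to first order.\<close>

lemma count_perturbed_eigenvalues:
  fixes I :: "nat set" and n :: "nat \<Rightarrow> nat" and D B :: "nat \<Rightarrow> complex mat" and E :: "complex \<Rightarrow> nat \<Rightarrow> complex mat"
  assumes I: "finite I" and \<Gamma>: "finite \<Gamma>" and S: "\<And>\<gamma>. \<gamma> \<in> \<Gamma> \<Longrightarrow> finite (S \<gamma>)"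
    and D: "\<And>i. i \<in> I \<Longrightarrow> D i \<in> carrier_mat (n i) (n i)" and B: "\<And>i. i \<in> I \<Longrightarrow> B i \<in> carrier_mat (n i) (n i)"
    and E: "\<And>\<gamma> i. i \<in> I \<Longrightarrow> E \<gamma> i \<in> carrier_mat (n i) (n i)"
    and EE: "\<And>\<gamma> i. \<gamma> \<in> \<Gamma> \<Longrightarrow> i \<in> I \<Longrightarrow> E \<gamma> i * E \<gamma> i = E \<gamma> i"
    and ED: "\<And>\<gamma> i. \<gamma> \<in> \<Gamma> \<Longrightarrow> i \<in> I \<Longrightarrow> E \<gamma> i * D i = \<gamma> \<cdot>\<^sub>m E \<gamma> i"
    and eig: "\<And>\<gamma> i v. \<gamma> \<in> \<Gamma> \<Longrightarrow> i \<in> I \<Longrightarrow> v \<in> carrier_vec (n i) \<Longrightarrow> D i *\<^sub>v v = \<gamma> \<cdot>\<^sub>v v \<Longrightarrow> E \<gamma> i *\<^sub>v v = v"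
    and ex: "\<And>\<gamma> b. \<gamma> \<in> \<Gamma> \<Longrightarrow> b \<in> S \<gamma> \<Longrightarrow> \<exists>i\<in>I. \<exists>v\<in>carrier_vec (n i). v \<noteq> 0\<^sub>v (n i) \<and>
      D i *\<^sub>v v = \<gamma> \<cdot>\<^sub>v v \<and> E \<gamma> i *\<^sub>v (B i *\<^sub>v v) = b \<cdot>\<^sub>v v"
  obtains \<epsilon> where "\<epsilon> \<noteq> 0" "(\<Sum>\<gamma>\<in>\<Gamma>. card (S \<gamma>)) \<le> card (\<Union>i\<in>I. spectrum (D i + \<epsilon> \<cdot>\<^sub>m B i))"
proof -
  obtain d where d: "d > 0" "\<And>a b. a \<in> \<Gamma> \<Longrightarrow> b \<in> \<Gamma> \<Longrightarrow> a \<noteq> b \<Longrightarrow> 2 * d \<le> norm (a - b)"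
    using finite_separation[OF \<Gamma>] by metis
  have "finite (\<Union>\<gamma>\<in>\<Gamma>. S \<gamma>)" using \<Gamma> S by blast
  then obtain \<delta> where \<delta>: "\<delta> > 0"
    "\<And>a b. a \<in> (\<Union>\<gamma>\<in>\<Gamma>. S \<gamma>) \<Longrightarrow> b \<in> (\<Union>\<gamma>\<in>\<Gamma>. S \<gamma>) \<Longrightarrow> a \<noteq> b \<Longrightarrow> 2 * \<delta> \<le> norm (a - b)"
    using finite_separation by metis
  let ?P = "Sigma \<Gamma> S" and ?U = "\<lambda>\<epsilon>. \<Union>i\<in>I. spectrum (D i + \<epsilon> \<cdot>\<^sub>m B i)"
  have P: "finite ?P" using \<Gamma> S by blast
  have near: "\<forall>\<^sub>F \<epsilon> in at 0. \<exists>w. norm (w - snd x) < \<delta> \<and> fst x + \<epsilon> * w \<in> ?U \<epsilon>"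
    if xP: "x \<in> ?P" for x
  proof -
    obtain \<gamma> b where x: "x = (\<gamma>, b)" and \<gamma>: "\<gamma> \<in> \<Gamma>" "b \<in> S \<gamma>"
      using xP by blast
    then obtain i v where i: "i \<in> I" and v: "v \<in> carrier_vec (n i)" "v \<noteq> 0\<^sub>v (n i)"
      "D i *\<^sub>v v = \<gamma> \<cdot>\<^sub>v v" "E \<gamma> i *\<^sub>v (B i *\<^sub>v v) = b \<cdot>\<^sub>v v"
      using ex[OF \<gamma>] by blast
    have "\<forall>\<^sub>F \<epsilon> in at 0. \<exists>w. norm (w - b) < \<delta> \<and> \<gamma> + \<epsilon> * w \<in> spectrum (D i + \<epsilon> \<cdot>\<^sub>m B i)"
      using eigenvalue_cluster[OF D[OF i] B[OF i] E[OF i] EE[OF \<gamma>(1) i] ED[OF \<gamma>(1) i] eig[OF \<gamma>(1) i] v \<delta>(1)] .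
    then show ?thesis
      by eventually_elim (use i in \<open>auto simp: x\<close>)
  qed
  have small: "\<forall>\<^sub>F \<epsilon> in at (0::complex). norm \<epsilon> * (norm (snd x) + \<delta>) < d" for x :: "complex \<times> complex"
  proof -
    have "((\<lambda>\<epsilon>::complex. norm \<epsilon> * (norm (snd x) + \<delta>)) \<longlongrightarrow> norm (0::complex) * (norm (snd x) + \<delta>)) (at 0)"
      by (rule tendsto_mult[OF tendsto_norm[OF tendsto_ident_at] tendsto_const])
    then show ?thesis using d(1) by (intro order_tendstoD(2)) auto
  qed
  have "\<forall>\<^sub>F \<epsilon> in at (0::complex). \<epsilon> \<noteq> 0"
    by (simp add: eventually_at_filter)
  moreover have "\<forall>\<^sub>F \<epsilon> in at 0. \<forall>x\<in>?P. (\<exists>w. norm (w - snd x) < \<delta> \<and> fst x + \<epsilon> * w \<in> ?U \<epsilon>) \<and>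
      norm \<epsilon> * (norm (snd x) + \<delta>) < d"
    using near small by (intro eventually_ball_finite[OF P] ballI eventually_conj)
  ultimately have "\<forall>\<^sub>F \<epsilon> in at 0. \<epsilon> \<noteq> 0 \<and> (\<forall>x\<in>?P. (\<exists>w. norm (w - snd x) < \<delta> \<and> fst x + \<epsilon> * w \<in> ?U \<epsilon>) \<and>
      norm \<epsilon> * (norm (snd x) + \<delta>) < d)"
    by (rule eventually_conj)
  from eventually_happens'[OF at_neq_bot this] obtain \<epsilon> where \<epsilon>: "\<epsilon> \<noteq> 0" and
    *: "\<forall>x\<in>?P. (\<exists>w. norm (w - snd x) < \<delta> \<and> fst x + \<epsilon> * w \<in> ?U \<epsilon>) \<and> norm \<epsilon> * (norm (snd x) + \<delta>) < d"
    by (elim exE conjE)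
  then have "\<forall>x\<in>?P. \<exists>w. norm (w - snd x) < \<delta> \<and> fst x + \<epsilon> * w \<in> ?U \<epsilon>"
    by (intro ballI) (drule (1) bspec, elim conjE, assumption)
  from bchoice[OF this] obtain w where
    **: "\<forall>x\<in>?P. norm (w x - snd x) < \<delta> \<and> fst x + \<epsilon> * w x \<in> ?U \<epsilon>" ..
  have w: "norm (w x - snd x) < \<delta>" "fst x + \<epsilon> * w x \<in> ?U \<epsilon>" if "x \<in> ?P" for x
    by (rule bspec[OF ** that, THEN conjunct1], rule bspec[OF ** that, THEN conjunct2])
  have sm: "norm \<epsilon> * (norm (snd x) + \<delta>) < d" if "x \<in> ?P" for x
    by (rule bspec[OF * that, THEN conjunct2])
  have wd: "norm (\<epsilon> * w x) < d" if "x \<in> ?P" for x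
  proof -
    have "norm (w x) \<le> norm (snd x) + norm (w x - snd x)"
      by (metis add.commute diff_add_cancel norm_triangle_ineq)
    also have "\<dots> \<le> norm (snd x) + \<delta>" using w(1)[OF that] by simp
    finally have "norm (\<epsilon> * w x) \<le> norm \<epsilon> * (norm (snd x) + \<delta>)"
      by (simp add: norm_mult mult_left_mono)
    then show ?thesis using sm[OF that] by simp
  qed
  have inj: "inj_on (\<lambda>x. fst x + \<epsilon> * w x) ?P"
  proof (rule inj_onI)
    fix x y assume x: "x \<in> ?P" and y: "y \<in> ?P" and eq: "fst x + \<epsilon> * w x = fst y + \<epsilon> * w y"
    have "fst x - fst y = \<epsilon> * w y - \<epsilon> * w x" using eq by (simp add: algebra_simps)
    then have "norm (fst x - fst y) < 2 * d"
      using wd[OF x] wd[OF y] norm_triangle_ineq4[of "\<epsilon> * w y" "\<epsilon> * w x"] by simp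
    then have f: "fst x = fst y" using d(2)[of "fst x" "fst y"] x y by force
    then have "w x = w y" using eq \<epsilon> by simp
    then have "norm (snd x - snd y) < 2 * \<delta>"
      using w(1)[OF x] w(1)[OF y] norm_triangle_ineq4[of "w x - snd y" "w x - snd x"] by simp
    then have "snd x = snd y" using \<delta>(2)[of "snd x" "snd y"] x y by force
    then show "x = y" using f by (simp add: prod_eq_iff)
  qed
  have "finite (?U \<epsilon>)"
    using I D B card_finite_spectrum(1)[of "D i + \<epsilon> \<cdot>\<^sub>m B i" for i] by (intro finite_UN_I) (metis add_carrier_mat smult_carrier_mat)+
  then have "card ?P \<le> card (?U \<epsilon>)"
    using w(2) by (intro card_inj_on_le[OF inj]) auto
  then show ?thesis
    using that[OF \<epsilon>] \<Gamma> S by (simp add: card_SigmaI)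
qed

section \<open>A trace identity and the rank one condition\<close>

text \<open>If \<open>b\<close> and its sums with multiples of \<open>n\<close> and of \<open>s = n\<^sup>2\<close> behave like nilpotent elements for a tracial functional,
  then expanding the powers leaves no room for the square of the commutator of \<open>n\<close> and \<open>b\<close>.\<close>

lemma tracial_commutator_square:
  fixes t :: "'a::ring_1 \<Rightarrow> complex"
  assumes add: "\<And>x y. t (x + y) = t x + t y" and minus: "\<And>x. t (- x) = - t x" and comm: "\<And>x y. t (x * y) = t (y * x)"
    and n4: "t ((b + n) ^ 4) = 0" "t ((b - n) ^ 4) = 0" "t (b ^ 4) = 0" "t (n ^ 4) = 0"
    and s3: "t ((b + s) ^ 3) = 0" "t ((b - s) ^ 3) = 0" "t (s ^ 3) = 0"
    and s: "t (s * b * b) = t (n * n * b * b)"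
  shows "t ((n * b - b * n) * (n * b - b * n)) = 0"
proof -
  have diff: "t (x - y) = t x - t y" for x y
    using add[of x "- y"] minus[of y] by simp
  have p4: "x ^ 4 = x * x * x * x" and p3: "x ^ 3 = x * x * x" for x :: 'a
    by (simp_all add: power4_eq_xxxx power3_eq_cube)
  have c: "t (b * n * n * b) = t (n * n * b * b)" "t (b * b * n * n) = t (n * n * b * b)"
    "t (n * b * b * n) = t (n * n * b * b)" "t (b * n * b * n) = t (n * b * n * b)"
    using comm[of b "n * n * b"] comm[of "b * b" "n * n"] comm[of "n * b * b" n] comm[of b "n * b * n"]
    by (simp_all add: mult.assoc)
  have cs: "t (b * s * b) = t (s * b * b)" "t (b * b * s) = t (s * b * b)"
    using comm[of b "s * b"] comm[of "b * b" s] by (simp_all add: mult.assoc)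
  have "(b + s) ^ 3 - (b - s) ^ 3 =
      (s * b * b + b * s * b + b * b * s + s ^ 3) + (s * b * b + b * s * b + b * b * s + s ^ 3)"
    by (simp add: p3 algebra_simps)
  then have "t ((b + s) ^ 3) - t ((b - s) ^ 3) = t ((s * b * b + b * s * b + b * b * s + s ^ 3) + (s * b * b + b * s * b + b * b * s + s ^ 3))"
    by (simp only: diff[symmetric])
  then have "6 * t (s * b * b) = 0"
    by (simp add: add cs s3)
  then have nnbb: "t (n * n * b * b) = 0" using s by simp
  have "(b + n) ^ 4 + (b - n) ^ 4 = (b ^ 4 + n ^ 4 + (n * n * b * b + n * b * n * b + n * b * b * n + b * n * n * b + b * n * b * n + b * b * n * n))
     + (b ^ 4 + n ^ 4 + (n * n * b * b + n * b * n * b + n * b * b * n + b * n * n * b + b * n * b * n + b * b * n * n))"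
    by (simp add: p4 algebra_simps)
  then have "t ((b + n) ^ 4) + t ((b - n) ^ 4) = t ((b ^ 4 + n ^ 4 + (n * n * b * b + n * b * n * b + n * b * b * n + b * n * n * b + b * n * b * n + b * b * n * n))
     + (b ^ 4 + n ^ 4 + (n * n * b * b + n * b * n * b + n * b * b * n + b * n * n * b + b * n * b * n + b * b * n * n)))"
    by (simp only: add[symmetric])
  then have nbnb: "t (n * b * n * b) = 0"
    by (simp add: add c n4 nnbb)
  have "(n * b - b * n) * (n * b - b * n) = n * b * n * b - n * b * b * n - b * n * n * b + b * n * b * n"
    by (simp add: algebra_simps)
  then show ?thesis
    by (simp add: add diff c nbnb nnbb)
qed

text \<open>For \<open>M = u v\<^sup>T\<close> both traces are powers of the number \<open>v\<^sup>T A u\<close>.\<close>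

lemma trace_outer_square:
  assumes A: "A \<in> carrier_mat n n" and M: "M \<in> carrier_mat n n" and outer: "outer_product n M"
  shows "trace n (A * (M * (A * M))) = (trace n (A * M))\<^sup>2"
proof -
  obtain u v where uv: "\<And>a b. a < n \<Longrightarrow> b < n \<Longrightarrow> M $$ (a, b) = u a * v b"
    using outer unfolding outer_product_def by blast
  define a where "a i = (\<Sum>j<n. A $$ (i, j) * u j)" for i
  have AM: "(A * M) $$ (i, k) = a i * v k" if "i < n" "k < n" for i k
    unfolding mult_entry[OF A M that] a_def sum_distrib_right
    using that by (intro sum.cong refl) (simp add: uv)
  have "A * (M * (A * M)) = (A * M) * (A * M)"
    using A M by (simp add: sq_mat[where n = n])
  moreover have "trace n ((A * M) * (A * M)) = (\<Sum>i<n. \<Sum>k<n. (A * M) $$ (i, k) * (A * M) $$ (k, i))"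
    using A M by (intro trace_mult_entries) auto
  moreover have "\<dots> = (\<Sum>i<n. \<Sum>k<n. (a i * v i) * (a k * v k))"
    by (intro sum.cong refl) (simp add: AM)
  moreover have "\<dots> = (trace n (A * M))\<^sup>2"
    by (simp add: trace_def AM sum_product power2_eq_square)
  ultimately show ?thesis by simp
qed

text \<open>Here \<open>e = f(X)\<close> is the projection onto the generalised eigenspace of \<open>X\<close> for \<open>\<mu>\<close>, so its trace is the multiplicity
  \<open>d\<close> of \<open>\<mu>\<close>. If the compression of \<open>Y + h(X)\<close> to that space has a single eigenvalue for each \<open>h\<close>, then
  with \<open>N = (X - \<mu>) e\<close> and \<open>b = e (Y - \<alpha>) e\<close>, where \<open>\<alpha>\<close> is the mean of the eigenvalues, all of \<open>b \<plusminus> N\<close> and \<open>b \<plusminus> N\<^sup>2\<close> are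
  nilpotent, and the trace of \<open>[N, b]\<^sup>2\<close> vanishes. But \<open>[N, b]\<close> is a matrix of rank one minus \<open>e\<close>, and this
  trace is \<open>d\<^sup>2 - d\<close>.\<close>

lemma multiplicity_le_one:
  fixes X Y :: "complex mat" and f :: "complex poly"
  assumes X: "X \<in> carrier_mat n n" and Y: "Y \<in> carrier_mat n n" and CM: "CM_relation n X Y"
    and ee: "mat_poly n f X * mat_poly n f X = mat_poly n f X"
    and K: "0 < K" and vanish: "mat_poly n ([:- \<mu>, 1:] ^ K * f) X = 0\<^sub>m n n"
    and single: "\<And>h. \<exists>k. \<forall>v b. v \<in> carrier_vec n \<longrightarrow> v \<noteq> 0\<^sub>v n \<longrightarrow> mat_poly n f X *\<^sub>v v = v \<longrightarrow>
      mat_poly n f X *\<^sub>v ((Y + mat_poly n h X) *\<^sub>v v) = b \<cdot>\<^sub>v v \<longrightarrow> b = k"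
  shows "trace n (mat_poly n f X) = 0 \<or> trace n (mat_poly n f X) = 1"
proof (rule ccontr)
  assume contr: "\<not> ?thesis"
  \<comment> \<open>The matrices in question are values of elements of the free algebra. Computing there, in a ring, leaves only
    the relations that need the matrices to be checked on values.\<close>
  define ev where "ev p = eval_poly n X Y p" for p
  define t where "t p = trace n (ev p)" for p
  define e where "e = mat_poly n f X"
  define d where "d = trace n e"
  define pe where "pe = pfree f var_x"
  have d0: "d \<noteq> 0" and d1: "d \<noteq> 1" using contr by (auto simp: d_def e_def)
  have evc [simp]: "ev p \<in> carrier_mat n n" for p by (simp add: ev_def)
  have e: "e \<in> carrier_mat n n" by (simp add: e_def)
  have ev_mult: "ev (p * q) = ev p * ev q" and ev_add: "ev (p + q) = ev p + ev q"
    and ev_uminus: "ev (- p) = - ev p" and ev_diff: "ev (p - q) = ev p - ev q" for p q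
    using X Y by (simp_all add: ev_def eval_poly_mult eval_poly_add eval_poly_uminus eval_poly_diff)
  have ev_pfree: "ev (pfree g var_x) = mat_poly n g X" for g
    using X Y by (simp add: ev_def eval_poly_pfree)
  have ev_pe: "ev pe = e" by (simp add: pe_def ev_pfree e_def)
  have ee': "e * e = e" using ee by (simp add: e_def)
  have pepe: "ev (pe * pe) = ev pe" by (simp add: ev_mult ev_pe ee')
  have t_add: "t (p + q) = t p + t q" for p q
    by (simp add: t_def ev_add trace_add)
  have t_uminus: "t (- p) = - t p" for p
    by (simp add: t_def ev_uminus trace_def sum_negf carrier_matD[OF evc])
  have t_diff: "t (p - q) = t p - t q" for p q
    using t_add[of p "- q"] t_uminus[of q] by simp
  have t_comm: "t (p * q) = t (q * p)" for p q
    by (simp add: t_def ev_mult trace_comm[of _ n])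
  have t_const: "t (const c * p) = c * t p" for c p
  proof -
    have "ev (const c * p) = c \<cdot>\<^sub>m ev p"
      using X Y by (simp add: ev_def eval_poly_mult eval_poly_const sq_smult_left[where n = n])
    then show ?thesis by (simp add: t_def trace_smult)
  qed
  have t_cong: "t (p * r) = t (q * r)" if "ev p = ev q" for p q r
    using that by (simp add: t_def ev_mult)
  have t_pe: "t pe = d" by (simp add: t_def ev_pe d_def)
  have poly_nil: "spectrum (mat_poly n ([:- \<mu>, 1:] * g * f) X) \<subseteq> {0}" for g
  proof -
    have "([:- \<mu>, 1:] * g * f) ^ K = ([:- \<mu>, 1:] ^ K * f) * (g ^ K * f ^ (K - 1))"
    proof -
      have "(l * g * f) ^ Suc m = (l ^ Suc m * f) * (g ^ Suc m * f ^ m)" for l :: "complex poly" and m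
        by (simp add: power_mult_distrib mult_ac)
      from this[of "[:- \<mu>, 1:]" "K - 1"] show ?thesis using K by simp
    qed
    then have "mat_poly n (([:- \<mu>, 1:] * g * f) ^ K) X = 0\<^sub>m n n"
      using X vanish by (simp only: mat_poly_mult) (simp add: left_mult_zero_mat[of _ n n])
    moreover have "pcompose ([:0, 1:] ^ m) g = g ^ m" for m and g :: "complex poly"
      by (induction m) (simp_all add: pcompose_mult pcompose_pCons)
    ultimately have "mat_poly n ([:0, 1:] ^ K) (mat_poly n ([:- \<mu>, 1:] * g * f) X) = 0\<^sub>m n n"
      using mat_poly_pcompose[OF X, of "[:0, 1:] ^ K" "[:- \<mu>, 1:] * g * f"] by metis
    from spectrum_annihilated[OF mat_poly_carrier this] show ?thesis by auto
  qed
  have nil_power: "t (p ^ k) = 0" if "spectrum (ev p) \<subseteq> {0}" "0 < k" for p k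
  proof -
    have "pfree ([:0, 1:] ^ m) p = p ^ m" for m
      by (induction m) (simp_all add: pfree_mult one_pCons)
    then have "ev (p ^ k) = mat_poly n ([:0, 1:] ^ k) (ev p)"
      unfolding ev_def using eval_poly_pfree[OF X Y, of "[:0, 1:] ^ k" p] by simp
    then show ?thesis
      using trace_nilpotent_power[OF evc that] by (simp add: t_def)
  qed
  \<comment> \<open>For \<open>h\<close> vanishing at \<open>\<mu>\<close>, the matrix \<open>h(X) e\<close> has trace zero; so the single eigenvalue of the compression is
    the same for all these \<open>h\<close>.\<close>
  define \<alpha> where "\<alpha> = t (pe * var_y) / d"
  define bb where "bb = pe * (var_y - const \<alpha>) * pe"
  have nil: "spectrum (ev (bb + pfree (h * f) var_x)) \<subseteq> {0}" if h: "h = [:- \<mu>, 1:] * g" for h g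
  proof -
    obtain k where k: "\<And>v b. v \<in> carrier_vec n \<Longrightarrow> v \<noteq> 0\<^sub>v n \<Longrightarrow> e *\<^sub>v v = v \<Longrightarrow>
      e *\<^sub>v ((Y + mat_poly n h X) *\<^sub>v v) = b \<cdot>\<^sub>v v \<Longrightarrow> b = k"
      using single[of h] unfolding e_def by blast
    define W where "W = Y + mat_poly n h X"
    have W: "W \<in> carrier_mat n n" using Y by (simp add: W_def)
    define z where "z = pe * (var_y + pfree h var_x - const k) * pe"
    have evy: "ev (var_y + pfree h var_x - const k) = W - k \<cdot>\<^sub>m 1\<^sub>m n"
      using X Y by (simp add: ev_def W_def eval_poly_add eval_poly_diff eval_poly_pfree eval_poly_const)
    have evz: "ev z = e * ((W - k \<cdot>\<^sub>m 1\<^sub>m n) * e)"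
      unfolding z_def ev_mult evy ev_pe
      by (rule sq_assoc[OF e minus_carrier_mat[OF smult_carrier_mat[OF one_carrier_mat]] e])
    have Wk: "W - k \<cdot>\<^sub>m 1\<^sub>m n \<in> carrier_mat n n"
      by (rule minus_carrier_mat[OF smult_carrier_mat[OF one_carrier_mat]])
    have "l = 0" if l: "l \<in> spectrum (ev z)" for l
    proof (rule ccontr)
      assume "l \<noteq> 0"
      obtain v where v: "v \<in> carrier_vec n" "v \<noteq> 0\<^sub>v n" "ev z *\<^sub>v v = l \<cdot>\<^sub>v v"
        by (rule spectrumE[OF l evc])
      have c: "(W - k \<cdot>\<^sub>m 1\<^sub>m n) * e \<in> carrier_mat n n" "e *\<^sub>v v \<in> carrier_vec n" using sq_mult[OF Wk e] e v(1) by auto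
      have "e * ev z = ev z"
        unfolding evz using sq_assoc[OF e e c(1)] by (simp add: ee')
      then have "e *\<^sub>v (ev z *\<^sub>v v) = ev z *\<^sub>v v"
        using sq_mult_vec[OF e evc v(1), of z] by simp
      then have "l \<cdot>\<^sub>v (e *\<^sub>v v) = l \<cdot>\<^sub>v v"
        using v e by (simp add: mult_mat_vec[of _ n n])
      then have "(1 / l) \<cdot>\<^sub>v (l \<cdot>\<^sub>v (e *\<^sub>v v)) = (1 / l) \<cdot>\<^sub>v (l \<cdot>\<^sub>v v)" by simp
      then have ev_v: "e *\<^sub>v v = v"
        using \<open>l \<noteq> 0\<close> by (simp add: smult_smult_assoc)
      have "ev z *\<^sub>v v = e *\<^sub>v ((W - k \<cdot>\<^sub>m 1\<^sub>m n) *\<^sub>v v)"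
        unfolding evz using sq_mult_vec[OF e c(1) v(1)] sq_mult_vec[OF Wk e v(1)] by (simp add: ev_v)
      also have "(W - k \<cdot>\<^sub>m 1\<^sub>m n) *\<^sub>v v = W *\<^sub>v v - k \<cdot>\<^sub>v v"
        using W v(1) minus_mult_distrib_mat_vec[OF W, of "k \<cdot>\<^sub>m 1\<^sub>m n" v] smult_mat_mult_vec[of "1\<^sub>m n" n v k] by simp
      also have "e *\<^sub>v (W *\<^sub>v v - k \<cdot>\<^sub>v v) = e *\<^sub>v (W *\<^sub>v v) - k \<cdot>\<^sub>v v"
        using e W v(1) by (simp add: mult_minus_distrib_mat_vec[of _ n n] mult_mat_vec[of _ n n] ev_v)
      finally have *: "e *\<^sub>v (W *\<^sub>v v) - k \<cdot>\<^sub>v v = l \<cdot>\<^sub>v v" using v(3) by simp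
      have "e *\<^sub>v (W *\<^sub>v v) = (l + k) \<cdot>\<^sub>v v"
      proof (rule eq_vecI)
        fix i assume "i < dim_vec ((l + k) \<cdot>\<^sub>v v)"
        then have i: "i < n" using v(1) by simp
        have "(e *\<^sub>v (W *\<^sub>v v) - k \<cdot>\<^sub>v v) $ i = l * v $ i" using * i v(1) by simp
        then show "(e *\<^sub>v (W *\<^sub>v v)) $ i = ((l + k) \<cdot>\<^sub>v v) $ i"
          using i v(1) e W by (simp add: algebra_simps del: index_mult_mat_vec)
      qed (use e v(1) in auto)
      then have "l + k = k"
        by (intro k[OF v(1,2) ev_v]) (simp add: W_def)
      then show False using \<open>l \<noteq> 0\<close> by simp
    qed
    then have nz: "spectrum (ev z) \<subseteq> {0}" by blast
    have hf: "ev (pe * pfree h var_x * pe) = ev (pfree (h * f) var_x)"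
    proof -
      have "f * h * f = h * (f * f)" by (simp add: mult_ac)
      then have "pe * pfree h var_x * pe = pfree h var_x * (pe * pe)"
        unfolding pe_def pfree_mult[symmetric] by (simp only:)
      then show ?thesis by (simp add: pfree_mult pe_def[symmetric] ev_mult ev_pe ee')
    qed
    have z: "z = pe * var_y * pe + pe * pfree h var_x * pe - const k * (pe * pe)"
      using const_commute[of k pe] by (simp add: z_def algebra_simps) (metis mult.assoc)
    have tpep: "t (pe * q * pe) = t (pe * q)" for q
      using t_comm[of "pe * q" pe] t_cong[OF pepe, of q] by (simp add: mult.assoc)
    have "t z = t (pe * var_y) + t (pfree (h * f) var_x) - k * d"
    proof -
      have "t (pe * pfree h var_x * pe) = t (pfree (h * f) var_x)" "t (pe * pe) = d"
        by (simp_all only: t_def hf pepe d_def ev_pe)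
      then show ?thesis
        unfolding z t_add t_diff t_const by (simp only: tpep[of var_y])
    qed
    moreover have "t z = 0"
      using nil_power[OF nz, of 1] by simp
    moreover have "t (pfree (h * f) var_x) = 0"
      using nil_power[of "pfree (h * f) var_x" 1] poly_nil[of g] by (simp add: ev_pfree h)
    ultimately have "k = \<alpha>" using d0 by (simp add: \<alpha>_def)
    have "bb = pe * var_y * pe - const k * (pe * pe)"
      unfolding bb_def \<open>k = \<alpha>\<close>[symmetric] using const_commute[of k pe] by (simp add: algebra_simps) (metis mult.assoc)
    then have "bb + pe * pfree h var_x * pe = z"
      using z by (simp only: add_diff_eq diff_add_eq)
    then have "ev (bb + pfree (h * f) var_x) = ev z"
      by (metis ev_add hf)
    then show ?thesis using nz by simp
  qed
  define l where "l = [:- \<mu>, 1:]"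
  define nn where "nn = pfree (l * f) var_x"
  define ss where "ss = pfree (l * l * f) var_x"
  have sp: "spectrum (ev (bb + nn)) \<subseteq> {0}" "spectrum (ev (bb + ss)) \<subseteq> {0}"
    using nil[of l 1] nil[of "l * l" l] by (simp_all add: nn_def ss_def l_def[symmetric])
  have sm: "spectrum (ev (bb - nn)) \<subseteq> {0}" "spectrum (ev (bb - ss)) \<subseteq> {0}"
    using nil[of "- l" "- 1"] nil[of "- (l * l)" "- l"]
    by (simp_all add: nn_def ss_def pfree_uminus l_def[symmetric])
  have sb: "spectrum (ev bb) \<subseteq> {0}"
    using nil[of 0 0] by simp
  have sn: "spectrum (ev nn) \<subseteq> {0}" "spectrum (ev ss) \<subseteq> {0}"
    using poly_nil[of 1] poly_nil[of l] by (simp_all add: nn_def ss_def ev_pfree l_def[symmetric])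
  have ssbb: "t (ss * bb * bb) = t (nn * nn * bb * bb)"
  proof -
    have "ev ss = ev (nn * nn)"
    proof -
      have "(l * f) * (l * f) = (l * l) * (f * f)" by (simp only: mult_ac)
      then show ?thesis
        using X by (simp only: ss_def nn_def pfree_mult[symmetric] ev_pfree mat_poly_mult ee)
    qed
    from t_cong[OF this, of "bb * bb"] show ?thesis by (simp only: mult.assoc)
  qed
  have "t ((nn * bb - bb * nn) * (nn * bb - bb * nn)) = 0"
    by (rule tracial_commutator_square[where t = t and s = ss, OF t_add t_uminus t_comm nil_power[OF sp(1)]
          nil_power[OF sm(1)] nil_power[OF sb] nil_power[OF sn(1)] nil_power[OF sp(2)] nil_power[OF sm(2)]
          nil_power[OF sn(2)] ssbb]) simp_all
  \<comment> \<open>The other evaluation: the commutator is the compression of a matrix of rank one minus the projection.\<close>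
  moreover have "ev (nn * bb - bb * nn) = ev (pe * (commutator var_x var_y + 1) * pe - pe)"
  proof -
    define x' where "x' = ev (var_x - const \<mu>)"
    define y' where "y' = ev (var_y - const \<alpha>)"
    have c: "x' \<in> carrier_mat n n" "y' \<in> carrier_mat n n" by (simp_all add: x'_def y'_def)
    have nn: "nn = (var_x - const \<mu>) * pe"
      unfolding nn_def pe_def pfree_mult by (simp add: l_def const_uminus)
    have "nn = pe * (var_x - const \<mu>)"
      unfolding nn pe_def by (simp add: left_diff_distrib right_diff_distrib pfree_commute const_commute)
    then have com: "x' * e = e * x'"
      using nn by (metis ev_mult ev_pe x'_def)
    have com': "x' * (e * A) = e * (x' * A)" if "A \<in> carrier_mat n n" for A
      using sq_assoc[OF c(1) e that] sq_assoc[OF e c(1) that] by (simp add: com)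
    have eeA: "e * (e * A) = e * A" if "A \<in> carrier_mat n n" for A
      using sq_assoc[OF e e that] by (simp add: ee')
    have "ev (nn * bb) = ev (pe * ((var_x - const \<mu>) * (var_y - const \<alpha>)) * pe)"
      unfolding nn bb_def ev_mult ev_pe x'_def[symmetric] y'_def[symmetric]
      using c e by (simp add: sq_mat[where n = n] com' eeA)
    moreover have "ev (bb * nn) = ev (pe * ((var_y - const \<alpha>) * (var_x - const \<mu>)) * pe)"
      unfolding nn bb_def ev_mult ev_pe x'_def[symmetric] y'_def[symmetric]
      using c e by (simp add: sq_mat[where n = n] com' com eeA ee')
    ultimately have "ev (nn * bb - bb * nn) =
        ev (pe * ((var_x - const \<mu>) * (var_y - const \<alpha>) - (var_y - const \<alpha>) * (var_x - const \<mu>)) * pe)"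
      by (simp add: ev_diff right_diff_distrib left_diff_distrib)
    also have "(var_x - const \<mu>) * (var_y - const \<alpha>) - (var_y - const \<alpha>) * (var_x - const \<mu>) = commutator var_x var_y"
      using const_commute[of \<mu> var_y] const_commute[of \<alpha> var_x] const_commute[of \<mu> "const \<alpha>"]
      by (simp add: commutator_def algebra_simps)
    also have "ev (pe * commutator var_x var_y * pe) = ev (pe * (commutator var_x var_y + 1) * pe - pe * pe)"
      by (simp add: algebra_simps)
    finally show ?thesis by (simp only: ev_diff pepe)
  qed
  moreover define aa where "aa = commutator var_x var_y + 1"
  ultimately have "t ((pe * aa * pe - pe) * (pe * aa * pe - pe)) = 0" and
    C: "t (nn * bb - bb * nn) = t (pe * aa * pe - pe)"
    by (simp_all add: t_def ev_mult)
  have evaa: "ev aa = X * Y - Y * X + 1\<^sub>m n"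
    using X Y by (simp add: aa_def ev_def commutator_def eval_poly_add eval_poly_diff eval_poly_mult)
  have tpep: "t (pe * q * pe) = t (pe * q)" for q
    using t_comm[of "pe * q" pe] t_cong[OF pepe, of q] by (simp add: mult.assoc)
  have "t (pe * aa) = d"
    using C t_comm[of nn bb] by (simp add: t_diff t_pe tpep)
  have "(pe * aa * pe - pe) * (pe * aa * pe - pe) =
      pe * aa * (pe * pe) * aa * pe - pe * aa * (pe * pe) - (pe * pe) * aa * pe + pe * pe"
    by (simp add: algebra_simps)
  moreover have "t (pe * aa * (pe * pe) * aa * pe) = d\<^sup>2"
  proof -
    have "ev (pe * aa * (pe * pe) * aa) = e * (ev aa * (e * ev aa))"
      using e by (simp add: ev_mult ev_pe ee' sq_mat[where n = n])
    moreover have "t (pe * (aa * (pe * pe) * aa) * pe) = trace n (ev (pe * aa * (pe * pe) * aa))"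
      using tpep[of "aa * (pe * pe) * aa"] by (simp only: t_def mult.assoc)
    ultimately have "t (pe * (aa * (pe * pe) * aa) * pe) = trace n (e * (ev aa * (e * ev aa)))"
      by (simp only:)
    also have "\<dots> = (t (pe * aa))\<^sup>2"
      using trace_outer_square[OF e evc, of aa] CM by (simp add: t_def ev_mult ev_pe evaa CM_relation_def)
    finally show ?thesis by (simp add: \<open>t (pe * aa) = d\<close> mult.assoc)
  qed
  moreover have "t (pe * aa * (pe * pe)) = d" "t ((pe * pe) * aa * pe) = d" "t (pe * pe) = d"
  proof -
    have "t (pe * aa * (pe * pe)) = t (pe * aa * pe)"
      using t_comm[of "pe * aa" "pe * pe"] t_comm[of "pe * aa" pe] t_cong[OF pepe] by simp
    then show "t (pe * aa * (pe * pe)) = d" by (simp add: tpep \<open>t (pe * aa) = d\<close>)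
    have "t ((pe * pe) * aa * pe) = t (pe * aa * pe)"
      using t_cong[OF pepe, of "aa * pe"] by (simp add: mult.assoc)
    then show "t ((pe * pe) * aa * pe) = d" by (simp add: tpep \<open>t (pe * aa) = d\<close>)
    show "t (pe * pe) = d" by (simp add: t_def pepe d_def ev_pe)
  qed
  ultimately have "d\<^sup>2 - d = 0"
    using \<open>t ((pe * aa * pe - pe) * (pe * aa * pe - pe)) = 0\<close> by (simp add: t_add t_diff)
  then show False using d0 d1 by (simp add: power2_eq_square)
qed

section \<open>Diagonal matrices\<close>

definition diag :: "nat \<Rightarrow> (nat \<Rightarrow> complex) \<Rightarrow> complex mat" where
  "diag n x = mat n n (\<lambda>(i, j). if i = j then x i else 0)"

lemma diag_carrier [simp]: "diag n x \<in> carrier_mat n n"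
  by (simp add: diag_def)

lemma diag_dim [simp]: "dim_row (diag n x) = n" "dim_col (diag n x) = n"
  by (simp_all add: diag_def)

lemma diag_entry: "i < n \<Longrightarrow> j < n \<Longrightarrow> diag n x $$ (i, j) = (if i = j then x i else 0)"
  by (simp add: diag_def)

lemma diag_mult_entry:
  assumes "A \<in> carrier_mat n n" "i < n" "j < n"
  shows "(diag n x * A) $$ (i, j) = x i * A $$ (i, j)" "(A * diag n x) $$ (i, j) = A $$ (i, j) * x j"
proof -
  have "(\<Sum>k<n. diag n x $$ (i, k) * A $$ (k, j)) = (\<Sum>k<n. if k = i then x i * A $$ (k, j) else 0)"
    using assms by (intro sum.cong) (auto simp: diag_entry)
  then show "(diag n x * A) $$ (i, j) = x i * A $$ (i, j)"
    unfolding mult_entry[OF diag_carrier assms] using assms(2) by simp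
  have "(\<Sum>k<n. A $$ (i, k) * diag n x $$ (k, j)) = (\<Sum>k<n. if k = j then A $$ (i, k) * x j else 0)"
    using assms by (intro sum.cong) (auto simp: diag_entry)
  then show "(A * diag n x) $$ (i, j) = A $$ (i, j) * x j"
    unfolding mult_entry[OF assms(1) diag_carrier assms(2,3)] using assms(3) by simp
qed

lemma diag_mult_vec:
  assumes "v \<in> carrier_vec n" "i < n"
  shows "(diag n x *\<^sub>v v) $ i = x i * v $ i"
proof -
  have "(diag n x *\<^sub>v v) $ i = (\<Sum>k<n. diag n x $$ (i, k) * v $ k)"
    using assms by (simp add: scalar_prod_def atLeast0LessThan)
  also have "\<dots> = (\<Sum>k<n. if k = i then x i * v $ k else 0)"
    using assms by (intro sum.cong) (auto simp: diag_entry)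
  finally show ?thesis using assms(2) by simp
qed

lemma mat_poly_diag: "mat_poly n f (diag n x) = diag n (\<lambda>i. poly f (x i))"
proof (induction f)
  case 0
  show ?case by (intro eq_matI) (auto simp: diag_entry)
next
  case (pCons c f)
  then show ?case
    by (intro eq_matI) (auto simp: mat_poly_pCons diag_mult_entry[OF diag_carrier] diag_entry simp del: index_mult_mat(1))
qed

lemma spectrum_diag: "spectrum (diag n x) = x ` {..<n}"
proof (intro equalityI subsetI)
  fix k assume "k \<in> spectrum (diag n x)"
  then obtain v where v: "v \<in> carrier_vec n" "v \<noteq> 0\<^sub>v n" "diag n x *\<^sub>v v = k \<cdot>\<^sub>v v"
    by (rule spectrumE[OF _ diag_carrier])
  then obtain i where i: "i < n" "v $ i \<noteq> 0"
    by (metis carrier_vecD eq_vecI index_zero_vec)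
  have "x i * v $ i = k * v $ i"
    using v(1,3) i(1) by (metis carrier_vecD diag_mult_vec index_smult_vec(1))
  then have "x i = k" using i(2) by (metis mult_right_cancel)
  then show "k \<in> x ` {..<n}" using i(1) by blast
next
  fix k assume "k \<in> x ` {..<n}"
  then obtain i where i: "i < n" "k = x i" by auto
  have "diag n x *\<^sub>v unit_vec n i = x i \<cdot>\<^sub>v unit_vec n i"
    using i(1) by (intro eq_vecI) (auto simp: diag_mult_vec simp del: index_mult_mat_vec)
  moreover have "unit_vec n i \<noteq> (0\<^sub>v n :: complex vec)"
    using i(1) by (metis index_unit_vec(1) index_zero_vec(1) zero_neq_one)
  ultimately show "k \<in> spectrum (diag n x)"
    unfolding i(2) by (intro spectrumI[OF diag_carrier]) auto
qed

lemma inverse_if_kernel_trivial: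
  fixes P :: "complex mat"
  assumes P: "P \<in> carrier_mat n n" and "\<And>v. v \<in> carrier_vec n \<Longrightarrow> P *\<^sub>v v = 0\<^sub>v n \<Longrightarrow> v = 0\<^sub>v n"
  obtains Q where "Q \<in> carrier_mat n n" "P * Q = 1\<^sub>m n" "Q * P = 1\<^sub>m n"
proof -
  have d: "det P \<noteq> 0"
    using assms det_0_iff_vec_prod_zero[OF P] by blast
  note adj = adj_mat[OF P]
  have "P * ((1 / det P) \<cdot>\<^sub>m adj_mat P) = 1\<^sub>m n" "(1 / det P) \<cdot>\<^sub>m adj_mat P * P = 1\<^sub>m n"
    using adj P d by (auto simp: sq_smult_left[where n = n] sq_smult_right[where n = n])
  then show ?thesis
    using adj(1) by (intro that[of "(1 / det P) \<cdot>\<^sub>m adj_mat P"]) auto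
qed

text \<open>A matrix with as many eigenvalues as rows is diagonalisable: polynomials in it separate the eigenvectors.\<close>

lemma diagonalisable_if_simple_spectrum:
  fixes A :: "complex mat"
  assumes A: "A \<in> carrier_mat n n" and card: "card (spectrum A) = n"
  obtains x P Q where "inj_on x {..<n}" "similar_mat_wit A (diag n x) P Q"
proof -
  have "finite (spectrum A)" by (rule card_finite_spectrum(1)[OF A])
  then obtain x where x: "bij_betw x {..<n} (spectrum A)"
    using ex_bij_betw_nat_finite[of "spectrum A"] card by (auto simp: atLeast0LessThan)
  then have inj: "inj_on x {..<n}" by (rule bij_betw_imp_inj_on)
  have "\<forall>k\<in>{..<n}. \<exists>v. v \<in> carrier_vec n \<and> v \<noteq> 0\<^sub>v n \<and> A *\<^sub>v v = x k \<cdot>\<^sub>v v"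
  proof
    fix k assume "k \<in> {..<n}"
    then have "x k \<in> spectrum A" using x by (auto simp: bij_betw_def)
    then show "\<exists>v. v \<in> carrier_vec n \<and> v \<noteq> 0\<^sub>v n \<and> A *\<^sub>v v = x k \<cdot>\<^sub>v v"
      by (rule spectrumE[OF _ A]) blast
  qed
  from bchoice[OF this] obtain w where
    w: "\<forall>k\<in>{..<n}. w k \<in> carrier_vec n \<and> w k \<noteq> 0\<^sub>v n \<and> A *\<^sub>v w k = x k \<cdot>\<^sub>v w k" ..
  define P where "P = mat n n (\<lambda>(i, k). w k $ i)"
  have P: "P \<in> carrier_mat n n" by (simp add: P_def)
  have fP: "(mat_poly n f A * P) $$ (i, k) = poly f (x k) * P $$ (i, k)" if "i < n" "k < n" for f i k
  proof -
    have wk: "w k \<in> carrier_vec n" "A *\<^sub>v w k = x k \<cdot>\<^sub>v w k" using w that by auto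
    have "col P k = w k"
      using wk that by (intro eq_vecI) (auto simp: P_def)
    then have "(mat_poly n f A * P) $$ (i, k) = (mat_poly n f A *\<^sub>v w k) $ i"
      using that P by simp
    also have "\<dots> = poly f (x k) * w k $ i"
      using mat_poly_eigenvector[OF A wk] wk that by simp
    finally show ?thesis using that by (simp add: P_def)
  qed
  obtain Q where Q: "Q \<in> carrier_mat n n" "P * Q = 1\<^sub>m n" "Q * P = 1\<^sub>m n"
  proof (rule inverse_if_kernel_trivial[OF P])
    fix c assume c: "c \<in> carrier_vec n" and 0: "P *\<^sub>v c = 0\<^sub>v n"
    have "c $ k = 0" if k: "k < n" for k
    proof -
      obtain f where f: "\<And>y. y \<in> spectrum A \<Longrightarrow> [:- y, 1:] ^ 1 dvd f - (if y = x k then 1 else 0)"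
        using poly_chinese_remainder[OF \<open>finite (spectrum A)\<close>, of 1 "\<lambda>y. if y = x k then 1 else 0"] by metis
      have f: "poly f (x l) = (if l = k then 1 else 0)" if "l < n" for l
      proof -
        have "x l \<in> spectrum A" using x that by (auto simp: bij_betw_def)
        moreover have "x l = x k \<longleftrightarrow> l = k" using inj that k by (auto dest: inj_onD)
        ultimately have "[:- x l, 1:] dvd f - (if l = k then 1 else 0)" using f[of "x l"] by simp
        then show ?thesis by (cases "l = k") (auto simp: poly_eq_0_iff_dvd[symmetric])
      qed
      obtain i where i: "i < n" "w k $ i \<noteq> 0"
        using w k by (metis carrier_vecD eq_vecI index_zero_vec lessThan_iff)
      have "(mat_poly n f A * P *\<^sub>v c) $ i = (\<Sum>l<n. (mat_poly n f A * P) $$ (i, l) * c $ l)"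
        using i c P by (simp add: scalar_prod_def atLeast0LessThan)
      also have "\<dots> = (\<Sum>l<n. if l = k then P $$ (i, l) * c $ l else 0)"
        using i by (intro sum.cong) (auto simp: fP f simp del: index_mult_mat(1))
      also have "\<dots> = w k $ i * c $ k"
        using i k by (simp add: P_def)
      finally have "w k $ i * c $ k = (mat_poly n f A *\<^sub>v (P *\<^sub>v c)) $ i"
        using c P by (simp add: sq_mult_vec[where n = n])
      moreover have "mat_poly n f A *\<^sub>v 0\<^sub>v n = 0\<^sub>v n"
        by (intro eq_vecI) auto
      ultimately show ?thesis using i by (simp add: 0)
    qed
    then show "c = 0\<^sub>v n" using c by (intro eq_vecI) auto
  qed
  have "A * P = P * diag n x"
    using A P fP[of _ _ "[:0, 1:]"]
    by (intro eq_matI) (auto simp: diag_mult_entry[OF P] mult.commute simp del: index_mult_mat(1))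
  then have "P * diag n x * Q = A * (P * Q)"
    using sq_assoc[OF A P Q(1)] by simp
  then have "A = P * diag n x * Q" using A Q by simp
  then have "similar_mat_wit A (diag n x) P Q"
    by (intro similar_mat_witI[OF Q(2,3) _ A diag_carrier P Q(1)])
  then show ?thesis using that inj by blast
qed

section \<open>Tuples with the largest number of eigenvalues\<close>

text \<open>No related tuple has more eigenvalues in total. The consequences of this are drawn from tuples to which two shears
  lead.\<close>

locale maximal_tuple =
  fixes I :: "nat set" and n :: "nat \<Rightarrow> nat" and X Y :: "nat \<Rightarrow> complex mat"
  assumes finite_I: "finite I"
    and X: "\<And>i. i \<in> I \<Longrightarrow> X i \<in> carrier_mat (n i) (n i)"
    and Y: "\<And>i. i \<in> I \<Longrightarrow> Y i \<in> carrier_mat (n i) (n i)"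
    and CM: "\<And>i. i \<in> I \<Longrightarrow> CM_relation (n i) (X i) (Y i)"
    and maximal: "\<And>T. equivalent I n (\<lambda>i. (X i, Y i)) T \<Longrightarrow>
      card (\<Union>i\<in>I. spectrum (fst (T i))) \<le> card (\<Union>i\<in>I. spectrum (X i))"
begin

definition L :: "complex set" where
  "L = (\<Union>i\<in>I. spectrum (X i))"

text \<open>A common bound for the sizes of Jordan blocks; it is positive, so that a congruence modulo \<open>(z - x)\<^sup>K\<close> also
  determines the value at \<open>x\<close>.\<close>

definition K :: nat where
  "K = Suc (sum n I)"

lemma finite_L: "finite L"
  unfolding L_def using finite_I card_finite_spectrum(1)[OF X] by blast

lemma spectrum_subset_L: "i \<in> I \<Longrightarrow> spectrum (X i) \<subseteq> L"
  by (auto simp: L_def)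

lemma n_le_K: "i \<in> I \<Longrightarrow> n i \<le> K"
  unfolding K_def using member_le_sum[of i I n] finite_I by simp

text \<open>The functional calculus common to all matrices of the tuple: a function on the union of the spectra acts
  on the generalised eigenspaces as scalars.\<close>

definition res :: "(complex \<Rightarrow> complex) \<Rightarrow> complex poly" where
  "res r = (SOME f. \<forall>x\<in>L. [:- x, 1:] ^ K dvd f - [:r x:])"

definition sf :: "(complex \<Rightarrow> complex) \<Rightarrow> nat \<Rightarrow> complex mat" where
  "sf r i = mat_poly (n i) (res r) (X i)"

lemma res: "x \<in> L \<Longrightarrow> [:- x, 1:] ^ K dvd res r - [:r x:]"
proof -
  obtain q where "\<And>x. x \<in> L \<Longrightarrow> [:- x, 1:] ^ K dvd q - [:r x:]"
    using poly_chinese_remainder[OF finite_L, of K "\<lambda>x. [:r x:]"] by metis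
  then have "\<exists>f. \<forall>x\<in>L. [:- x, 1:] ^ K dvd f - [:r x:]" by blast
  then have "\<forall>x\<in>L. [:- x, 1:] ^ K dvd res r - [:r x:]"
    unfolding res_def by (rule someI_ex)
  then show "x \<in> L \<Longrightarrow> [:- x, 1:] ^ K dvd res r - [:r x:]" by blast
qed

lemma poly_res:
  assumes "x \<in> L" shows "poly (res r) x = r x"
proof -
  have "[:- x, 1:] dvd [:- x, 1:] ^ K" by (simp only: K_def power_Suc dvd_triv_left)
  then have "[:- x, 1:] dvd res r - [:r x:]"
    using res[OF assms] dvd_trans by blast
  then show ?thesis by (simp add: poly_eq_0_iff_dvd[symmetric])
qed

lemma mat_poly_eqI:
  assumes i: "i \<in> I" and "\<And>x. x \<in> L \<Longrightarrow> [:- x, 1:] ^ K dvd f - g"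
  shows "mat_poly (n i) f (X i) = mat_poly (n i) g (X i)"
proof -
  have "mat_poly (n i) (f - g) (X i) = 0\<^sub>m (n i) (n i)"
    by (rule mat_poly_vanish[OF X[OF i] finite_L spectrum_subset_L[OF i] n_le_K[OF i] assms(2)])
  then have "mat_poly (n i) (f - g + g) (X i) = mat_poly (n i) g (X i)"
    unfolding mat_poly_add by (simp add: left_add_zero_mat[of _ "n i" "n i"])
  then show ?thesis by simp
qed

lemma sf_carrier [simp]: "sf r i \<in> carrier_mat (n i) (n i)"
  by (simp add: sf_def)

lemma sf_cong: "i \<in> I \<Longrightarrow> (\<And>x. x \<in> L \<Longrightarrow> r x = s x) \<Longrightarrow> sf r i = sf s i"
  unfolding sf_def
proof (rule mat_poly_eqI, assumption)
  fix x assume "x \<in> L" and eq: "\<And>x. x \<in> L \<Longrightarrow> r x = s x"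
  have "res r - res s = (res r - [:r x:]) - (res s - [:s x:])"
    using eq[OF \<open>x \<in> L\<close>] by simp
  then show "[:- x, 1:] ^ K dvd res r - res s"
    using res[OF \<open>x \<in> L\<close>] by (metis dvd_diff)
qed

lemma sf_mult:
  assumes i: "i \<in> I" shows "sf (\<lambda>x. r x * s x) i = sf r i * sf s i"
proof -
  have "mat_poly (n i) (res (\<lambda>x. r x * s x)) (X i) = mat_poly (n i) (res r * res s) (X i)"
  proof (rule mat_poly_eqI[OF i])
    fix x assume x: "x \<in> L"
    have eq: "res (\<lambda>x. r x * s x) - res r * res s = (res (\<lambda>x. r x * s x) - [:r x * s x:])
        - ((res r - [:r x:]) * res s + [:r x:] * (res s - [:s x:]))"
      by (simp add: algebra_simps)
    show "[:- x, 1:] ^ K dvd res (\<lambda>x. r x * s x) - res r * res s"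
      unfolding eq by (intro dvd_diff dvd_add dvd_mult[OF res[OF x]] dvd_mult2[OF res[OF x]] res[OF x])
  qed
  then show ?thesis using X[OF i] by (simp add: sf_def mat_poly_mult)
qed

lemma sf_add:
  assumes i: "i \<in> I" shows "sf (\<lambda>x. r x + s x) i = sf r i + sf s i"
proof -
  have "mat_poly (n i) (res (\<lambda>x. r x + s x)) (X i) = mat_poly (n i) (res r + res s) (X i)"
  proof (rule mat_poly_eqI[OF i])
    fix x assume x: "x \<in> L"
    have eq: "res (\<lambda>x. r x + s x) - (res r + res s) = (res (\<lambda>x. r x + s x) - [:r x + s x:])
        - ((res r - [:r x:]) + (res s - [:s x:]))"
      by simp
    show "[:- x, 1:] ^ K dvd res (\<lambda>x. r x + s x) - (res r + res s)"
      unfolding eq by (intro dvd_diff dvd_add res[OF x])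
  qed
  then show ?thesis by (simp add: sf_def mat_poly_add)
qed

lemma sf_const:
  assumes i: "i \<in> I" shows "sf (\<lambda>_. c) i = c \<cdot>\<^sub>m 1\<^sub>m (n i)"
proof -
  have "mat_poly (n i) (res (\<lambda>_. c)) (X i) = mat_poly (n i) [:c:] (X i)"
    by (rule mat_poly_eqI[OF i]) (use res[of _ "\<lambda>_. c"] in simp)
  then show ?thesis using X[OF i] by (simp add: sf_def mat_poly_const)
qed

lemma sf_cmult:
  assumes i: "i \<in> I" shows "sf (\<lambda>x. c * r x) i = c \<cdot>\<^sub>m sf r i"
  using sf_mult[OF i, of "\<lambda>_. c" r]
  by (simp add: sf_const[OF i] sq_smult_left[where n = "n i"] left_mult_one_mat[of _ "n i" "n i"])

lemma sf_eigenvector: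
  assumes i: "i \<in> I" and v: "v \<in> carrier_vec (n i)" "v \<noteq> 0\<^sub>v (n i)" "X i *\<^sub>v v = k \<cdot>\<^sub>v v"
  shows "sf r i *\<^sub>v v = r k \<cdot>\<^sub>v v"
proof -
  have "k \<in> L" using spectrumI[OF X[OF i] v] spectrum_subset_L[OF i] by blast
  then show ?thesis
    unfolding sf_def using mat_poly_eigenvector[OF X[OF i] v(1,3)] poly_res by simp
qed

lemma sf_commute: "i \<in> I \<Longrightarrow> sf r i * X i = X i * sf r i"
  using mat_poly_mult[OF X, of i "res r" "[:0, 1:]"] mat_poly_mult[OF X, of i "[:0, 1:]" "res r"] X
  by (simp add: sf_def mult.commute)

text \<open>The projection to the sum of the generalised eigenspaces on which \<open>c\<close> takes the value \<open>\<gamma>\<close>, and the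
  eigenvalues of the compression of \<open>Y + h(X)\<close> to it.\<close>

definition proj :: "(complex \<Rightarrow> complex) \<Rightarrow> complex \<Rightarrow> nat \<Rightarrow> complex mat" where
  "proj c \<gamma> i = sf (\<lambda>x. if c x = \<gamma> then 1 else 0) i"

definition compressed_eigenvalue ::
  "(complex \<Rightarrow> complex) \<Rightarrow> complex \<Rightarrow> complex poly \<Rightarrow> nat \<Rightarrow> complex \<Rightarrow> bool" where
  "compressed_eigenvalue c \<gamma> h i b \<longleftrightarrow> (\<exists>v\<in>carrier_vec (n i). v \<noteq> 0\<^sub>v (n i) \<and> proj c \<gamma> i *\<^sub>v v = v \<and>
     proj c \<gamma> i *\<^sub>v ((Y i + mat_poly (n i) h (X i)) *\<^sub>v v) = b \<cdot>\<^sub>v v)"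

lemma proj_carrier [simp]: "proj c \<gamma> i \<in> carrier_mat (n i) (n i)"
  by (simp add: proj_def)

lemma proj_idem: "i \<in> I \<Longrightarrow> proj c \<gamma> i * proj c \<gamma> i = proj c \<gamma> i"
  unfolding proj_def sf_mult[symmetric] by (rule sf_cong) auto

lemma proj_sf:
  assumes i: "i \<in> I" shows "proj c \<gamma> i * sf c i = \<gamma> \<cdot>\<^sub>m proj c \<gamma> i"
  unfolding proj_def sf_mult[OF i, symmetric] sf_cmult[OF i, symmetric] by (rule sf_cong[OF i]) auto

lemma sf_proj:
  assumes i: "i \<in> I" shows "sf c i * proj c \<gamma> i = \<gamma> \<cdot>\<^sub>m proj c \<gamma> i"
  unfolding proj_def sf_mult[OF i, symmetric] sf_cmult[OF i, symmetric] by (rule sf_cong[OF i]) auto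

text \<open>The function \<open>g\<close> inverts \<open>c - \<gamma>\<close> where it does not vanish, so \<open>1\<close> minus the projection is a multiple of
  \<open>c(X) - \<gamma>\<close>.\<close>

lemma proj_fixes_eigenspace:
  assumes i: "i \<in> I" and v: "v \<in> carrier_vec (n i)" and ev: "sf c i *\<^sub>v v = \<gamma> \<cdot>\<^sub>v v"
  shows "proj c \<gamma> i *\<^sub>v v = v"
proof -
  define g where "g x = (if c x = \<gamma> then 0 else 1 / (c x - \<gamma>))" for x
  have "proj c \<gamma> i + sf g i * (sf c i + (- \<gamma>) \<cdot>\<^sub>m 1\<^sub>m (n i)) = 1 \<cdot>\<^sub>m 1\<^sub>m (n i)"
    unfolding sf_const[OF i, symmetric] sf_add[OF i, symmetric] sf_mult[OF i, symmetric] proj_def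
    by (rule sf_cong[OF i]) (auto simp: g_def)
  then have "(proj c \<gamma> i + sf g i * (sf c i + (- \<gamma>) \<cdot>\<^sub>m 1\<^sub>m (n i))) *\<^sub>v v = v"
    using v by (simp add: smult_mat_mult_vec[of _ "n i"])
  moreover have "(sf c i + (- \<gamma>) \<cdot>\<^sub>m 1\<^sub>m (n i)) *\<^sub>v v = 0\<^sub>v (n i)"
    using v by (simp add: sq_add_vec[where n = "n i"] smult_mat_mult_vec[of _ "n i"] ev) (intro eq_vecI, auto)
  moreover have "sf g i *\<^sub>v 0\<^sub>v (n i) = 0\<^sub>v (n i)"
    by (intro eq_vecI) (auto simp: carrier_matD[OF sf_carrier])
  ultimately show ?thesis
    using v by (simp add: sq_add_vec[where n = "n i"] sq_mult[where n = "n i"] sq_mult_vec[where n = "n i"]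
        right_zero_vec[OF mult_mat_vec_carrier[OF proj_carrier]])
qed

text \<open>The bound from maximality: the compressed eigenvalues, counted for each value of \<open>c\<close> separately, are at most as
  many as the eigenvalues of the tuple.\<close>

lemma count_compressed_eigenvalues:
  assumes fin: "\<And>\<gamma>. \<gamma> \<in> c ` L \<Longrightarrow> finite (S \<gamma>)"
    and S: "\<And>\<gamma> b. \<gamma> \<in> c ` L \<Longrightarrow> b \<in> S \<gamma> \<Longrightarrow> \<exists>i\<in>I. compressed_eigenvalue c \<gamma> h i b"
  shows "(\<Sum>\<gamma>\<in>c ` L. card (S \<gamma>)) \<le> card L"
proof -
  define B where "B i = Y i + mat_poly (n i) h (X i)" for i
  have B: "B i \<in> carrier_mat (n i) (n i)" if "i \<in> I" for i
    using Y[OF that] by (simp add: B_def)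
  obtain \<epsilon> where \<epsilon>: "\<epsilon> \<noteq> 0" and le: "(\<Sum>\<gamma>\<in>c ` L. card (S \<gamma>)) \<le> card (\<Union>i\<in>I. spectrum (sf c i + \<epsilon> \<cdot>\<^sub>m B i))"
  proof (rule count_perturbed_eigenvalues[of I "c ` L" S "sf c" n B "proj c"])
    fix \<gamma> b assume \<gamma>: "\<gamma> \<in> c ` L" "b \<in> S \<gamma>"
    then obtain i v where i: "i \<in> I" and v: "v \<in> carrier_vec (n i)" "v \<noteq> 0\<^sub>v (n i)" "proj c \<gamma> i *\<^sub>v v = v"
      "proj c \<gamma> i *\<^sub>v (B i *\<^sub>v v) = b \<cdot>\<^sub>v v"
      using S[OF \<gamma>] unfolding compressed_eigenvalue_def B_def by blast
    have "sf c i *\<^sub>v v = (sf c i * proj c \<gamma> i) *\<^sub>v v"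
      using v by (simp add: sq_mult_vec[where n = "n i"])
    also have "\<dots> = \<gamma> \<cdot>\<^sub>v v"
      using v by (simp add: sf_proj[OF i] smult_mat_mult_vec[of _ "n i"])
    finally show "\<exists>i\<in>I. \<exists>v\<in>carrier_vec (n i). v \<noteq> 0\<^sub>v (n i) \<and> sf c i *\<^sub>v v = \<gamma> \<cdot>\<^sub>v v \<and> proj c \<gamma> i *\<^sub>v (B i *\<^sub>v v) = b \<cdot>\<^sub>v v"
      using i v by blast
  qed (use finite_I finite_L fin B proj_idem proj_sf proj_fixes_eigenspace in auto)
  \<comment> \<open>The shear by \<open>g\<close> followed by \<open>x \<mapsto> x + y\<close> replaces \<open>X\<close> by \<open>Y + h(X) + c(X) / \<epsilon>\<close>: the first shear takes away the
    \<open>X\<close> that the second one adds.\<close>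
  define g where "g = h + Polynomial.smult (1 / \<epsilon>) (res c) - [:0, 1:]"
  define X' where "X' i = X i + (Y i + mat_poly (n i) g (X i))" for i
  have X': "sf c i + \<epsilon> \<cdot>\<^sub>m B i = \<epsilon> \<cdot>\<^sub>m X' i" if i: "i \<in> I" for i
  proof -
    have "mat_poly (n i) g (X i) = mat_poly (n i) h (X i) + (1 / \<epsilon>) \<cdot>\<^sub>m sf c i - X i"
      using X[OF i] by (simp add: g_def mat_poly_diff mat_poly_add mat_poly_smult sf_def)
    then show ?thesis
      using X[OF i] Y[OF i] \<epsilon> carrier_matD[OF sf_carrier[of c i]]
      by (intro eq_matI) (auto simp: X'_def B_def algebra_simps)
  qed
  let ?T = "\<lambda>i. (X i, Y i)" and ?T1 = "\<lambda>i. (X i, Y i + mat_poly (n i) g (X i))"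
  have sq: "square_pairs I n ?T" using X Y by (simp add: square_pairs_def square_pair_def)
  have 1: "equivalent I n ?T ?T1" using equivalent_y_shear[OF sq, of g] by simp
  have sq1: "square_pairs I n ?T1" by (rule equivalent_square_pairs[OF 1])
  have "equivalent I n ?T1 (\<lambda>i. (X i + mat_poly (n i) [:0, 1:] (Y i + mat_poly (n i) g (X i)), Y i + mat_poly (n i) g (X i)))"
    using equivalent_x_shear[OF sq1, of "[:0, 1:]"] by simp
  from equivalent_trans[OF 1 this sq]
  have "card (\<Union>i\<in>I. spectrum (X i + mat_poly (n i) [:0, 1:] (Y i + mat_poly (n i) g (X i)))) \<le> card L"
    unfolding L_def using maximal by fastforce
  moreover have "mat_poly (n i) [:0, 1:] (Y i + mat_poly (n i) g (X i)) = Y i + mat_poly (n i) g (X i)" if "i \<in> I" for i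
    using square_pairsD(2)[OF sq1 that] by simp
  ultimately have card_X': "card (\<Union>i\<in>I. spectrum (X' i)) \<le> card L"
    by (simp add: X'_def)
  have X'c: "X' i \<in> carrier_mat (n i) (n i)" if "i \<in> I" for i
    using X[OF that] Y[OF that] by (simp add: X'_def)
  have "(\<Union>i\<in>I. spectrum (sf c i + \<epsilon> \<cdot>\<^sub>m B i)) \<subseteq> (\<lambda>k. \<epsilon> * k) ` (\<Union>i\<in>I. spectrum (X' i))"
  proof
    fix k assume "k \<in> (\<Union>i\<in>I. spectrum (sf c i + \<epsilon> \<cdot>\<^sub>m B i))"
    then obtain i where i: "i \<in> I" and "k \<in> spectrum (\<epsilon> \<cdot>\<^sub>m X' i)" using X' by auto
    then obtain v where v: "v \<in> carrier_vec (n i)" "v \<noteq> 0\<^sub>v (n i)" "(\<epsilon> \<cdot>\<^sub>m X' i) *\<^sub>v v = k \<cdot>\<^sub>v v"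
      using spectrumE[of k "\<epsilon> \<cdot>\<^sub>m X' i" "n i"] X'c[OF i] by auto
    have "\<epsilon> \<cdot>\<^sub>v (X' i *\<^sub>v v) = k \<cdot>\<^sub>v v"
      using v smult_mat_mult_vec[OF X'c[OF i] v(1)] by simp
    then have "(1 / \<epsilon>) \<cdot>\<^sub>v (\<epsilon> \<cdot>\<^sub>v (X' i *\<^sub>v v)) = (1 / \<epsilon>) \<cdot>\<^sub>v (k \<cdot>\<^sub>v v)" by simp
    then have "X' i *\<^sub>v v = (k / \<epsilon>) \<cdot>\<^sub>v v" using \<epsilon> by (simp add: smult_smult_assoc)
    then have "k / \<epsilon> \<in> spectrum (X' i)" by (rule spectrumI[OF X'c[OF i] v(1,2)])
    then show "k \<in> (\<lambda>k. \<epsilon> * k) ` (\<Union>i\<in>I. spectrum (X' i))"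
      using i \<epsilon> by (intro image_eqI[of _ _ "k / \<epsilon>"]) auto
  qed
  moreover have "finite (\<Union>i\<in>I. spectrum (X' i))"
    using finite_I card_finite_spectrum(1)[OF X'c] by blast
  ultimately have "card (\<Union>i\<in>I. spectrum (sf c i + \<epsilon> \<cdot>\<^sub>m B i)) \<le> card (\<Union>i\<in>I. spectrum (X' i))"
    by (rule surj_card_le[rotated])
  then show ?thesis using le card_X' by linarith
qed

lemma compressed_eigenvalue_exists:
  assumes "\<gamma> \<in> c ` L"
  shows "\<exists>i\<in>I. \<exists>b. compressed_eigenvalue c \<gamma> h i b"
proof -
  obtain k i where k: "\<gamma> = c k" "i \<in> I" "k \<in> spectrum (X i)"
    using assms by (auto simp: L_def)
  note i = k(2)
  define W where "W = {v \<in> carrier_vec (n i). proj c \<gamma> i *\<^sub>v v = v}"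
  define B where "B = Y i + mat_poly (n i) h (X i)"
  have B: "B \<in> carrier_mat (n i) (n i)" using Y[OF i] by (simp add: B_def)
  obtain w where w: "w \<in> carrier_vec (n i)" "w \<noteq> 0\<^sub>v (n i)" "X i *\<^sub>v w = k \<cdot>\<^sub>v w"
    by (rule spectrumE[OF k(3) X[OF i]])
  have "proj c \<gamma> i *\<^sub>v w = w"
    unfolding proj_def sf_eigenvector[OF i w] by (simp add: k(1))
  then have wW: "w \<in> W" using w by (simp add: W_def)
  have PB: "proj c \<gamma> i * B \<in> carrier_mat (n i) (n i)" using B by (simp add: sq_mult[where n = "n i"])
  have inv: "(proj c \<gamma> i * B) *\<^sub>v v - a \<cdot>\<^sub>v v \<in> W" if "v \<in> W" for v a
  proof -
    have v: "v \<in> carrier_vec (n i)" "proj c \<gamma> i *\<^sub>v v = v" using that by (auto simp: W_def)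
    have c: "(proj c \<gamma> i * B) *\<^sub>v v \<in> carrier_vec (n i)" using PB v(1) by simp
    have "proj c \<gamma> i *\<^sub>v ((proj c \<gamma> i * B) *\<^sub>v v) = (proj c \<gamma> i * B) *\<^sub>v v"
      using sq_mult_vec[OF proj_carrier PB v(1), of c \<gamma>] sq_assoc[OF proj_carrier proj_carrier B, of c \<gamma> c \<gamma>]
      by (simp add: proj_idem[OF i])
    then show ?thesis
      using v c mult_minus_distrib_mat_vec[OF proj_carrier c smult_carrier_vec[THEN iffD2, OF v(1)], of c \<gamma> a]
      by (simp add: W_def mult_mat_vec[of _ "n i" "n i"])
  qed
  obtain v b where v: "v \<in> W" "v \<noteq> 0\<^sub>v (n i)" "(proj c \<gamma> i * B) *\<^sub>v v = b \<cdot>\<^sub>v v"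
    by (rule eigenvector_in_invariant_set[OF PB _ inv wW w(2)]) (auto simp: W_def)
  have "v \<in> carrier_vec (n i)" "proj c \<gamma> i *\<^sub>v v = v" using v(1) by (auto simp: W_def)
  moreover have "proj c \<gamma> i *\<^sub>v (B *\<^sub>v v) = b \<cdot>\<^sub>v v"
    using sq_mult_vec[OF proj_carrier B \<open>v \<in> carrier_vec (n i)\<close>, of c \<gamma>] v(3) by simp
  ultimately have "compressed_eigenvalue c \<gamma> h i b"
    unfolding compressed_eigenvalue_def B_def[symmetric] using v(2) by blast
  then show ?thesis using i by blast
qed

text \<open>Each value of \<open>c\<close> contributes at least one eigenvalue, so all that can be gained must be gained at \<open>\<gamma>\<close>.\<close>

lemma count_compressed_eigenvalues_at:
  assumes \<gamma>: "\<gamma> \<in> c ` L" and "finite A" and A: "\<And>b. b \<in> A \<Longrightarrow> \<exists>i\<in>I. compressed_eigenvalue c \<gamma> h i b"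
  shows "card A + card (c ` L - {\<gamma>}) \<le> card L"
proof -
  have "\<forall>\<beta>\<in>c ` L. \<exists>b. \<exists>i\<in>I. compressed_eigenvalue c \<beta> h i b"
    using compressed_eigenvalue_exists by blast
  from bchoice[OF this] obtain s where s: "\<forall>\<beta>\<in>c ` L. \<exists>i\<in>I. compressed_eigenvalue c \<beta> h i (s \<beta>)" ..
  define S where "S \<beta> = (if \<beta> = \<gamma> then A else {s \<beta>})" for \<beta>
  have "(\<Sum>\<beta>\<in>c ` L. card (S \<beta>)) \<le> card L"
    by (rule count_compressed_eigenvalues[where h = h]) (use assms s in \<open>auto simp: S_def split: if_splits\<close>)
  moreover have "(\<Sum>\<beta>\<in>c ` L. card (S \<beta>)) = card A + (\<Sum>\<beta>\<in>c ` L - {\<gamma>}. card (S \<beta>))"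
    using \<gamma> finite_L by (simp add: sum.remove[of _ \<gamma>] S_def)
  moreover have "(\<Sum>\<beta>\<in>c ` L - {\<gamma>}. card (S \<beta>)) = (\<Sum>\<beta>\<in>c ` L - {\<gamma>}. 1)"
    by (intro sum.cong) (auto simp: S_def)
  ultimately show ?thesis by simp
qed

text \<open>If \<open>c\<close> is injective, then there is no room for a second eigenvalue anywhere, not even one from another block.\<close>

lemma compressed_eigenvalue_unique:
  assumes "\<mu> \<in> L" and "i \<in> I" "compressed_eigenvalue (\<lambda>x. x) \<mu> h i b" and "j \<in> I" "compressed_eigenvalue (\<lambda>x. x) \<mu> h j b'"
  shows "b = b'"
proof -
  have "card {b, b'} + card (L - {\<mu>}) \<le> card L"
    using count_compressed_eigenvalues_at[of \<mu> "\<lambda>x. x" "{b, b'}" h] assms by auto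
  moreover have "card (L - {\<mu>}) = card L - 1" "card L > 0"
    using assms(1) finite_L by (auto simp: card_gt_0_iff)
  ultimately have "card {b, b'} \<le> 1" by linarith
  then show ?thesis by (cases "b = b'") auto
qed

lemma trace_proj:
  assumes i: "i \<in> I" and \<mu>: "\<mu> \<in> L"
  shows "trace (n i) (proj (\<lambda>x. x) \<mu> i) = 0 \<or> trace (n i) (proj (\<lambda>x. x) \<mu> i) = 1"
proof -
  define f where "f = res (\<lambda>x. if x = \<mu> then 1 else 0)"
  have pf: "proj (\<lambda>x. x) \<mu> i = mat_poly (n i) f (X i)"
    by (simp add: proj_def sf_def f_def)
  have "mat_poly (n i) ([:- \<mu>, 1:] ^ K * f) (X i) = 0\<^sub>m (n i) (n i)"
  proof (rule mat_poly_vanish[OF X[OF i] finite_L spectrum_subset_L[OF i] n_le_K[OF i]])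
    fix x assume x: "x \<in> L"
    show "[:- x, 1:] ^ K dvd [:- \<mu>, 1:] ^ K * f"
    proof (cases "x = \<mu>")
      case False
      then have "[:- x, 1:] ^ K dvd f" using res[OF x, of "\<lambda>x. if x = \<mu> then 1 else 0"] by (simp add: f_def)
      then show ?thesis by (rule dvd_mult)
    qed simp
  qed
  moreover have "\<exists>k. \<forall>v b. v \<in> carrier_vec (n i) \<longrightarrow> v \<noteq> 0\<^sub>v (n i) \<longrightarrow> mat_poly (n i) f (X i) *\<^sub>v v = v \<longrightarrow>
      mat_poly (n i) f (X i) *\<^sub>v ((Y i + mat_poly (n i) h (X i)) *\<^sub>v v) = b \<cdot>\<^sub>v v \<longrightarrow> b = k" for h
  proof -
    define k where "k = (SOME b. compressed_eigenvalue (\<lambda>x. x) \<mu> h i b)"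
    have "b = k" if "compressed_eigenvalue (\<lambda>x. x) \<mu> h i b" for b
      using compressed_eigenvalue_unique[OF \<mu> i that i] someI[of "compressed_eigenvalue (\<lambda>x. x) \<mu> h i", OF that]
      by (simp add: k_def)
    then show ?thesis
      unfolding compressed_eigenvalue_def pf by blast
  qed
  ultimately show ?thesis
    unfolding pf using multiplicity_le_one[OF X[OF i] Y[OF i] CM[OF i], of f K \<mu>] proj_idem[OF i, of "\<lambda>x. x" \<mu>]
    by (simp add: pf K_def)
qed

lemma proj_nonzero:
  assumes i: "i \<in> I" and "proj (\<lambda>x. x) \<mu> i \<noteq> 0\<^sub>m (n i) (n i)"
  shows "\<mu> \<in> spectrum (X i)"
proof -
  let ?P = "proj (\<lambda>x. x) \<mu> i"
  define W where "W = {v \<in> carrier_vec (n i). ?P *\<^sub>v v = v}"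
  obtain u where u: "u \<in> carrier_vec (n i)" "?P *\<^sub>v u \<noteq> 0\<^sub>v (n i)"
    using mat_eq_zeroI[OF proj_carrier] assms(2) by blast
  have PW: "?P *\<^sub>v u \<in> W"
    using u sq_mult_vec[OF proj_carrier proj_carrier u(1), of "\<lambda>x. x" \<mu> "\<lambda>x. x" \<mu>]
    by (simp add: W_def proj_idem[OF i] mult_mat_vec_carrier[OF proj_carrier])
  have inv: "X i *\<^sub>v v - a \<cdot>\<^sub>v v \<in> W" if "v \<in> W" for v a
  proof -
    have v: "v \<in> carrier_vec (n i)" "?P *\<^sub>v v = v" using that by (auto simp: W_def)
    have c: "X i *\<^sub>v v \<in> carrier_vec (n i)" using X[OF i] v(1) by simp
    have "?P *\<^sub>v (X i *\<^sub>v v) = X i *\<^sub>v v"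
      using sq_mult_vec[OF proj_carrier X[OF i] v(1), of "\<lambda>x. x" \<mu>] sq_mult_vec[OF X[OF i] proj_carrier v(1), of "\<lambda>x. x" \<mu>] v(2)
      by (simp add: proj_def sf_commute[OF i])
    then show ?thesis
      using v c mult_minus_distrib_mat_vec[OF proj_carrier c smult_carrier_vec[THEN iffD2, OF v(1)], of "\<lambda>x. x" \<mu> a]
      by (simp add: W_def mult_mat_vec[of _ "n i" "n i"])
  qed
  obtain v k where v: "v \<in> W" "v \<noteq> 0\<^sub>v (n i)" "X i *\<^sub>v v = k \<cdot>\<^sub>v v"
    by (rule eigenvector_in_invariant_set[OF X[OF i] _ inv PW u(2)]) (auto simp: W_def)
  have vc: "v \<in> carrier_vec (n i)" "?P *\<^sub>v v = v" using v(1) by (auto simp: W_def)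
  have "(if k = \<mu> then 1 else 0) \<cdot>\<^sub>v v = v"
    using sf_eigenvector[OF i vc(1) v(2,3), of "\<lambda>x. if x = \<mu> then 1 else 0"] vc(2) by (simp add: proj_def)
  moreover have "0 \<cdot>\<^sub>v v = 0\<^sub>v (n i)"
    using vc(1) by (intro eq_vecI) auto
  ultimately have "k = \<mu>"
    using v(2) by (cases "k = \<mu>") auto
  then show ?thesis using spectrumI[OF X[OF i] vc(1) v(2,3)] by simp
qed

text \<open>The multiplicities add up to the size and are at most one.\<close>

lemma simple_spectrum:
  assumes i: "i \<in> I" shows "card (spectrum (X i)) = n i"
proof -
  let ?P = "\<lambda>\<mu>. proj (\<lambda>x. x) \<mu> i"
  have "trace (n i) (sf (\<lambda>x. \<Sum>\<mu>\<in>A. if x = \<mu> then 1 else 0) i) = (\<Sum>\<mu>\<in>A. trace (n i) (?P \<mu>))" if "finite A" for A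
    using that
  proof (induction A rule: finite_induct)
    case empty
    then show ?case by (simp add: sf_const[OF i] trace_def)
  next
    case (insert \<mu> A)
    show ?case
      unfolding sum.insert[OF insert.hyps] sf_add[OF i] trace_add[OF sf_carrier sf_carrier] insert.IH proj_def ..
  qed
  from this[OF finite_L]
  have "(\<Sum>\<mu>\<in>L. trace (n i) (?P \<mu>)) = trace (n i) (sf (\<lambda>x. \<Sum>\<mu>\<in>L. if x = \<mu> then 1 else 0) i)" by simp
  also have "sf (\<lambda>x. \<Sum>\<mu>\<in>L. if x = \<mu> then 1 else 0) i = sf (\<lambda>_. 1) i"
    by (rule sf_cong[OF i]) (simp add: finite_L)
  also have "trace (n i) (sf (\<lambda>_. 1) i) = of_nat (n i)"
    by (simp add: sf_const[OF i] trace_def)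
  finally have sum: "(\<Sum>\<mu>\<in>L. trace (n i) (?P \<mu>)) = of_nat (n i)" .
  have "(\<Sum>\<mu>\<in>L. trace (n i) (?P \<mu>)) = (\<Sum>\<mu>\<in>L. if trace (n i) (?P \<mu>) = 1 then 1 else 0)"
    using trace_proj[OF i] by (intro sum.cong) auto
  also have "\<dots> = of_nat (card {\<mu> \<in> L. trace (n i) (?P \<mu>) = 1})"
    using finite_L by (simp add: sum.If_cases Int_def)
  finally have "n i = card {\<mu> \<in> L. trace (n i) (?P \<mu>) = 1}"
    using sum by (metis of_nat_eq_iff)
  also have "\<dots> \<le> card (spectrum (X i))"
  proof (rule card_mono[OF card_finite_spectrum(1)[OF X[OF i]]], rule subsetI)
    fix \<mu> assume "\<mu> \<in> {\<mu> \<in> L. trace (n i) (?P \<mu>) = 1}"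
    then have "?P \<mu> \<noteq> 0\<^sub>m (n i) (n i)" by (auto simp: trace_def)
    then show "\<mu> \<in> spectrum (X i)" by (rule proj_nonzero[OF i])
  qed
  finally show ?thesis using card_finite_spectrum(2)[OF X[OF i]] by simp
qed

lemma compressed_eigenvalue_diagI:
  assumes i: "i \<in> I" and Xd: "X i = diag (n i) x"
    and supp: "\<And>p. p < n i \<Longrightarrow> w p \<noteq> 0 \<Longrightarrow> c (x p) = \<gamma>" and p0: "p0 < n i" "w p0 \<noteq> 0"
    and ev: "\<And>p. p < n i \<Longrightarrow> c (x p) = \<gamma> \<Longrightarrow> (\<Sum>q<n i. Y i $$ (p, q) * w q) + poly h (x p) * w p = b * w p"
  shows "compressed_eigenvalue c \<gamma> h i b"
proof -
  define v where "v = vec (n i) w"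
  have v: "v \<in> carrier_vec (n i)" by (simp add: v_def)
  have "x p \<in> L" if "p < n i" for p
    using spectrum_subset_L[OF i] that by (auto simp: Xd spectrum_diag)
  then have P: "proj c \<gamma> i = diag (n i) (\<lambda>p. if c (x p) = \<gamma> then 1 else 0)"
    unfolding proj_def sf_def Xd mat_poly_diag by (intro eq_matI) (auto simp: diag_entry poly_res)
  have "v \<noteq> 0\<^sub>v (n i)"
    using p0 by (metis index_vec index_zero_vec(1) v_def)
  moreover have "proj c \<gamma> i *\<^sub>v v = v"
  proof (rule eq_vecI)
    fix p assume "p < dim_vec v"
    then have p: "p < n i" by (simp add: v_def)
    show "(proj c \<gamma> i *\<^sub>v v) $ p = v $ p"
      unfolding P diag_mult_vec[OF v p] using supp[OF p] p by (auto simp: v_def)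
  qed (simp add: P v_def)
  moreover have "proj c \<gamma> i *\<^sub>v ((Y i + mat_poly (n i) h (X i)) *\<^sub>v v) = b \<cdot>\<^sub>v v"
  proof (rule eq_vecI)
    fix p assume "p < dim_vec (b \<cdot>\<^sub>v v)"
    then have p: "p < n i" by (simp add: v_def)
    have c: "(Y i + mat_poly (n i) h (X i)) *\<^sub>v v \<in> carrier_vec (n i)"
      using Y[OF i] v by (intro mult_mat_vec_carrier[of _ _ "n i"]) auto
    have "((Y i + mat_poly (n i) h (X i)) *\<^sub>v v) $ p = (Y i *\<^sub>v v) $ p + (diag (n i) (\<lambda>p. poly h (x p)) *\<^sub>v v) $ p"
      using sq_add_vec[OF Y[OF i] mat_poly_carrier v, of h "X i"] Y[OF i] p
      by (simp add: Xd mat_poly_diag del: index_mult_mat_vec)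
    also have "\<dots> = (\<Sum>q<n i. Y i $$ (p, q) * w q) + poly h (x p) * w p"
      using Y[OF i] p unfolding diag_mult_vec[OF v p] by (simp add: v_def scalar_prod_def atLeast0LessThan)
    finally have "((Y i + mat_poly (n i) h (X i)) *\<^sub>v v) $ p = (\<Sum>q<n i. Y i $$ (p, q) * w q) + poly h (x p) * w p" .
    then show "(proj c \<gamma> i *\<^sub>v ((Y i + mat_poly (n i) h (X i)) *\<^sub>v v)) $ p = (b \<cdot>\<^sub>v v) $ p"
      unfolding P diag_mult_vec[OF c p] using ev[OF p] supp[OF p] p by (auto simp: v_def)
  qed (simp add: P v_def)
  ultimately show ?thesis
    unfolding compressed_eigenvalue_def using v by blast
qed

end

lemma CM_relation_diag:
  assumes Y: "Y \<in> carrier_mat n n" and CM: "CM_relation n (diag n x) Y"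
  obtains u v where "\<And>a. a < n \<Longrightarrow> u a * v a = 1"
    "\<And>a b. a < n \<Longrightarrow> b < n \<Longrightarrow> a \<noteq> b \<Longrightarrow> (x a - x b) * Y $$ (a, b) = u a * v b"
proof -
  obtain u v where uv: "\<And>a b. a < n \<Longrightarrow> b < n \<Longrightarrow> (diag n x * Y - Y * diag n x + 1\<^sub>m n) $$ (a, b) = u a * v b"
    using CM unfolding CM_relation_def outer_product_def by blast
  have e: "(diag n x * Y - Y * diag n x + 1\<^sub>m n) $$ (a, b) = x a * Y $$ (a, b) - Y $$ (a, b) * x b + (if a = b then 1 else 0)"
    if "a < n" "b < n" for a b
    using that Y diag_mult_entry[OF Y that, of x] by (simp del: index_mult_mat(1))
  show ?thesis
    by (rule that[of u v]) (use uv e in \<open>fastforce simp: algebra_simps\<close>)+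
qed

text \<open>Suppose that the blocks \<open>i\<close> and \<open>j\<close> share an eigenvalue \<open>\<lambda>\<close> and that block \<open>i\<close> has an eigenvalue \<open>\<mu>\<close> that
  block \<open>j\<close> lacks. Letting \<open>\<lambda>\<close> and \<open>\<mu>\<close> collide under \<open>c\<close> produces three eigenvalues out of these two: \<open>0\<close> from
  block \<open>j\<close>, and two opposite nonzero ones from block \<open>i\<close>, because the off-diagonal entries of \<open>Y\<close> do not vanish.\<close>

lemma (in maximal_tuple) shared_eigenvalue:
  assumes Xd: "\<And>i. i \<in> I \<Longrightarrow> X i = diag (n i) (x i)" and inj: "\<And>i. i \<in> I \<Longrightarrow> inj_on (x i) {..<n i}"
    and i: "i \<in> I" and j: "j \<in> I" and a: "a < n i" and a': "a' < n j" and eq: "x i a = x j a'" and b: "b < n i"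
  shows "x i b \<in> x j ` {..<n j}"
proof (rule ccontr)
  assume not: "x i b \<notin> x j ` {..<n j}"
  define l where "l = x i a"
  define m where "m = x i b"
  have lm: "l \<noteq> m"
    using not a' eq unfolding l_def m_def by (metis image_eqI lessThan_iff)
  then have ab: "a \<noteq> b" by (auto simp: l_def m_def)
  have L: "l \<in> L" "m \<in> L"
    using spectrum_subset_L[OF i] a b by (auto simp: Xd[OF i] spectrum_diag l_def m_def)
  have xi: "x i p = l \<longleftrightarrow> p = a" "x i p = m \<longleftrightarrow> p = b" if "p < n i" for p
    using inj_onD[OF inj[OF i]] that a b by (auto simp: l_def m_def)
  have xj1: "x j p = l \<longleftrightarrow> p = a'" if "p < n j" for p
    using inj_onD[OF inj[OF j]] that a' eq by (auto simp: l_def)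
  have xj2: "x j p \<noteq> m" if "p < n j" for p
    using not that unfolding m_def by (metis image_eqI lessThan_iff)
  note xj = xj1 xj2
  have single: "(\<Sum>q<k. f q * (if q = p then 1 else 0)) = f p" if "p < k" for f :: "nat \<Rightarrow> complex" and p k
  proof -
    have "(\<Sum>q<k. f q * (if q = p then 1 else 0)) = (\<Sum>q<k. if q = p then f q else 0)"
      by (intro sum.cong) auto
    then show ?thesis using that by simp
  qed
  \<comment> \<open>The diagonal entries of both blocks at the shared eigenvalue agree, as they are compressed eigenvalues; so the
    same \<open>h\<close> cancels both.\<close>
  define \<alpha> where "\<alpha> = Y i $$ (a, a)"
  have "compressed_eigenvalue (\<lambda>x. x) l 0 i \<alpha>"
    by (rule compressed_eigenvalue_diagI[OF i Xd[OF i], of "\<lambda>q. if q = a then 1 else 0" _ _ a])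
      (use a xi in \<open>auto simp: single \<alpha>_def split: if_splits\<close>)
  moreover have "compressed_eigenvalue (\<lambda>x. x) l 0 j (Y j $$ (a', a'))"
    by (rule compressed_eigenvalue_diagI[OF j Xd[OF j], of "\<lambda>q. if q = a' then 1 else 0" _ _ a'])
      (use a' xj in \<open>auto simp: single split: if_splits\<close>)
  ultimately have \<alpha>: "Y j $$ (a', a') = \<alpha>"
    using compressed_eigenvalue_unique[OF L(1) i _ j] by metis
  define c where "c x = (if x = m then l else x)" for x
  define h where "h = res (\<lambda>x. if x = l then - \<alpha> else if x = m then - Y i $$ (b, b) else 0)"
  have h: "poly h l = - \<alpha>" "poly h m = - Y i $$ (b, b)"
    using lm L by (simp_all add: h_def poly_res)
  have "compressed_eigenvalue c l h j 0"
    by (rule compressed_eigenvalue_diagI[OF j Xd[OF j], of "\<lambda>q. if q = a' then 1 else 0" _ _ a'])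
      (use a' xj h \<alpha> lm eq in \<open>auto simp: single c_def l_def[symmetric] split: if_splits\<close>)
  moreover have "compressed_eigenvalue c l h i k" if k: "k * k = Y i $$ (a, b) * Y i $$ (b, a)" "k \<noteq> 0" for k
  proof (rule compressed_eigenvalue_diagI[OF i Xd[OF i], of "\<lambda>q. if q = a then Y i $$ (a, b) else if q = b then k else 0" _ _ b])
    fix p assume p: "p < n i" "c (x i p) = l"
    then have pab: "p = a \<or> p = b" using xi by (auto simp: c_def split: if_splits)
    have "(\<Sum>q<n i. Y i $$ (p, q) * (if q = a then Y i $$ (a, b) else if q = b then k else 0)) =
        (\<Sum>q<n i. (Y i $$ (p, q) * Y i $$ (a, b)) * (if q = a then 1 else 0) + (Y i $$ (p, q) * k) * (if q = b then 1 else 0))"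
      using ab by (intro sum.cong) auto
    also have "\<dots> = Y i $$ (p, a) * Y i $$ (a, b) + Y i $$ (p, b) * k"
      unfolding sum.distrib single[OF a] single[OF b] ..
    finally show "(\<Sum>q<n i. Y i $$ (p, q) * (if q = a then Y i $$ (a, b) else if q = b then k else 0)) +
        poly h (x i p) * (if p = a then Y i $$ (a, b) else if p = b then k else 0) =
        k * (if p = a then Y i $$ (a, b) else if p = b then k else 0)"
      using pab ab h k(1) by (auto simp: l_def[symmetric] m_def[symmetric] \<alpha>_def mult_ac)
  next
    fix p assume "p < n i" "(if p = a then Y i $$ (a, b) else if p = b then k else 0) \<noteq> 0"
    then show "c (x i p) = l" by (auto simp: c_def l_def m_def split: if_splits)
  qed (use b ab k in auto)
  \<comment> \<open>The rank one condition gives \<open>Y\<^sub>a\<^sub>b Y\<^sub>b\<^sub>a = - 1 / (\<lambda> - \<mu>)\<^sup>2\<close>.\<close>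
  moreover obtain k where k: "k * k = Y i $$ (a, b) * Y i $$ (b, a)" "k \<noteq> 0"
  proof -
    have "CM_relation (n i) (diag (n i) (x i)) (Y i)" using CM[OF i] by (simp add: Xd[OF i])
    then obtain u v where uv: "\<And>a. a < n i \<Longrightarrow> u a * v a = 1"
      "\<And>a b. a < n i \<Longrightarrow> b < n i \<Longrightarrow> a \<noteq> b \<Longrightarrow> (x i a - x i b) * Y i $$ (a, b) = u a * v b"
      using CM_relation_diag[OF Y[OF i]] by blast
    have "(l - m) * Y i $$ (a, b) = u a * v b" "(m - l) * Y i $$ (b, a) = u b * v a"
      using uv(2)[OF a b ab] uv(2)[OF b a ab[symmetric]] by (simp_all add: l_def m_def)
    then have "((l - m) * Y i $$ (a, b)) * ((m - l) * Y i $$ (b, a)) = (u a * v a) * (u b * v b)"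
      by (simp add: mult_ac)
    then have "(l - m) * (m - l) * (Y i $$ (a, b) * Y i $$ (b, a)) = 1"
      using uv(1)[OF a] uv(1)[OF b] by (simp add: mult_ac)
    moreover have "(l - m) * (m - l) * ((\<i> / (l - m)) * (\<i> / (l - m))) = 1"
    proof -
      have "d * (- d) * ((\<i> / d) * (\<i> / d)) = 1" if "d \<noteq> 0" for d :: complex
        using that by (simp add: field_simps)
      from this[of "l - m"] show ?thesis using lm by simp
    qed
    ultimately have "(\<i> / (l - m)) * (\<i> / (l - m)) = Y i $$ (a, b) * Y i $$ (b, a)"
      using lm by (metis mult_cancel_left mult_zero_left zero_neq_one)
    then show ?thesis using that[of "\<i> / (l - m)"] lm by simp
  qed
  ultimately have ex: "\<exists>i\<in>I. compressed_eigenvalue c l h i b" if "b \<in> {0, k, - k}" for b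
    using that i j by (metis (no_types, lifting) insertE minus_mult_minus neg_equal_0_iff_equal singletonD)
  have cL: "c ` L = L - {m}"
    using L lm by (auto simp: c_def)
  have "card {0, k, - k} + card (L - {m} - {l}) \<le> card L"
    using count_compressed_eigenvalues_at[of l c "{0, k, - k}" h] ex L lm by (simp add: cL)
  moreover have "card {0, k, - k} = 3"
    using k(2) by (simp add: eq_neg_iff_add_eq_0)
  moreover have "card (L - {m} - {l}) + 2 = card L"
  proof -
    have "card (L - {m} - {l}) = card L - 1 - 1"
      using L lm finite_L by simp
    moreover have "card {l, m} \<le> card L" using L finite_L by (intro card_mono) auto
    ultimately show ?thesis using lm by simp
  qed
  ultimately show False by simp
qed

text \<open>Diagonalising a maximal tuple keeps it maximal. In the diagonal form, two blocks that share an eigenvalue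
  have all eigenvalues in common and thus the same size, so they are the same block.\<close>

theorem equivalent_to_disjoint_diagonal:
  assumes I: "finite I" and n: "inj_on n I" and T: "square_pairs I n T"
    and CM: "\<And>i. i \<in> I \<Longrightarrow> CM_relation (n i) (fst (T i)) (snd (T i))"
  obtains x Y where "equivalent I n T (\<lambda>i. (diag (n i) (x i), Y i))"
    "\<And>i j a b. i \<in> I \<Longrightarrow> j \<in> I \<Longrightarrow> a < n i \<Longrightarrow> b < n j \<Longrightarrow> x i a = x j b \<Longrightarrow> i = j \<and> a = b"
proof -
  let ?N = "\<lambda>T. card (\<Union>i\<in>I. spectrum (fst (T i)))"
  have bound: "?N T' \<le> sum n I" if "equivalent I n T T'" for T'
  proof -
    have "?N T' \<le> (\<Sum>i\<in>I. card (spectrum (fst (T' i))))"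
      by (rule card_UN_le[OF I])
    also have "\<dots> \<le> sum n I"
      using equivalent_square_pairs[OF that] by (intro sum_mono card_finite_spectrum(2)) (rule square_pairsD(1))
    finally show ?thesis .
  qed
  obtain M where M: "equivalent I n T M" and max: "\<forall>T'. equivalent I n T T' \<longrightarrow> ?N T' \<le> ?N M"
    using ex_has_greatest_nat[of "equivalent I n T" T ?N "Suc (sum n I)"] equivalent_refl[OF T] bound
    by (metis le_imp_less_Suc less_imp_le_nat)
  have sqM: "square_pairs I n M" by (rule equivalent_square_pairs[OF M])
  interpret M: maximal_tuple I n "\<lambda>i. fst (M i)" "\<lambda>i. snd (M i)"
    by unfold_locales
      (use I sqM equivalent_CM_relation[OF T M] CM max equivalent_trans[OF M _ T] in \<open>auto simp: square_pairs_def square_pair_def\<close>)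
  have "\<forall>i\<in>I. \<exists>x P Q. inj_on x {..<n i} \<and> similar_mat_wit (fst (M i)) (diag (n i) x) P Q"
  proof
    fix i assume i: "i \<in> I"
    show "\<exists>x P Q. inj_on x {..<n i} \<and> similar_mat_wit (fst (M i)) (diag (n i) x) P Q"
      by (rule diagonalisable_if_simple_spectrum[OF M.X[OF i] M.simple_spectrum[OF i]]) blast
  qed
  from bchoice[OF this] obtain x where "\<forall>i\<in>I. \<exists>P Q. inj_on (x i) {..<n i} \<and> similar_mat_wit (fst (M i)) (diag (n i) (x i)) P Q" ..
  from bchoice[OF this] obtain P where "\<forall>i\<in>I. \<exists>Q. inj_on (x i) {..<n i} \<and> similar_mat_wit (fst (M i)) (diag (n i) (x i)) (P i) Q" ..
  from bchoice[OF this] obtain Q where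
    xPQ: "\<forall>i\<in>I. inj_on (x i) {..<n i} \<and> similar_mat_wit (fst (M i)) (diag (n i) (x i)) (P i) (Q i)" ..
  define Y where "Y i = Q i * snd (M i) * P i" for i
  let ?D = "\<lambda>i. (diag (n i) (x i), Y i)"
  have "equivalent I n M ?D"
  proof (rule equivalent_conj[OF sqM])
    fix i assume i: "i \<in> I"
    then have s: "similar_mat_wit (fst (M i)) (diag (n i) (x i)) (P i) (Q i)" using xPQ by blast
    note w = similar_mat_witD2[OF M.X[OF i] s]
    have "similar_mat_wit (Y i) (snd (M i)) (Q i) (P i)"
      unfolding Y_def using M.Y[OF i] w(6,7) by (intro similar_mat_witI[OF w(2,1) refl]) (auto intro!: sq_mult)
    from similar_mat_wit_sym[OF this]
    show "simul_similar (M i) (?D i)"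
      using s by (auto simp: simul_similar_def)
  qed
  from equivalent_trans[OF M this T] have D: "equivalent I n T ?D" .
  have sqD: "square_pairs I n ?D" by (rule equivalent_square_pairs[OF D])
  have "spectrum (fst (M i)) = spectrum (diag (n i) (x i))" if "i \<in> I" for i
    using xPQ that char_poly_similar spectrum_root_char_poly[OF M.X[OF that]] spectrum_root_char_poly[OF diag_carrier]
    by (metis similar_mat_def)
  then have ND: "?N ?D = ?N M" by simp
  interpret D: maximal_tuple I n "\<lambda>i. diag (n i) (x i)" Y
    by unfold_locales
      (use I sqD equivalent_CM_relation[OF T D] CM max ND equivalent_trans[OF D _ T] in \<open>auto simp: square_pairs_def square_pair_def\<close>)
  have inj: "inj_on (x i) {..<n i}" if "i \<in> I" for i using xPQ that by blast
  show ?thesis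
  proof (rule that[OF D])
    fix i j a b assume i: "i \<in> I" and j: "j \<in> I" and ab: "a < n i" "b < n j" "x i a = x j b"
    have "x i ` {..<n i} \<subseteq> x j ` {..<n j}"
      using D.shared_eigenvalue[OF refl inj i j ab] by auto
    moreover have "x j ` {..<n j} \<subseteq> x i ` {..<n i}"
      using D.shared_eigenvalue[OF refl inj j i ab(2,1) ab(3)[symmetric]] by auto
    ultimately have "card (x i ` {..<n i}) = card (x j ` {..<n j})" by simp
    then have "n i = n j" by (simp add: card_image inj i j)
    then have "i = j" using n i j by (simp add: inj_on_eq_iff)
    then show "i = j \<and> a = b" using ab inj[OF i] by (auto dest: inj_onD)
  qed
qed

section \<open>The base point\<close>

text \<open>On polynomials of degree less than \<open>n\<close>, in the basis of the divided powers \<open>z\<^sup>k / k!\<close>, these are the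
  derivative and the multiplication by \<open>z\<close>, truncated by \<open>z\<^sup>n = 0\<close>.\<close>

definition deriv_mat :: "nat \<Rightarrow> complex mat" where
  "deriv_mat n = mat n n (\<lambda>(i, j). if j = Suc i then 1 else 0)"

definition mult_mat :: "nat \<Rightarrow> complex mat" where
  "mult_mat n = mat n n (\<lambda>(i, j). if i = Suc j then of_nat i else 0)"

lemma deriv_mat_carrier [simp]: "deriv_mat n \<in> carrier_mat n n"
  by (simp add: deriv_mat_def)

lemma mult_mat_carrier [simp]: "mult_mat n \<in> carrier_mat n n"
  by (simp add: mult_mat_def)

lemma deriv_mat_dim [simp]: "dim_row (deriv_mat n) = n" "dim_col (deriv_mat n) = n"
  by (simp_all add: deriv_mat_def)

lemma mult_mat_dim [simp]: "dim_row (mult_mat n) = n" "dim_col (mult_mat n) = n"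
  by (simp_all add: mult_mat_def)

lemma deriv_mat_mult_entry:
  assumes A: "A \<in> carrier_mat n n" and ij: "i < n" "j < n"
  shows "(deriv_mat n * A) $$ (i, j) = (if Suc i < n then A $$ (Suc i, j) else 0)"
    and "(A * deriv_mat n) $$ (i, j) = (if j = 0 then 0 else A $$ (i, j - 1))"
proof -
  have "(\<Sum>k<n. deriv_mat n $$ (i, k) * A $$ (k, j)) = (\<Sum>k<n. if k = Suc i then A $$ (k, j) else 0)"
    using ij by (intro sum.cong) (auto simp: deriv_mat_def)
  then show "(deriv_mat n * A) $$ (i, j) = (if Suc i < n then A $$ (Suc i, j) else 0)"
    unfolding mult_entry[OF deriv_mat_carrier A ij] by simp
  have "(\<Sum>k<n. A $$ (i, k) * deriv_mat n $$ (k, j)) = (\<Sum>k<n. if k = j - 1 then (if j = 0 then 0 else A $$ (i, k)) else 0)"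
    using ij by (intro sum.cong) (auto simp: deriv_mat_def)
  then show "(A * deriv_mat n) $$ (i, j) = (if j = 0 then 0 else A $$ (i, j - 1))"
    unfolding mult_entry[OF A deriv_mat_carrier ij] using ij by simp
qed

lemma mat_poly_deriv_entry:
  assumes "i < n" "j < n"
  shows "mat_poly n f (deriv_mat n) $$ (i, j) = (if i \<le> j then coeff f (j - i) else 0)"
  using assms
proof (induction f arbitrary: i)
  case (pCons c f)
  have "mat_poly n (pCons c f) (deriv_mat n) $$ (i, j) =
      (if i = j then c else 0) + (deriv_mat n * mat_poly n f (deriv_mat n)) $$ (i, j)"
    using pCons.prems by (simp add: mat_poly_pCons del: index_mult_mat(1))
  also have "\<dots> = (if i = j then c else 0) + (if Suc i < n then mat_poly n f (deriv_mat n) $$ (Suc i, j) else 0)"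
    using pCons.prems by (simp only: deriv_mat_mult_entry(1)[OF mat_poly_carrier])
  also have "\<dots> = (if i \<le> j then coeff (pCons c f) (j - i) else 0)"
  proof -
    have "coeff (pCons c f) (j - i) = coeff f (j - Suc i)" if "i < j"
      using that by (metis Suc_diff_Suc coeff_pCons_Suc)
    then show ?thesis
      using pCons.IH[of "Suc i"] pCons.prems by (cases "i = j") (auto simp: Suc_le_eq)
  qed
  finally show ?case .
qed simp

text \<open>The derivative is a single nilpotent block, so only polynomials in it commute with it.\<close>

lemma commutes_with_deriv:
  assumes M: "M \<in> carrier_mat n n" and com: "deriv_mat n * M = M * deriv_mat n"
  obtains f where "M = mat_poly n f (deriv_mat n)"
proof -
  have step: "M $$ (Suc i, j) = (if j = 0 then 0 else M $$ (i, j - 1))" if "Suc i < n" "j < n" for i j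
    using deriv_mat_mult_entry[OF M, of i j] that by (simp add: com)
  have M_entry: "M $$ (i, j) = (if i \<le> j then M $$ (0, j - i) else 0)" if "i < n" "j < n" for i j
    using that
  proof (induction i arbitrary: j)
    case (Suc i)
    show ?case
    proof (cases j)
      case (Suc k)
      then show ?thesis using step[of i j] Suc.IH[of k] Suc.prems by simp
    qed (use step[of i 0] Suc.prems in simp)
  qed simp
  define f where "f = Poly (map (\<lambda>k. M $$ (0, k)) [0..<n])"
  have "M = mat_poly n f (deriv_mat n)"
  proof (rule eq_matI)
    fix i j assume "i < dim_row (mat_poly n f (deriv_mat n))" "j < dim_col (mat_poly n f (deriv_mat n))"
    then show "M $$ (i, j) = mat_poly n f (deriv_mat n) $$ (i, j)"
      by (simp add: M_entry[of i j] mat_poly_deriv_entry f_def coeff_Poly_eq nth_default_def less_imp_diff_less)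
  qed (use M in auto)
  then show ?thesis by (rule that)
qed

lemma mat_poly_deriv_nilpotent: "mat_poly n (monom 1 n * f) (deriv_mat n) = 0\<^sub>m n n"
  by (intro eq_matI) (auto simp: mat_poly_deriv_entry coeff_monom_mult)

text \<open>A kernel vector is a polynomial of degree less than \<open>n\<close> with \<open>n\<close> roots.\<close>

lemma vandermonde_invertible:
  fixes x :: "nat \<Rightarrow> complex"
  assumes inj: "inj_on x {..<n}"
  obtains W where "W \<in> carrier_mat n n" "mat n n (\<lambda>(a, b). x a ^ b / fact b) * W = 1\<^sub>m n"
    "W * mat n n (\<lambda>(a, b). x a ^ b / fact b) = 1\<^sub>m n"
proof -
  let ?V = "mat n n (\<lambda>(a, b). x a ^ b / fact b)"
  show ?thesis
  proof (rule inverse_if_kernel_trivial[of ?V n])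
    fix v :: "complex vec" assume v: "v \<in> carrier_vec n" and 0: "?V *\<^sub>v v = 0\<^sub>v n"
    define p where "p = Poly (map (\<lambda>b. v $ b / fact b) [0..<n])"
    have coeff_p: "coeff p b = (if b < n then v $ b / fact b else 0)" for b
      by (simp add: p_def coeff_Poly_eq nth_default_def)
    have "poly p (x a) = 0" if a: "a < n" for a
    proof -
      have "degree p \<le> n - 1"
        by (intro degree_le allI impI) (auto simp: coeff_p)
      then have "poly p (x a) = (\<Sum>b\<le>n - 1. coeff p b * x a ^ b)"
        unfolding poly_altdef by (intro sum.mono_neutral_left) (auto simp: coeff_eq_0)
      also have "\<dots> = (\<Sum>b<n. x a ^ b / fact b * v $ b)"
        using a by (intro sum.cong) (auto simp: coeff_p)
      also have "\<dots> = (?V *\<^sub>v v) $ a"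
        using a v by (simp add: scalar_prod_def atLeast0LessThan)
      finally show ?thesis using a by (simp add: 0)
    qed
    then have roots: "x ` {..<n} \<subseteq> {z. poly p z = 0}" by auto
    have "p = 0"
    proof (rule ccontr)
      assume p: "p \<noteq> 0"
      have "n \<le> card {z. poly p z = 0}"
        using card_mono[OF poly_roots_finite[OF p] roots] inj by (simp add: card_image)
      also have "\<dots> \<le> degree p" by (rule card_poly_roots_bound[OF p])
      finally have "coeff p (degree p) = 0" by (simp add: coeff_p)
      then show False using p by simp
    qed
    then have "v $ b = 0" if "b < n" for b
      using coeff_p[of b] that by simp
    then show "v = 0\<^sub>v n" using v by (intro eq_vecI) auto
  qed (use that in auto)
qed

text \<open>Evaluation at the points \<open>x\<^sub>a\<close> turns the multiplication by \<open>z\<close> modulo \<open>P = \<Prod>(z - x\<^sub>a)\<close> into the diagonal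
  matrix. This multiplication differs from the truncated one in the last column only, and its commutator with the
  derivative, up to the identity, is a matrix of rank one with last column \<open>n c\<close>, a multiple of \<open>P'\<close>. For
  \<open>P = z\<^sup>n\<close> the last column is \<open>n e\<close>, with \<open>e\<close> the last unit vector. A unipotent polynomial \<open>U\<close> in the derivative
  takes \<open>e\<close> to \<open>c\<close>, and conjugation by it makes the two commutators equal; then the difference of the two
  multiplications commutes with the derivative and hence is a polynomial in it.\<close>

lemma diagonal_from_base:
  assumes inj: "inj_on x {..<n}"
  obtains p P Q where "similar_mat_wit (mult_mat n + mat_poly n p (deriv_mat n)) (diag n x) P Q"
proof (cases "n = 0")
  case True
  then have "mult_mat n + mat_poly n 0 (deriv_mat n) = diag n x" by (intro eq_matI) auto
  then show ?thesis
    using that[of 0] similar_mat_wit_refl[OF diag_carrier] by metis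
next
  case False
  define l where "l = n - 1"
  have n: "n = Suc l" using False by (simp add: l_def)
  let ?J = "deriv_mat n" and ?Z = "mult_mat n"
  define V where "V = mat n n (\<lambda>(a, b). x a ^ b / fact b)"
  have V: "V \<in> carrier_mat n n" by (simp add: V_def)
  obtain W where W: "W \<in> carrier_mat n n" "V * W = 1\<^sub>m n" "W * V = 1\<^sub>m n"
    unfolding V_def by (rule vandermonde_invertible[OF inj])
  \<comment> \<open>\<open>C\<close> is the multiplication modulo \<open>P\<close>: its last column \<open>- a\<close> is found by solving for the values of
    \<open>z\<^sup>n / (n - 1)!\<close> at the points.\<close>
  define y where "y = vec n (\<lambda>k. - (x k ^ n / fact l))"
  define a where "a = W *\<^sub>v y"
  have y: "y \<in> carrier_vec n" by (simp add: y_def)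
  have a: "a \<in> carrier_vec n" using W(1) y by (simp add: a_def)
  have Va: "V *\<^sub>v a = y"
    using sq_mult_vec[OF V W(1) y] W(2) y by (simp add: a_def)
  define C where "C = mat n n (\<lambda>(i, j). ?Z $$ (i, j) - (if j = l then a $ i else 0))"
  have C: "C \<in> carrier_mat n n" by (simp add: C_def)
  have VC: "V * C = diag n x * V"
  proof (rule eq_matI)
    fix r b assume "r < dim_row (diag n x * V)" "b < dim_col (diag n x * V)"
    then have rb: "r < n" "b < n" using V by auto
    have "(V * C) $$ (r, b) = (\<Sum>k<n. V $$ (r, k) * ?Z $$ (k, b)) - (if b = l then (\<Sum>k<n. V $$ (r, k) * a $ k) else 0)"
      unfolding mult_entry[OF V C rb] using rb
      by (auto simp: C_def right_diff_distrib sum_subtractf intro!: sum.cong)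
    also have "(\<Sum>k<n. V $$ (r, k) * a $ k) = (V *\<^sub>v a) $ r"
      using rb V a by (simp add: scalar_prod_def atLeast0LessThan)
    also have "(\<Sum>k<n. V $$ (r, k) * ?Z $$ (k, b)) = (\<Sum>k<n. if k = Suc b then V $$ (r, k) * of_nat k else 0)"
      using rb by (intro sum.cong) (auto simp: mult_mat_def)
    also have "\<dots> = (if Suc b < n then x r * V $$ (r, b) else 0)"
    proof -
      have "t / (d * f) * d = t / f" if "d \<noteq> 0" for t d f :: complex
        using that by simp
      from this[of "of_nat (Suc b)" "x r ^ Suc b" "fact b"]
      have "x r ^ Suc b / fact (Suc b) * of_nat (Suc b) = x r * (x r ^ b / fact b)"
        unfolding fact_Suc by (simp del: of_nat_Suc)
      then show ?thesis
        using rb by (simp add: V_def del: of_nat_Suc fact_Suc power_Suc)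
    qed
    finally show "(V * C) $$ (r, b) = (diag n x * V) $$ (r, b)"
      unfolding diag_mult_entry(1)[OF V rb] Va using rb by (auto simp: y_def V_def n)
  qed (use V C in auto)
  define c where "c i = (if i = l then 1 else a $ Suc i / of_nat n)" for i
  define u where "u = Poly (map (\<lambda>k. c (l - k)) [0..<n])"
  have coeff_u: "coeff u k = (if k < n then c (l - k) else 0)" for k
    by (simp add: u_def coeff_Poly_eq nth_default_def)
  define U where "U = mat_poly n u ?J"
  have U: "U \<in> carrier_mat n n" by (simp add: U_def)
  have U_entry: "U $$ (i, j) = (if i \<le> j then c (l - (j - i)) else 0)" if "i < n" "j < n" for i j
    using that by (auto simp: U_def mat_poly_deriv_entry coeff_u)
  have UJ: "U * ?J = ?J * U"
    unfolding U_def using mat_poly_mult[OF deriv_mat_carrier, of n u "[:0, 1:]"] mat_poly_mult[OF deriv_mat_carrier, of n "[:0, 1:]" u]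
    by (simp add: mult.commute)
  \<comment> \<open>\<open>N\<close> and \<open>N0\<close> are the two matrices of rank one, and \<open>U\<close> takes the one to the other.\<close>
  define N where "N = mat n n (\<lambda>(i, j). if j = l then of_nat n * c i else 0)"
  define N0 where "N0 = mat n n (\<lambda>(i, j). if i = l \<and> j = l then of_nat n else (0::complex))"
  have N: "N \<in> carrier_mat n n" "N0 \<in> carrier_mat n n" by (simp_all add: N_def N0_def)
  have UN: "U * N0 = N"
  proof (rule eq_matI)
    fix i j assume "i < dim_row N" "j < dim_col N"
    then have ij: "i < n" "j < n" using N by auto
    have "(U * N0) $$ (i, j) = (\<Sum>k<n. if k = l then (if j = l then of_nat n * c i else 0) else 0)"
      unfolding mult_entry[OF U N(2) ij] using ij n by (intro sum.cong) (auto simp: N0_def U_entry)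
    also have "\<dots> = N $$ (i, j)" using ij n by (simp add: N_def)
    finally show "(U * N0) $$ (i, j) = N $$ (i, j)" .
  qed (use U N in auto)
  have NU: "N * U = N"
  proof (rule eq_matI)
    fix i j assume "i < dim_row N" "j < dim_col N"
    then have ij: "i < n" "j < n" using N by auto
    have "(N * U) $$ (i, j) = (\<Sum>k<n. if k = l then (if j = l then of_nat n * c i else 0) else 0)"
      unfolding mult_entry[OF N(1) U ij] using ij n by (intro sum.cong) (auto simp: N_def U_entry c_def)
    also have "\<dots> = N $$ (i, j)" using ij n by (simp add: N_def)
    finally show "(N * U) $$ (i, j) = N $$ (i, j)" .
  qed (use U N in auto)
  have JZ: "?J * ?Z + N0 = ?Z * ?J + 1\<^sub>m n"
  proof (rule eq_matI)
    fix i j assume "i < dim_row (?Z * ?J + 1\<^sub>m n)" "j < dim_col (?Z * ?J + 1\<^sub>m n)"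
    then have ij: "i < n" "j < n" by auto
    then show "(?J * ?Z + N0) $$ (i, j) = (?Z * ?J + 1\<^sub>m n) $$ (i, j)"
      using deriv_mat_mult_entry[OF mult_mat_carrier ij] n
      by (auto simp: mult_mat_def N0_def simp del: index_mult_mat(1))
  qed (use N in auto)
  have JC: "?J * C + N = C * ?J + 1\<^sub>m n"
  proof (rule eq_matI)
    fix i j assume "i < dim_row (C * ?J + 1\<^sub>m n)" "j < dim_col (C * ?J + 1\<^sub>m n)"
    then have ij: "i < n" "j < n" by auto
    then show "(?J * C + N) $$ (i, j) = (C * ?J + 1\<^sub>m n) $$ (i, j)"
      using deriv_mat_mult_entry[OF C ij] n C N of_nat_neq_0[of l, where 'a = complex, unfolded of_nat_Suc]
      by (auto simp: mult_mat_def N_def C_def c_def simp del: index_mult_mat(1))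
  qed (use N C in auto)
  define M where "M = U * ?Z - C * U"
  have M: "M \<in> carrier_mat n n" using C U by (simp add: M_def minus_carrier_mat)
  have "?J * M = M * ?J"
  proof (rule eq_matI)
    fix i j assume "i < dim_row (M * ?J)" "j < dim_col (M * ?J)"
    then have ij: "i < n" "j < n" using M by auto
    have c4: "U * (?J * ?Z) \<in> carrier_mat n n" "U * (?Z * ?J) \<in> carrier_mat n n" "?J * C * U \<in> carrier_mat n n" "C * ?J * U \<in> carrier_mat n n"
      using U C by (simp_all add: sq_mult)
    have "U * (?J * ?Z) + N = U * (?Z * ?J) + U"
      using arg_cong[OF JZ, of "\<lambda>t. U * t"] U N by (simp add: sq_distrib_left[where n = n] sq_mult UN)
    from arg_cong[OF this, of "\<lambda>t. t $$ (i, j)"]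
    have 1: "(U * (?J * ?Z)) $$ (i, j) + N $$ (i, j) = (U * (?Z * ?J)) $$ (i, j) + U $$ (i, j)"
      using c4 N U ij by (simp del: index_mult_mat(1))
    have "?J * C * U + N = C * ?J * U + U"
      using arg_cong[OF JC, of "\<lambda>t. t * U"] U N C by (simp add: sq_distrib_right[where n = n] sq_mult NU)
    from arg_cong[OF this, of "\<lambda>t. t $$ (i, j)"]
    have 2: "(?J * C * U) $$ (i, j) + N $$ (i, j) = (C * ?J * U) $$ (i, j) + U $$ (i, j)"
      using c4 N U ij by (simp del: index_mult_mat(1))
    have JM: "?J * M = U * (?J * ?Z) - ?J * C * U"
      unfolding M_def using U C sq_assoc[OF U deriv_mat_carrier mult_mat_carrier] sq_assoc[OF deriv_mat_carrier U mult_mat_carrier]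
        sq_assoc[OF deriv_mat_carrier C U]
      by (simp add: mult_minus_distrib_mat[of _ n n _ n] sq_mult UJ)
    have MJ: "M * ?J = U * (?Z * ?J) - C * ?J * U"
      unfolding M_def using U C sq_assoc[OF U mult_mat_carrier deriv_mat_carrier] sq_assoc[OF C U deriv_mat_carrier]
        sq_assoc[OF C deriv_mat_carrier U]
      by (simp add: minus_mult_distrib_mat[of _ n n _ _ n] sq_mult UJ)
    have minus: "(A - B) $$ (i, j) = A $$ (i, j) - B $$ (i, j)" if "B \<in> carrier_mat n n" for A B :: "complex mat"
      using that ij by simp
    have cancel: "p - q = p' - q'" if "p + r = p' + t" "q + r = q' + t" for p q r p' q' t :: complex
      using that by (metis add_diff_cancel_right)
    show "(?J * M) $$ (i, j) = (M * ?J) $$ (i, j)"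
      unfolding JM MJ minus[OF c4(3)] minus[OF c4(4)] by (rule cancel[OF 1 2])
  qed (use M in auto)
  then obtain f where f: "M = mat_poly n f ?J"
    by (rule commutes_with_deriv[OF M])
  obtain h where "u = pCons 1 h"
    by (metis coeff_u coeff_pCons_0 c_def diff_zero n pCons_cases zero_less_Suc)
  then have "bezout u (monom 1 1)"
    unfolding bezout_def by (intro exI[of _ 1] exI[of _ "- h"]) (simp add: monom_altdef)
  then have "bezout u (monom 1 n)"
    using bezout_power[of u "monom 1 1" n] by (simp add: monom_power)
  then obtain g g' where g: "g * u + g' * monom 1 n = 1" unfolding bezout_def by blast
  define A where "A = mat_poly n g ?J"
  have A: "A \<in> carrier_mat n n" by (simp add: A_def)
  have "mat_poly n (g * u + monom 1 n * g') ?J = 1\<^sub>m n"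
    using g by (simp add: mult.commute)
  then have AU: "A * U = 1\<^sub>m n"
    by (simp add: mat_poly_add mat_poly_deriv_nilpotent mat_poly_mult A_def U_def
        right_add_zero_mat[OF sq_mult[OF mat_poly_carrier mat_poly_carrier]])
  then have UA: "U * A = 1\<^sub>m n"
    unfolding A_def U_def by (simp add: mat_poly_mult[symmetric] mult.commute)
  have AM: "A * M = mat_poly n (g * f) ?J"
    by (simp add: A_def f mat_poly_mult)
  define p where "p = - (g * f)"
  have CU: "C * U = U * ?Z - M"
    using U C by (intro eq_matI) (auto simp: M_def simp del: index_mult_mat(1))
  have "A * (C * U) = A * (U * ?Z) - A * M"
    unfolding CU using A U M by (intro mult_minus_distrib_mat[of _ n n _ n]) (auto simp: sq_mult)
  also have "A * (U * ?Z) = ?Z"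
    using sq_assoc[OF A U mult_mat_carrier] by (simp add: AU left_mult_one_mat[of _ n n])
  also have "?Z - A * M = ?Z + mat_poly n p ?J"
    using mat_poly_diff[OF deriv_mat_carrier, of n 0 "g * f"] by (intro eq_matI) (auto simp: AM p_def)
  finally have Zp: "?Z + mat_poly n p ?J = A * (C * U)" ..
  have "C = W * diag n x * V"
    using sq_assoc[OF W(1) V C] sq_assoc[OF W(1) diag_carrier V] W(3) C by (simp add: VC)
  then have "?Z + mat_poly n p ?J = (A * W) * diag n x * (V * U)"
    unfolding Zp using A W(1) V U by (simp add: sq_mat[where n = n])
  moreover have "(A * W) * (V * U) = 1\<^sub>m n"
  proof -
    have "W * (V * U) = U" using sq_assoc[OF W(1) V U] W(3) U by simp
    then show ?thesis using sq_assoc[OF A W(1), of "V * U"] V U AU by (simp add: sq_mult)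
  qed
  moreover have "(V * U) * (A * W) = 1\<^sub>m n"
  proof -
    have "U * (A * W) = W" using sq_assoc[OF U A W(1)] UA W(1) by simp
    then show ?thesis using sq_assoc[OF V U, of "A * W"] A W by (simp add: sq_mult)
  qed
  ultimately have "similar_mat_wit (?Z + mat_poly n p ?J) (diag n x) (A * W) (V * U)"
    using A W(1) V U by (intro similar_mat_witI[of _ _ n]) (auto simp: sq_mult)
  then show ?thesis by (rule that)
qed

section \<open>Transitivity\<close>

lemma CM_relation_base: "CM_relation n (mult_mat n) (deriv_mat n + c \<cdot>\<^sub>m 1\<^sub>m n)"
proof -
  let ?J = "deriv_mat n" and ?Z = "mult_mat n"
  have "?Z * (?J + c \<cdot>\<^sub>m 1\<^sub>m n) = ?Z * ?J + c \<cdot>\<^sub>m ?Z" "(?J + c \<cdot>\<^sub>m 1\<^sub>m n) * ?Z = ?J * ?Z + c \<cdot>\<^sub>m ?Z"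
    by (simp_all add: sq_mat[where n = n] right_mult_one_mat[of _ n n] left_mult_one_mat[of _ n n])
  then have *: "(?Z * (?J + c \<cdot>\<^sub>m 1\<^sub>m n) - (?J + c \<cdot>\<^sub>m 1\<^sub>m n) * ?Z + 1\<^sub>m n) $$ (a, b) =
      (if Suc a = n then of_nat n else 0) * (if Suc b = n then 1 else 0)" if "a < n" "b < n" for a b
    using that deriv_mat_mult_entry[OF mult_mat_carrier that]
    by (auto simp: mult_mat_def simp del: index_mult_mat(1))
  show ?thesis
    unfolding CM_relation_def outer_product_def
    by (rule exI[of _ "\<lambda>a. if Suc a = n then of_nat n else 0"], rule exI[of _ "\<lambda>b. if Suc b = n then 1 else 0"])
      (intro allI impI *)
qed

text \<open>The rank one condition determines the off-diagonal entries of \<open>Y\<close> up to conjugation by a diagonal matrix.\<close>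

lemma off_diagonal_unique:
  assumes inj: "inj_on x {..<n}" and Y: "Y \<in> carrier_mat n n" "Y' \<in> carrier_mat n n"
    and CM: "CM_relation n (diag n x) Y" "CM_relation n (diag n x) Y'"
  obtains s where "\<And>a. a < n \<Longrightarrow> s a \<noteq> 0"
    "\<And>a b. a < n \<Longrightarrow> b < n \<Longrightarrow> a \<noteq> b \<Longrightarrow> Y' $$ (a, b) = s a * Y $$ (a, b) / s b"
proof -
  obtain u v where uv: "\<And>a. a < n \<Longrightarrow> u a * v a = 1"
    "\<And>a b. a < n \<Longrightarrow> b < n \<Longrightarrow> a \<noteq> b \<Longrightarrow> (x a - x b) * Y $$ (a, b) = u a * v b"
    using CM_relation_diag[OF Y(1) CM(1)] by blast
  obtain u' v' where uv': "\<And>a. a < n \<Longrightarrow> u' a * v' a = 1"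
    "\<And>a b. a < n \<Longrightarrow> b < n \<Longrightarrow> a \<noteq> b \<Longrightarrow> (x a - x b) * Y' $$ (a, b) = u' a * v' b"
    using CM_relation_diag[OF Y(2) CM(2)] by blast
  have nz: "u a \<noteq> 0" "u' a \<noteq> 0" if "a < n" for a
    using uv(1)[OF that] uv'(1)[OF that] by auto
  have v: "v a = 1 / u a" "v' a = 1 / u' a" if "a < n" for a
    using uv(1)[OF that] uv'(1)[OF that] nz[OF that] by (simp_all add: field_simps)
  show ?thesis
  proof (rule that[of "\<lambda>a. u' a / u a"])
    fix a b assume ab: "a < n" "b < n" "a \<noteq> b"
    then have d: "x a - x b \<noteq> 0" using inj by (auto dest: inj_onD)
    have "Y $$ (a, b) = u a / u b / (x a - x b)" "Y' $$ (a, b) = u' a / u' b / (x a - x b)"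
      using uv(2)[OF ab] uv'(2)[OF ab] d v[OF ab(2)]
      by (metis mult.right_neutral nonzero_mult_div_cancel_left times_divide_eq_right)+
    moreover have "p / q * (q / r / d) / (t / r) = p / t / d" if "q \<noteq> 0" "r \<noteq> 0" for p q r t d :: complex
      using that by simp
    ultimately show "Y' $$ (a, b) = u' a / u a * Y $$ (a, b) / (u' b / u b)"
      using nz ab by simp
  qed (use nz in auto)
qed

text \<open>In the base tuple the second matrix at index \<open>i\<close> has the only eigenvalue \<open>i\<close>, so one shear can treat each
  block as needed; the first matrices become diagonal with the prescribed eigenvalues. What is left is the
  diagonal of the second matrices, for which all eigenvalues have to be distinct.\<close>

theorem base_equivalent_to_diagonal:
  assumes I: "finite I" and Y: "\<And>i. i \<in> I \<Longrightarrow> Y i \<in> carrier_mat (n i) (n i)"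
    and CM: "\<And>i. i \<in> I \<Longrightarrow> CM_relation (n i) (diag (n i) (x i)) (Y i)"
    and dist: "\<And>i j a b. i \<in> I \<Longrightarrow> j \<in> I \<Longrightarrow> a < n i \<Longrightarrow> b < n j \<Longrightarrow> x i a = x j b \<Longrightarrow> i = j \<and> a = b"
  shows "equivalent I n (\<lambda>i. (mult_mat (n i), deriv_mat (n i) + of_nat i \<cdot>\<^sub>m 1\<^sub>m (n i))) (\<lambda>i. (diag (n i) (x i), Y i))"
proof -
  let ?J = "\<lambda>i. deriv_mat (n i) + of_nat i \<cdot>\<^sub>m 1\<^sub>m (n i)"
  let ?T0 = "\<lambda>i. (mult_mat (n i), ?J i)"
  have J: "?J i \<in> carrier_mat (n i) (n i)" for i by simp
  have sq0: "square_pairs I n ?T0" by (simp add: square_pairs_def square_pair_def)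
  have inj: "inj_on (x i) {..<n i}" if "i \<in> I" for i
    using dist[OF that that] by (auto intro!: inj_onI)
  have "\<forall>i\<in>I. \<exists>p P Q. similar_mat_wit (mult_mat (n i) + mat_poly (n i) p (deriv_mat (n i))) (diag (n i) (x i)) P Q"
  proof
    fix i assume "i \<in> I"
    show "\<exists>p P Q. similar_mat_wit (mult_mat (n i) + mat_poly (n i) p (deriv_mat (n i))) (diag (n i) (x i)) P Q"
      by (rule diagonal_from_base[OF inj[OF \<open>i \<in> I\<close>]]) blast
  qed
  from bchoice[OF this] obtain p where
    "\<forall>i\<in>I. \<exists>P Q. similar_mat_wit (mult_mat (n i) + mat_poly (n i) (p i) (deriv_mat (n i))) (diag (n i) (x i)) P Q" ..
  from bchoice[OF this] obtain P where
    "\<forall>i\<in>I. \<exists>Q. similar_mat_wit (mult_mat (n i) + mat_poly (n i) (p i) (deriv_mat (n i))) (diag (n i) (x i)) (P i) Q" ..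
  from bchoice[OF this] obtain Q where
    pPQ: "\<forall>i\<in>I. similar_mat_wit (mult_mat (n i) + mat_poly (n i) (p i) (deriv_mat (n i))) (diag (n i) (x i)) (P i) (Q i)" ..
  define K where "K = sum n I"
  obtain f where f: "\<And>y. y \<in> of_nat ` I \<Longrightarrow> [:- y, 1:] ^ K dvd f - pcompose (p (the_inv_into I of_nat y)) [:- y, 1:]"
    using poly_chinese_remainder[of "of_nat ` I" K "\<lambda>y. pcompose (p (the_inv_into I of_nat y)) [:- y, 1:]"] I by blast
  have fJ: "mat_poly (n i) f (?J i) = mat_poly (n i) (p i) (deriv_mat (n i))" if i: "i \<in> I" for i
  proof -
    have "inj_on (of_nat :: nat \<Rightarrow> complex) I" by (rule inj_onI) simp
    then have dvd: "[:- of_nat i, 1:] ^ K dvd f - pcompose (p i) [:- of_nat i, 1:]"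
      using f[of "of_nat i"] i by (simp add: the_inv_into_f_f)
    have "upper_triangular (?J i)"
      by (auto simp: upper_triangular_def deriv_mat_def)
    then have "char_poly (?J i) = (\<Prod>a\<leftarrow>diag_mat (?J i). [:- a, 1:])"
      using char_poly_upper_triangular[OF J] by blast
    moreover have "set (diag_mat (?J i)) \<subseteq> {of_nat i}"
      by (auto simp: diag_mat_def deriv_mat_def)
    ultimately have "spectrum (?J i) \<subseteq> {of_nat i}"
      by (auto simp: spectrum_root_char_poly[OF J] poly_prod_list prod_list_zero_iff)
    then have "mat_poly (n i) (f - pcompose (p i) [:- of_nat i, 1:]) (?J i) = 0\<^sub>m (n i) (n i)"
      using member_le_sum[of i I n] I i dvd by (intro mat_poly_vanish[OF J, of "{of_nat i}" _ K]) (auto simp: K_def)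
    then have "mat_poly (n i) (f - pcompose (p i) [:- of_nat i, 1:] + pcompose (p i) [:- of_nat i, 1:]) (?J i) =
        mat_poly (n i) (pcompose (p i) [:- of_nat i, 1:]) (?J i)"
      unfolding mat_poly_add by (simp add: left_add_zero_mat[of _ "n i" "n i"])
    also have "\<dots> = mat_poly (n i) (p i) (mat_poly (n i) [:- of_nat i, 1:] (?J i))"
      by (rule mat_poly_pcompose[OF J])
    also have "mat_poly (n i) [:- of_nat i, 1:] (?J i) = deriv_mat (n i)"
      unfolding mat_poly_linear[OF J] by (intro eq_matI) auto
    finally show ?thesis by simp
  qed
  let ?T1 = "\<lambda>i. (mult_mat (n i) + mat_poly (n i) f (?J i), ?J i)"
  have T1: "equivalent I n ?T0 ?T1"
    using equivalent_x_shear[OF sq0, of f] by simp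
  have sq1: "square_pairs I n ?T1" by (rule equivalent_square_pairs[OF T1])
  define Y2 where "Y2 i = Q i * ?J i * P i" for i
  let ?T2 = "\<lambda>i. (diag (n i) (x i), Y2 i)"
  have T2: "equivalent I n ?T1 ?T2"
  proof (rule equivalent_conj[OF sq1])
    fix i assume i: "i \<in> I"
    have s: "similar_mat_wit (mult_mat (n i) + mat_poly (n i) f (?J i)) (diag (n i) (x i)) (P i) (Q i)"
      unfolding fJ[OF i] using pPQ i by blast
    have "mult_mat (n i) + mat_poly (n i) f (?J i) \<in> carrier_mat (n i) (n i)" by simp
    note w = similar_mat_witD2[OF this s]
    have "similar_mat_wit (Y2 i) (?J i) (Q i) (P i)"
      unfolding Y2_def using w(6,7) by (intro similar_mat_witI[OF w(2,1) refl]) (auto intro!: sq_mult)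
    from similar_mat_wit_sym[OF this]
    show "simul_similar (?T1 i) (?T2 i)"
      using s by (auto simp: simul_similar_def)
  qed
  have T02: "equivalent I n ?T0 ?T2" by (rule equivalent_trans[OF T1 T2 sq0])
  have sq2: "square_pairs I n ?T2" by (rule equivalent_square_pairs[OF T02])
  have Y2: "Y2 i \<in> carrier_mat (n i) (n i)" if "i \<in> I" for i
    using square_pairsD(2)[OF sq2 that] by simp
  have CM2: "CM_relation (n i) (diag (n i) (x i)) (Y2 i)" if "i \<in> I" for i
    using equivalent_CM_relation[OF sq0 T02 that] CM_relation_base by simp
  have "\<forall>i\<in>I. \<exists>s. (\<forall>a<n i. s a \<noteq> 0) \<and> (\<forall>a<n i. \<forall>b<n i. a \<noteq> b \<longrightarrow> Y i $$ (a, b) = s a * Y2 i $$ (a, b) / s b)"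
  proof
    fix i assume i: "i \<in> I"
    show "\<exists>s. (\<forall>a<n i. s a \<noteq> 0) \<and> (\<forall>a<n i. \<forall>b<n i. a \<noteq> b \<longrightarrow> Y i $$ (a, b) = s a * Y2 i $$ (a, b) / s b)"
      by (rule off_diagonal_unique[OF inj[OF i] Y2[OF i] Y[OF i] CM2[OF i] CM[OF i]]) blast
  qed
  from bchoice[OF this] obtain s where
    s: "\<forall>i\<in>I. (\<forall>a<n i. s i a \<noteq> 0) \<and> (\<forall>a<n i. \<forall>b<n i. a \<noteq> b \<longrightarrow> Y i $$ (a, b) = s i a * Y2 i $$ (a, b) / s i b)" ..
  define S where "S i = diag (n i) (s i)" for i
  define S' where "S' i = diag (n i) (\<lambda>a. 1 / s i a)" for i
  define Y3 where "Y3 i = S i * Y2 i * S' i" for i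
  let ?T3 = "\<lambda>i. (diag (n i) (x i), Y3 i)"
  have SS': "S i * S' i = 1\<^sub>m (n i)" "S' i * S i = 1\<^sub>m (n i)" if "i \<in> I" for i
    unfolding S_def S'_def using s that
    by (auto intro!: eq_matI simp: diag_mult_entry(1)[OF diag_carrier] diag_entry simp del: index_mult_mat(1))
  have T3: "equivalent I n ?T2 ?T3"
  proof (rule equivalent_conj[OF sq2])
    fix i assume i: "i \<in> I"
    have "similar_mat_wit (Y3 i) (Y2 i) (S i) (S' i)"
      unfolding Y3_def using Y2[OF i]
      by (intro similar_mat_witI[OF SS'[OF i] refl]) (auto intro!: sq_mult simp: S_def S'_def)
    moreover have "diag (n i) (x i) = S i * diag (n i) (x i) * S' i"
      unfolding S_def S'_def using s i
      by (auto intro!: eq_matI simp: diag_mult_entry(1)[OF diag_carrier] diag_mult_entry(2)[OF sq_mult[OF diag_carrier diag_carrier]] diag_entry simp del: index_mult_mat(1))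
    then have "similar_mat_wit (diag (n i) (x i)) (diag (n i) (x i)) (S i) (S' i)"
      by (intro similar_mat_witI[OF SS'[OF i]]) (auto simp: S_def S'_def)
    ultimately have "simul_similar (?T3 i) (?T2 i)"
      by (auto simp: simul_similar_def)
    then show "simul_similar (?T2 i) (?T3 i)"
      by (rule simul_similar_sym)
  qed
  have T03: "equivalent I n ?T0 ?T3" by (rule equivalent_trans[OF T02 T3 sq0])
  have sq3: "square_pairs I n ?T3" by (rule equivalent_square_pairs[OF T03])
  have Y3_off: "Y3 i $$ (a, b) = Y i $$ (a, b)" if "i \<in> I" "a < n i" "b < n i" "a \<noteq> b" for i a b
    unfolding Y3_def S_def S'_def diag_mult_entry(2)[OF sq_mult[OF diag_carrier Y2[OF that(1)]] that(2,3)]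
      diag_mult_entry(1)[OF Y2[OF that(1)] that(2,3)] using s that by simp
  \<comment> \<open>All eigenvalues are distinct, also those of different blocks, so a polynomial can correct all diagonals at once.\<close>
  define E where "E = (\<lambda>(i, a). x i a) ` (SIGMA i:I. {..<n i})"
  have "finite E" using I by (simp add: E_def)
  then obtain q where q: "\<And>y. y \<in> E \<Longrightarrow> [:- y, 1:] ^ 1 dvd
      q - (\<Sum>(i, a)\<in>(SIGMA i:I. {..<n i}). if x i a = y then [:Y i $$ (a, a) - Y3 i $$ (a, a):] else 0)"
    using poly_chinese_remainder[of E 1 "\<lambda>y. \<Sum>(i, a)\<in>(SIGMA i:I. {..<n i}). if x i a = y then [:Y i $$ (a, a) - Y3 i $$ (a, a):] else 0"]
    by blast
  have q: "poly q (x i a) = Y i $$ (a, a) - Y3 i $$ (a, a)" if i: "i \<in> I" "a < n i" for i a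
  proof -
    have "(\<Sum>(j, b)\<in>(SIGMA i:I. {..<n i}). if x j b = x i a then [:Y j $$ (b, b) - Y3 j $$ (b, b):] else 0) =
        (\<Sum>z\<in>(SIGMA i:I. {..<n i}). if z = (i, a) then [:Y i $$ (a, a) - Y3 i $$ (a, a):] else 0)"
    proof (rule sum.cong[OF refl])
      fix z assume "z \<in> (SIGMA i:I. {..<n i})"
      then obtain j b where z: "z = (j, b)" "j \<in> I" "b < n j" by auto
      show "(case z of (j, b) \<Rightarrow> if x j b = x i a then [:Y j $$ (b, b) - Y3 j $$ (b, b):] else 0) =
          (if z = (i, a) then [:Y i $$ (a, a) - Y3 i $$ (a, a):] else 0)"
      proof (cases "x j b = x i a")
        case True
        then have "j = i" "b = a" using dist[OF z(2) i(1) z(3) i(2)] by auto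
        then show ?thesis by (simp add: z(1))
      next
        case False
        then show ?thesis unfolding z(1) by auto
      qed
    qed
    also have "\<dots> = [:Y i $$ (a, a) - Y3 i $$ (a, a):]"
      using I i by simp
    finally have "[:- x i a, 1:] dvd q - [:Y i $$ (a, a) - Y3 i $$ (a, a):]"
      using q[of "x i a"] i by (auto simp: E_def)
    then show ?thesis by (simp add: poly_eq_0_iff_dvd[symmetric])
  qed
  have "equivalent I n ?T3 (\<lambda>i. (diag (n i) (x i), Y3 i + mat_poly (n i) q (diag (n i) (x i))))"
    using equivalent_y_shear[OF sq3, of q] by simp
  moreover have "Y3 i + mat_poly (n i) q (diag (n i) (x i)) = Y i" if i: "i \<in> I" for i
  proof (rule eq_matI)
    fix a b assume "a < dim_row (Y i)" "b < dim_col (Y i)"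
    then have ab: "a < n i" "b < n i" using Y[OF i] by auto
    then show "(Y3 i + mat_poly (n i) q (diag (n i) (x i))) $$ (a, b) = Y i $$ (a, b)"
      using q[OF i] Y3_off[OF i ab] by (cases "a = b") (auto simp: mat_poly_diag diag_entry)
  qed (use Y[OF i] in auto)
  ultimately have "equivalent I n ?T3 (\<lambda>i. (diag (n i) (x i), Y i))"
    unfolding equivalent_def by simp
  then show ?thesis
    by (rule equivalent_trans[OF T03 _ sq0])
qed

theorem theorem2:
  fixes m :: nat and n :: "nat \<Rightarrow> nat"
  assumes "m \<ge> 1"
    and "inj_on n {1..m}"
  shows "transitive_action symp_aut_group (CM_product m n) (diagonal_action m n)"
proof (rule transitive_action_if_equivalent)
  let ?I = "{1..m}"
  let ?base = "\<lambda>i. (mult_mat (n i), deriv_mat (n i) + of_nat i \<cdot>\<^sub>m 1\<^sub>m (n i))"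
  have sq: "square_pairs ?I n T" if "\<forall>i\<in>?I. T i \<in> CM_pairs (n i)" for T
    using that CM_pairs_square by (simp add: square_pairs_def)
  have base: "equivalent ?I n ?base T" if T: "\<forall>i\<in>?I. T i \<in> CM_pairs (n i)" for T
  proof -
    have CM: "CM_relation (n i) (fst (T i)) (snd (T i))" if "i \<in> ?I" for i
      using T that CM_relation_if_CM_pairs by (metis prod.collapse)
    obtain x Y where D: "equivalent ?I n T (\<lambda>i. (diag (n i) (x i), Y i))"
      and dist: "\<And>i j a b. i \<in> ?I \<Longrightarrow> j \<in> ?I \<Longrightarrow> a < n i \<Longrightarrow> b < n j \<Longrightarrow> x i a = x j b \<Longrightarrow> i = j \<and> a = b"
      by (rule equivalent_to_disjoint_diagonal[OF finite_atLeastAtMost assms(2) sq[OF T] CM]) blast+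
    have "equivalent ?I n ?base (\<lambda>i. (diag (n i) (x i), Y i))"
    proof (rule base_equivalent_to_diagonal[OF finite_atLeastAtMost _ _ dist])
      fix i assume i: "i \<in> ?I"
      show "Y i \<in> carrier_mat (n i) (n i)"
        using square_pairsD(2)[OF equivalent_square_pairs[OF D] i] by simp
      show "CM_relation (n i) (diag (n i) (x i)) (Y i)"
        using equivalent_CM_relation[OF sq[OF T] D i CM[OF i]] by simp
    qed
    moreover have "equivalent ?I n (\<lambda>i. (diag (n i) (x i), Y i)) T"
      by (rule equivalent_sym[OF D sq[OF T]])
    ultimately show ?thesis
      by (rule equivalent_trans) (simp add: square_pairs_def square_pair_def)
  qed
  fix T T' assume T: "\<forall>i\<in>?I. T i \<in> CM_pairs (n i)" and T': "\<forall>i\<in>?I. T' i \<in> CM_pairs (n i)"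
  have "equivalent ?I n T ?base"
    by (rule equivalent_sym[OF base[OF T]]) (simp add: square_pairs_def square_pair_def)
  then show "equivalent ?I n T T'"
    by (rule equivalent_trans[OF _ base[OF T'] sq[OF T]])
qed

end
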